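(* Let $A\in\hat{\mathcal C}_{W(\mathbb F)}$, let $(E,\rho,D)$ be a Cayley–Hamilton representation of $G$ over $A$, and let $N$ be a faithful left $E$-module which is finitely generated as an $A$-module, regarded as an $A[G]$-module via $\rho$. Then $N$ satisfies condition $\mathcal C$ as an $A[G]$-module if and only if the Cayley–Hamilton representation $(E,\rho,D)$ satisfies condition $\mathcal C$.
   Context: Fix a prime $p$ and a profinite group $G$ satisfying Mazur's condition $\Phi_p$ (for every open subgroup $H$ of $G$, the maximal pro-$p$ quotient of $H$ is topologically finitely generated); actions of $G$ are continuous. For an $R$-algebra $E$, a $d$-dimensional pseudorepresentation $D:E\to R$ is a multiplicative polynomial law of degree $d$ (maps $D_B:E\otimes_RB\to B$ natural in commutative $R$-algebras $B$, with $D_B(1)=1$, $D_B(xy)=D_B(x)D_B(y)$, $D_B(bx)=b^dD_B(x)$). $(E,D)$ is a Cayley–Hamilton $R$-algebra if $E$ is a finitely generated $R$-algebra and every $x\in E\otimes_RB$ ($B$ any commutative $R$-algebra) satisfies $\chi_D(x,x)=0$, where $\chi_D(x,t)=D_{B[t]}(t-x)$; then $E$ is finite over $R$. A Cayley–Hamilton representation of $G$ over $A$ is $(E,\rho,D)$ with $(E,D:E\to A)$ Cayley–Hamilton and $\rho:G\to E^\times$ a continuous homomorphism. Fix a finite field $\mathbb F$ of characteristic $p$; $\hat{\mathcal C}_{W(\mathbb F)}$ is the category of complete Noetherian local $W(\mathbb F)$-algebras with residue field $\mathbb F$. A stable condition $\mathcal C$ is a full subcategory of the category of finite-cardinality $\mathbb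 Z_p[G]$-modules closed under isomorphisms, submodules, quotients and finite direct sums; fix one. For a complete Noetherian local $\mathbb Z_p$-algebra $(A,\mathfrak m_A)$ and an $A[G]$-module $M$ finitely generated over $A$, $M$ satisfies $\mathcal C$ if $M/\mathfrak m_A^iM\in\mathcal C$ for all $i\ge1$. A Cayley–Hamilton representation $(E,\rho,D)$ of $G$ over such $A$ satisfies $\mathcal C$ if $E$, as a left $A[G]$-module via $\rho$ and left multiplication, satisfies $\mathcal C$. *)

theory Defs
  imports "HOL-Analysis.T1_Spaces" "HOL-Algebra.Algebra" "HOL-Computational_Algebra.Primes"
begin

section \<open>Profinite groups and Mazur's condition\<close>

definition topological_group :: "'g monoid \<Rightarrow> 'g topology \<Rightarrow> bool" where
  "topological_group G T \<longleftrightarrow> group G \<and> topspace T = carrier G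
     \<and> continuous_map (prod_topology T T) T (\<lambda>(x, y). x \<otimes>\<^bsub>G\<^esub> y)
     \<and> continuous_map T T (\<lambda>x. inv\<^bsub>G\<^esub> x)"

definition profinite_group :: "'g monoid \<Rightarrow> 'g topology \<Rightarrow> bool" where
  "profinite_group G T \<longleftrightarrow> topological_group G T \<and> compact_space T \<and> Hausdorff_space T
     \<and> (\<forall>S. connectedin T S \<longrightarrow> (\<exists>a. S \<subseteq> {a}))"

definition pro_p_group :: "nat \<Rightarrow> 'g monoid \<Rightarrow> 'g topology \<Rightarrow> bool" where
  "pro_p_group p G T \<longleftrightarrow> profinite_group G T
     \<and> (\<forall>N. N \<lhd> G \<and> openin T N \<longrightarrow> (\<exists>k. card (rcosets\<^bsub>G\<^esub> N) = p ^ k))"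

definition coset_topology :: "'g monoid \<Rightarrow> 'g topology \<Rightarrow> 'g set \<Rightarrow> 'g set topology" where
  "coset_topology G T N = topology (\<lambda>U. U \<subseteq> rcosets\<^bsub>G\<^esub> N \<and> openin T (\<Union>U))"

text \<open>The kernel of the projection of \<open>G\<close> onto its maximal pro-\<open>p\<close> quotient: the smallest closed
  normal subgroup with pro-\<open>p\<close> quotient.\<close>

definition pro_p_kernel :: "nat \<Rightarrow> 'g monoid \<Rightarrow> 'g topology \<Rightarrow> 'g set" where
  "pro_p_kernel p G T =
     \<Inter>{N. N \<lhd> G \<and> closedin T N \<and> pro_p_group p (G Mod N) (coset_topology G T N)}"

definition topologically_fin_gen :: "'g monoid \<Rightarrow> 'g topology \<Rightarrow> bool" where
  "topologically_fin_gen G T \<longleftrightarrow>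
     (\<exists>S. finite S \<and> S \<subseteq> carrier G \<and> T closure_of (generate G S) = carrier G)"

definition mazur_Phi :: "nat \<Rightarrow> 'g monoid \<Rightarrow> 'g topology \<Rightarrow> bool" where
  "mazur_Phi p G T \<longleftrightarrow>
     (\<forall>H. subgroup H G \<and> openin T H \<longrightarrow>
        (let GH = G\<lparr>carrier := H\<rparr>; TH = subtopology T H; K = pro_p_kernel p GH TH
         in topologically_fin_gen (GH Mod K) (coset_topology GH TH K)))"


section \<open>p-adic integers and Witt vectors\<close>

text \<open>\<open>\<int>\<^sub>p\<close> as the inverse limit of the rings \<open>\<int>/p\<^sup>n\<close>, each with carrier \<open>{0..<p\<^sup>n}\<close>.\<close>

definition padic_ints :: "nat \<Rightarrow> (nat \<Rightarrow> int) ring" where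
  "padic_ints p =
    \<lparr> carrier = {x. \<forall>n. x n \<in> {0..<int p ^ n} \<and> x (Suc n) mod int p ^ n = x n},
      monoid.mult = (\<lambda>x y n. (x n * y n) mod int p ^ n),
      one = (\<lambda>n. 1 mod int p ^ n),
      ring.zero = (\<lambda>n. 0),
      add = (\<lambda>x y n. (x n + y n) mod int p ^ n) \<rparr>"

text \<open>Integer polynomials in variables indexed by \<open>'v\<close>: the outer coefficients are indexed by
  monomials, which are finitely supported exponent functions.\<close>

type_synonym 'v int_mpoly = "('v \<Rightarrow>\<^sub>0 nat) \<Rightarrow>\<^sub>0 int"

definition mvar :: "'v \<Rightarrow> 'v int_mpoly" where
  "mvar v = Poly_Mapping.single (Poly_Mapping.single v 1) 1"

definition mpoly_eval :: "('r, 'm) ring_scheme \<Rightarrow> ('v \<Rightarrow> 'r) \<Rightarrow> 'v int_mpoly \<Rightarrow> 'r" where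
  "mpoly_eval R x P =
     (\<Oplus>\<^bsub>R\<^esub>e \<in> Poly_Mapping.keys P.
        [Poly_Mapping.lookup P e] \<cdot>\<^bsub>R\<^esub>
          (\<Otimes>\<^bsub>R\<^esub>v \<in> Poly_Mapping.keys e. x v [^]\<^bsub>R\<^esub> Poly_Mapping.lookup e v))"

definition ghost :: "nat \<Rightarrow> nat \<Rightarrow> (nat \<Rightarrow> 'r::comm_ring_1) \<Rightarrow> 'r" where
  "ghost p n x = (\<Sum>i\<le>n. of_nat p ^ i * x i ^ (p ^ (n - i)))"

text \<open>By Witt's theorem the following sequences of integer polynomials exist and are unique.\<close>

definition witt_sum_poly :: "nat \<Rightarrow> nat \<Rightarrow> (nat + nat) int_mpoly" where
  "witt_sum_poly p = (THE S. \<forall>n. ghost p n S =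
      ghost p n (\<lambda>i. mvar (Inl i)) + ghost p n (\<lambda>i. mvar (Inr i)))"

definition witt_prod_poly :: "nat \<Rightarrow> nat \<Rightarrow> (nat + nat) int_mpoly" where
  "witt_prod_poly p = (THE S. \<forall>n. ghost p n S =
      ghost p n (\<lambda>i. mvar (Inl i)) * ghost p n (\<lambda>i. mvar (Inr i)))"

definition witt_ring :: "nat \<Rightarrow> 'r ring \<Rightarrow> (nat \<Rightarrow> 'r) ring" where
  "witt_ring p R =
    \<lparr> carrier = {x. \<forall>n. x n \<in> carrier R},
      monoid.mult = (\<lambda>x y n. mpoly_eval R (case_sum x y) (witt_prod_poly p n)),
      one = (\<lambda>n. if n = 0 then \<one>\<^bsub>R\<^esub> else \<zero>\<^bsub>R\<^esub>),
      ring.zero = (\<lambda>n. \<zero>\<^bsub>R\<^esub>),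
      add = (\<lambda>x y n. mpoly_eval R (case_sum x y) (witt_sum_poly p n)) \<rparr>"


section \<open>Complete Noetherian local algebras\<close>

definition ideal_power :: "'a ring \<Rightarrow> 'a set \<Rightarrow> nat \<Rightarrow> 'a set" where
  "ideal_power A I n = I [^]\<^bsub>ideals_set A\<^esub> n"

definition complete_noetherian_local :: "'a ring \<Rightarrow> 'a set \<Rightarrow> bool" where
  "complete_noetherian_local A \<mm> \<longleftrightarrow>
     cring A \<and> noetherian_ring A
     \<and> maximalideal \<mm> A \<and> (\<forall>J. maximalideal J A \<longrightarrow> J = \<mm>)
     \<and> (\<Inter>n. ideal_power A \<mm> n) = {\<zero>\<^bsub>A\<^esub>}
     \<and> (\<forall>x. (\<forall>n. x n \<in> carrier A \<and> x (Suc n) \<ominus>\<^bsub>A\<^esub> x n \<in> ideal_power A \<mm> n)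
          \<longrightarrow> (\<exists>a \<in> carrier A. \<forall>n. a \<ominus>\<^bsub>A\<^esub> x n \<in> ideal_power A \<mm> n))"

text \<open>\<open>(A, \<mm>)\<close> with structure map \<open>\<psi> : W(F) \<rightarrow> A\<close> is an object of the category of complete Noetherian
  local \<open>W(F)\<close>-algebras with residue field \<open>F\<close>. The residue map \<open>\<pi> : A \<rightarrow> F\<close> restricts to the
  reduction map of \<open>W(F)\<close>, which sends a Witt vector to its component \<open>0\<close>.\<close>

definition CNL_witt_algebra ::
    "nat \<Rightarrow> 'f ring \<Rightarrow> 'a ring \<Rightarrow> 'a set \<Rightarrow> ((nat \<Rightarrow> 'f) \<Rightarrow> 'a) \<Rightarrow> bool" where
  "CNL_witt_algebra p F A \<mm> \<psi> \<longleftrightarrow>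
     complete_noetherian_local A \<mm> \<and> \<psi> \<in> ring_hom (witt_ring p F) A
     \<and> (\<exists>\<pi> \<in> ring_hom A F. \<pi> ` carrier A = carrier F \<and> a_kernel A F \<pi> = \<mm>
          \<and> (\<forall>w \<in> carrier (witt_ring p F). \<pi> (\<psi> w) = w 0))"


section \<open>Modules\<close>

text \<open>The library locale \<open>module\<close> is for commutative scalars only.\<close>

locale left_module = R?: ring R + M?: abelian_group M
  for R :: "'r ring" (structure) and M :: "('r, 'm) module" (structure) +
  assumes smult_closed:
      "\<lbrakk> a \<in> carrier R; x \<in> carrier M \<rbrakk> \<Longrightarrow> a \<odot>\<^bsub>M\<^esub> x \<in> carrier M"
    and smult_l_distr:
      "\<lbrakk> a \<in> carrier R; b \<in> carrier R; x \<in> carrier M \<rbrakk> \<Longrightarrow>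
        (a \<oplus>\<^bsub>R\<^esub> b) \<odot>\<^bsub>M\<^esub> x = a \<odot>\<^bsub>M\<^esub> x \<oplus>\<^bsub>M\<^esub> b \<odot>\<^bsub>M\<^esub> x"
    and smult_r_distr:
      "\<lbrakk> a \<in> carrier R; x \<in> carrier M; y \<in> carrier M \<rbrakk> \<Longrightarrow>
        a \<odot>\<^bsub>M\<^esub> (x \<oplus>\<^bsub>M\<^esub> y) = a \<odot>\<^bsub>M\<^esub> x \<oplus>\<^bsub>M\<^esub> a \<odot>\<^bsub>M\<^esub> y"
    and smult_assoc:
      "\<lbrakk> a \<in> carrier R; b \<in> carrier R; x \<in> carrier M \<rbrakk> \<Longrightarrow>
        (a \<otimes>\<^bsub>R\<^esub> b) \<odot>\<^bsub>M\<^esub> x = a \<odot>\<^bsub>M\<^esub> (b \<odot>\<^bsub>M\<^esub> x)"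
    and smult_one:
      "x \<in> carrier M \<Longrightarrow> \<one>\<^bsub>R\<^esub> \<odot>\<^bsub>M\<^esub> x = x"

definition faithful :: "'r ring \<Rightarrow> ('r, 'm) module \<Rightarrow> bool" where
  "faithful R M \<longleftrightarrow>
     (\<forall>a \<in> carrier R. (\<forall>x \<in> carrier M. a \<odot>\<^bsub>M\<^esub> x = \<zero>\<^bsub>M\<^esub>) \<longrightarrow> a = \<zero>\<^bsub>R\<^esub>)"

text \<open>In the records below the fields \<open>mult\<close> and \<open>one\<close> carry no information.\<close>

definition restrict_scalars :: "('r \<Rightarrow> 's) \<Rightarrow> ('s, 'm) module \<Rightarrow> ('r, 'm) module" where
  "restrict_scalars \<phi> M =
    \<lparr> carrier = carrier M, monoid.mult = monoid.mult M, one = one M, ring.zero = ring.zero M, add = add M,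
      smult = (\<lambda>r x. \<phi> r \<odot>\<^bsub>M\<^esub> x) \<rparr>"

definition regular_module :: "'r ring \<Rightarrow> ('r, 'r) module" where
  "regular_module R =
    \<lparr> carrier = carrier R, monoid.mult = monoid.mult R, one = one R, ring.zero = ring.zero R, add = add R,
      smult = monoid.mult R \<rparr>"

text \<open>For an ideal \<open>I\<close> and \<open>S = carrier M\<close> this is \<open>I M\<close>; for \<open>I = carrier R\<close> it is the submodule
  generated by \<open>S\<close>.\<close>

definition smult_span :: "'r set \<Rightarrow> ('r, 'm) module \<Rightarrow> 'm set \<Rightarrow> 'm set" where
  "smult_span I M S = generate (add_monoid M) {a \<odot>\<^bsub>M\<^esub> x | a x. a \<in> I \<and> x \<in> S}"

definition fin_gen_module :: "'r ring \<Rightarrow> ('r, 'm) module \<Rightarrow> bool" where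
  "fin_gen_module R M \<longleftrightarrow>
     (\<exists>S. finite S \<and> S \<subseteq> carrier M \<and> carrier M = smult_span (carrier R) M S)"

definition quotient_module :: "('r, 'm) module \<Rightarrow> 'm set \<Rightarrow> ('r, 'm set) module" where
  "quotient_module M S =
    \<lparr> carrier = a_rcosets\<^bsub>M\<^esub> S, monoid.mult = undefined, one = undefined,
      ring.zero = S, add = set_add M,
      smult = (\<lambda>r Q. \<Union>x\<in>Q. S +>\<^bsub>M\<^esub> (r \<odot>\<^bsub>M\<^esub> x)) \<rparr>"

definition quotient_action ::
    "('r, 'm) module \<Rightarrow> 'm set \<Rightarrow> ('g \<Rightarrow> 'm \<Rightarrow> 'm) \<Rightarrow> 'g \<Rightarrow> 'm set \<Rightarrow> 'm set" where
  "quotient_action M S act g Q = (\<Union>x\<in>Q. S +>\<^bsub>M\<^esub> (act g x))"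

definition direct_sum_module :: "nat \<Rightarrow> (nat \<Rightarrow> ('r, 'm) module) \<Rightarrow> ('r, nat \<Rightarrow> 'm) module" where
  "direct_sum_module k M =
    \<lparr> carrier = (\<Pi>\<^sub>E i\<in>{..<k}. carrier (M i)), monoid.mult = undefined, one = undefined,
      ring.zero = (\<lambda>i\<in>{..<k}. \<zero>\<^bsub>M i\<^esub>),
      add = (\<lambda>x y. \<lambda>i\<in>{..<k}. x i \<oplus>\<^bsub>M i\<^esub> y i),
      smult = (\<lambda>r x. \<lambda>i\<in>{..<k}. r \<odot>\<^bsub>M i\<^esub> x i) \<rparr>"

definition direct_sum_action ::
    "nat \<Rightarrow> (nat \<Rightarrow> 'g \<Rightarrow> 'm \<Rightarrow> 'm) \<Rightarrow> 'g \<Rightarrow> (nat \<Rightarrow> 'm) \<Rightarrow> (nat \<Rightarrow> 'm)" where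
  "direct_sum_action k act g x = (\<lambda>i\<in>{..<k}. act i g (x i))"

text \<open>A module over the group ring \<open>R[G]\<close>, given as an \<open>R\<close>-module with an \<open>R\<close>-linear action of \<open>G\<close>.\<close>

definition group_ring_module ::
    "'g monoid \<Rightarrow> 'r ring \<Rightarrow> ('r, 'm) module \<Rightarrow> ('g \<Rightarrow> 'm \<Rightarrow> 'm) \<Rightarrow> bool" where
  "group_ring_module G R M act \<longleftrightarrow> Module.module R M
     \<and> (\<forall>g \<in> carrier G. act g \<in> carrier M \<rightarrow> carrier M)
     \<and> (\<forall>g \<in> carrier G. \<forall>x \<in> carrier M. \<forall>y \<in> carrier M. act g (x \<oplus>\<^bsub>M\<^esub> y) = act g x \<oplus>\<^bsub>M\<^esub> act g y)
     \<and> (\<forall>g \<in> carrier G. \<forall>r \<in> carrier R. \<forall>x \<in> carrier M. act g (r \<odot>\<^bsub>M\<^esub> x) = r \<odot>\<^bsub>M\<^esub> act g x)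
     \<and> (\<forall>g \<in> carrier G. \<forall>h \<in> carrier G. \<forall>x \<in> carrier M. act (g \<otimes>\<^bsub>G\<^esub> h) x = act g (act h x))
     \<and> (\<forall>x \<in> carrier M. act \<one>\<^bsub>G\<^esub> x = x)"

definition group_ring_isomorphic ::
    "'g monoid \<Rightarrow> 'r ring \<Rightarrow> ('r, 'm) module \<Rightarrow> ('g \<Rightarrow> 'm \<Rightarrow> 'm)
       \<Rightarrow> ('r, 'n) module \<Rightarrow> ('g \<Rightarrow> 'n \<Rightarrow> 'n) \<Rightarrow> bool" where
  "group_ring_isomorphic G R M act N act' \<longleftrightarrow>
     (\<exists>f. bij_betw f (carrier M) (carrier N)
        \<and> (\<forall>x \<in> carrier M. \<forall>y \<in> carrier M. f (x \<oplus>\<^bsub>M\<^esub> y) = f x \<oplus>\<^bsub>N\<^esub> f y)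
        \<and> (\<forall>r \<in> carrier R. \<forall>x \<in> carrier M. f (r \<odot>\<^bsub>M\<^esub> x) = r \<odot>\<^bsub>N\<^esub> f x)
        \<and> (\<forall>g \<in> carrier G. \<forall>x \<in> carrier M. f (act g x) = act' g (f x)))"

definition group_ring_submodule ::
    "'g monoid \<Rightarrow> 'r ring \<Rightarrow> ('r, 'm) module \<Rightarrow> ('g \<Rightarrow> 'm \<Rightarrow> 'm) \<Rightarrow> 'm set \<Rightarrow> bool" where
  "group_ring_submodule G R M act S \<longleftrightarrow>
     submodule S R M \<and> (\<forall>g \<in> carrier G. \<forall>x \<in> S. act g x \<in> S)"


section \<open>Stable conditions\<close>

text \<open>Every finite module is isomorphic to one whose carrier is a set of natural numbers, so a class
  of finite \<open>\<int>\<^sub>p[G]\<close>-modules closed under isomorphism is the same as such a class of modules with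
  carrier in \<^typ>\<open>nat\<close>. Constructions that leave \<^typ>\<open>nat\<close> are replaced by their isomorphic copies.\<close>

type_synonym 'g padic_rep = "(nat \<Rightarrow> int, nat) module \<times> ('g \<Rightarrow> nat \<Rightarrow> nat)"

definition finite_padic_reps :: "nat \<Rightarrow> 'g monoid \<Rightarrow> 'g topology \<Rightarrow> 'g padic_rep set" where
  "finite_padic_reps p G T =
     {(M, act). group_ring_module G (padic_ints p) M act \<and> finite (carrier M)
        \<and> continuous_map (prod_topology T (discrete_topology (carrier M)))
            (discrete_topology (carrier M)) (\<lambda>(g, x). act g x)}"

definition stable_condition ::
    "nat \<Rightarrow> 'g monoid \<Rightarrow> 'g topology \<Rightarrow> 'g padic_rep set \<Rightarrow> bool" where
  "stable_condition p G T \<C> \<longleftrightarrow>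
     \<C> \<subseteq> finite_padic_reps p G T
     \<and> (\<forall>(M, act) \<in> \<C>. \<forall>(N, act') \<in> finite_padic_reps p G T.
          group_ring_isomorphic G (padic_ints p) M act N act' \<longrightarrow> (N, act') \<in> \<C>)
     \<and> (\<forall>(M, act) \<in> \<C>. \<forall>S. group_ring_submodule G (padic_ints p) M act S \<longrightarrow>
          (M\<lparr>carrier := S\<rparr>, act) \<in> \<C>)
     \<and> (\<forall>(M, act) \<in> \<C>. \<forall>S. group_ring_submodule G (padic_ints p) M act S \<longrightarrow>
          (\<forall>(N, act') \<in> finite_padic_reps p G T.
             group_ring_isomorphic G (padic_ints p)
               (quotient_module M S) (quotient_action M S act) N act' \<longrightarrow> (N, act') \<in> \<C>))
     \<and> (\<forall>k M act. (\<forall>i<k. (M i, act i) \<in> \<C>) \<longrightarrow>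
          (\<forall>(N, act') \<in> finite_padic_reps p G T.
             group_ring_isomorphic G (padic_ints p)
               (direct_sum_module k M) (direct_sum_action k act) N act' \<longrightarrow> (N, act') \<in> \<C>))"

text \<open>Here \<open>A\<close> is a \<open>\<int>\<^sub>p\<close>-algebra via \<open>\<zeta>\<close>, and \<open>M\<close> is meant to be finitely generated over \<open>A\<close>. (For a
  Cayley--Hamilton algebra \<open>M = E\<close> this holds automatically.)\<close>

definition module_satisfies ::
    "nat \<Rightarrow> 'g monoid \<Rightarrow> 'g padic_rep set \<Rightarrow> 'a ring \<Rightarrow> 'a set \<Rightarrow> ((nat \<Rightarrow> int) \<Rightarrow> 'a)
       \<Rightarrow> ('a, 'm) module \<Rightarrow> ('g \<Rightarrow> 'm \<Rightarrow> 'm) \<Rightarrow> bool" where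
  "module_satisfies p G \<C> A \<mm> \<zeta> M act \<longleftrightarrow>
     (\<forall>i\<ge>1. let S = smult_span (ideal_power A \<mm> i) M (carrier M) in
        \<exists>(Q, act') \<in> \<C>. group_ring_isomorphic G (padic_ints p)
          (restrict_scalars \<zeta> (quotient_module M S)) (quotient_action M S act) Q act')"


section \<open>Algebras and tensor products\<close>

definition is_algebra :: "'r ring \<Rightarrow> 'e ring \<Rightarrow> ('r \<Rightarrow> 'e) \<Rightarrow> bool" where
  "is_algebra R E \<eta> \<longleftrightarrow> cring R \<and> ring E \<and> \<eta> \<in> ring_hom R E
     \<and> (\<forall>r \<in> carrier R. \<forall>x \<in> carrier E. \<eta> r \<otimes>\<^bsub>E\<^esub> x = x \<otimes>\<^bsub>E\<^esub> \<eta> r)"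

definition is_comm_algebra :: "'r ring \<Rightarrow> 'b ring \<Rightarrow> ('r \<Rightarrow> 'b) \<Rightarrow> bool" where
  "is_comm_algebra R B \<beta> \<longleftrightarrow> cring B \<and> is_algebra R B \<beta>"

definition fin_gen_algebra :: "'r ring \<Rightarrow> 'e ring \<Rightarrow> ('r \<Rightarrow> 'e) \<Rightarrow> bool" where
  "fin_gen_algebra R E \<eta> \<longleftrightarrow>
     (\<exists>S. finite S \<and> S \<subseteq> carrier E \<and> generate_ring E (\<eta> ` carrier R \<union> S) = carrier E)"

definition monoid_ring :: "'x monoid \<Rightarrow> ('x \<Rightarrow>\<^sub>0 int) ring" where
  "monoid_ring K =
    \<lparr> carrier = {c. Poly_Mapping.keys c \<subseteq> carrier K},
      monoid.mult = (\<lambda>c d. frag_extend (\<lambda>x. frag_extend (\<lambda>y. frag_of (x \<otimes>\<^bsub>K\<^esub> y)) d) c),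
      one = frag_of \<one>\<^bsub>K\<^esub>,
      ring.zero = 0,
      add = (+) \<rparr>"

text \<open>The ring \<open>E \<otimes>\<^sub>R B\<close> is the monoid ring of the multiplicative monoid \<open>E \<times> B\<close> modulo the ideal
  generated by the relations of balanced biadditivity. (The additive group of this monoid ring is
  free on \<open>E \<times> B\<close>, and the additive subgroup generated by the relations is already an ideal.)\<close>

definition tensor_ideal ::
    "'r ring \<Rightarrow> 'e ring \<Rightarrow> ('r \<Rightarrow> 'e) \<Rightarrow> 'b ring \<Rightarrow> ('r \<Rightarrow> 'b) \<Rightarrow> ('e \<times> 'b \<Rightarrow>\<^sub>0 int) set" where
  "tensor_ideal R E \<eta> B \<beta> = Idl\<^bsub>monoid_ring (E \<times>\<times> B)\<^esub>
     ({frag_of (x \<oplus>\<^bsub>E\<^esub> y, b) - frag_of (x, b) - frag_of (y, b) | x y b.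
         x \<in> carrier E \<and> y \<in> carrier E \<and> b \<in> carrier B}
    \<union> {frag_of (x, b \<oplus>\<^bsub>B\<^esub> c) - frag_of (x, b) - frag_of (x, c) | x b c.
         x \<in> carrier E \<and> b \<in> carrier B \<and> c \<in> carrier B}
    \<union> {frag_of (\<eta> r \<otimes>\<^bsub>E\<^esub> x, b) - frag_of (x, \<beta> r \<otimes>\<^bsub>B\<^esub> b) | r x b.
         r \<in> carrier R \<and> x \<in> carrier E \<and> b \<in> carrier B})"

definition tensor_ring ::
    "'r ring \<Rightarrow> 'e ring \<Rightarrow> ('r \<Rightarrow> 'e) \<Rightarrow> 'b ring \<Rightarrow> ('r \<Rightarrow> 'b) \<Rightarrow> ('e \<times> 'b \<Rightarrow>\<^sub>0 int) set ring" where
  "tensor_ring R E \<eta> B \<beta> = monoid_ring (E \<times>\<times> B) Quot tensor_ideal R E \<eta> B \<beta>"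

definition pure_tensor ::
    "'r ring \<Rightarrow> 'e ring \<Rightarrow> ('r \<Rightarrow> 'e) \<Rightarrow> 'b ring \<Rightarrow> ('r \<Rightarrow> 'b) \<Rightarrow> 'e \<Rightarrow> 'b \<Rightarrow> ('e \<times> 'b \<Rightarrow>\<^sub>0 int) set" where
  "pure_tensor R E \<eta> B \<beta> x b =
     tensor_ideal R E \<eta> B \<beta> +>\<^bsub>monoid_ring (E \<times>\<times> B)\<^esub> frag_of (x, b)"

text \<open>The map \<open>E \<otimes>\<^sub>R B \<rightarrow> E \<otimes>\<^sub>R B'\<close> induced by \<open>\<phi> : B \<rightarrow> B'\<close>, where \<open>\<beta>'\<close> is the structure map of \<open>B'\<close>.\<close>

definition tensor_map ::
    "'r ring \<Rightarrow> 'e ring \<Rightarrow> ('r \<Rightarrow> 'e) \<Rightarrow> 'c ring \<Rightarrow> ('r \<Rightarrow> 'c) \<Rightarrow> ('b \<Rightarrow> 'c)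
       \<Rightarrow> ('e \<times> 'b \<Rightarrow>\<^sub>0 int) set \<Rightarrow> ('e \<times> 'c \<Rightarrow>\<^sub>0 int) set" where
  "tensor_map R E \<eta> B' \<beta>' \<phi> Q =
     (\<Union>c\<in>Q. tensor_ideal R E \<eta> B' \<beta>' +>\<^bsub>monoid_ring (E \<times>\<times> B')\<^esub>
        frag_extend (\<lambda>(x, b). frag_of (x, \<phi> b)) c)"


section \<open>Pseudorepresentations and Cayley--Hamilton algebras\<close>

text \<open>Commutative \<open>R\<close>-algebras \<open>B\<close> range over the rings with carrier in the type \<open>'r \<times> nat + 'u\<close>.
  As \<open>'u\<close> is arbitrary, this universe is as large as desired. It always contains a copy of every
  finitely generated commutative \<open>R\<close>-algebra, and with \<open>B\<close> a copy of \<open>B[t]\<close>. As every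
  algebra is the filtered union of its finitely generated subalgebras and \<open>E \<otimes>\<^sub>R _\<close> commutes with
  filtered colimits, a polynomial law, and the validity of the identities below, is determined by
  its restriction to any such universe.\<close>

type_synonym ('r, 'u) univ = "'r \<times> nat + 'u"

type_synonym ('r, 'e, 'u) poly_law =
  "('r, 'u) univ ring \<Rightarrow> ('r \<Rightarrow> ('r, 'u) univ) \<Rightarrow> ('e \<times> ('r, 'u) univ \<Rightarrow>\<^sub>0 int) set \<Rightarrow> ('r, 'u) univ"

definition pseudorepresentation ::
    "'r ring \<Rightarrow> 'e ring \<Rightarrow> ('r \<Rightarrow> 'e) \<Rightarrow> nat \<Rightarrow> ('r, 'e, 'u) poly_law \<Rightarrow> bool" where
  "pseudorepresentation R E \<eta> d D \<longleftrightarrow>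
     is_algebra R E \<eta>
     \<and> (\<forall>B \<beta>. is_comm_algebra R B \<beta> \<longrightarrow>
          (let EB = tensor_ring R E \<eta> B \<beta>; \<tau> = pure_tensor R E \<eta> B \<beta> in
             D B \<beta> \<in> carrier EB \<rightarrow> carrier B
             \<and> D B \<beta> \<one>\<^bsub>EB\<^esub> = \<one>\<^bsub>B\<^esub>
             \<and> (\<forall>x \<in> carrier EB. \<forall>y \<in> carrier EB. D B \<beta> (x \<otimes>\<^bsub>EB\<^esub> y) = D B \<beta> x \<otimes>\<^bsub>B\<^esub> D B \<beta> y)
             \<and> (\<forall>b \<in> carrier B. \<forall>x \<in> carrier EB.
                  D B \<beta> (\<tau> \<one>\<^bsub>E\<^esub> b \<otimes>\<^bsub>EB\<^esub> x) = b [^]\<^bsub>B\<^esub> d \<otimes>\<^bsub>B\<^esub> D B \<beta> x)))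
     \<and> (\<forall>B \<beta> B' \<beta>' \<phi>. is_comm_algebra R B \<beta> \<and> is_comm_algebra R B' \<beta>'
          \<and> \<phi> \<in> ring_hom B B' \<and> (\<forall>r \<in> carrier R. \<phi> (\<beta> r) = \<beta>' r) \<longrightarrow>
          (\<forall>x \<in> carrier (tensor_ring R E \<eta> B \<beta>).
             D B' \<beta>' (tensor_map R E \<eta> B' \<beta>' \<phi> x) = \<phi> (D B \<beta> x)))"

text \<open>The characteristic polynomial \<open>\<chi>\<^sub>D(x, t) = D(t - x)\<close> of \<open>x \<in> E \<otimes>\<^sub>R B\<close>. The law \<open>D\<close> is evaluated
  on a copy \<open>P\<close> of \<open>B[t]\<close> in the universe, given by an isomorphism \<open>\<theta> : B[t] \<rightarrow> P\<close>.\<close>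

definition char_poly ::
    "'r ring \<Rightarrow> 'e ring \<Rightarrow> ('r \<Rightarrow> 'e) \<Rightarrow> ('r, 'e, 'u) poly_law
       \<Rightarrow> ('r, 'u) univ ring \<Rightarrow> ('r \<Rightarrow> ('r, 'u) univ)
       \<Rightarrow> ('r, 'u) univ ring \<Rightarrow> ((nat \<Rightarrow> ('r, 'u) univ) \<Rightarrow> ('r, 'u) univ)
       \<Rightarrow> ('e \<times> ('r, 'u) univ \<Rightarrow>\<^sub>0 int) set \<Rightarrow> nat \<Rightarrow> ('r, 'u) univ" where
  "char_poly R E \<eta> D B \<beta> P \<theta> x =
     (let \<kappa> = (\<lambda>b. \<theta> (monom (UP B) b 0)); t = \<theta> (monom (UP B) \<one>\<^bsub>B\<^esub> 1);
          EP = tensor_ring R E \<eta> P (\<kappa> \<circ> \<beta>)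
      in inv_into (carrier (UP B)) \<theta>
           (D P (\<kappa> \<circ> \<beta>)
              (pure_tensor R E \<eta> P (\<kappa> \<circ> \<beta>) \<one>\<^bsub>E\<^esub> t \<ominus>\<^bsub>EP\<^esub> tensor_map R E \<eta> P (\<kappa> \<circ> \<beta>) \<kappa> x)))"

definition cayley_hamilton_algebra ::
    "'r ring \<Rightarrow> 'e ring \<Rightarrow> ('r \<Rightarrow> 'e) \<Rightarrow> nat \<Rightarrow> ('r, 'e, 'u) poly_law \<Rightarrow> bool" where
  "cayley_hamilton_algebra R E \<eta> d D \<longleftrightarrow>
     pseudorepresentation R E \<eta> d D \<and> fin_gen_algebra R E \<eta>
     \<and> (\<forall>B \<beta> P \<theta>. is_comm_algebra R B \<beta> \<and> cring P \<and> \<theta> \<in> ring_iso (UP B) P \<longrightarrow>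
          (let EB = tensor_ring R E \<eta> B \<beta> in
           \<forall>x \<in> carrier EB.
             UnivPoly.eval B EB (pure_tensor R E \<eta> B \<beta> \<one>\<^bsub>E\<^esub>) x (char_poly R E \<eta> D B \<beta> P \<theta> x)
               = \<zero>\<^bsub>EB\<^esub>))"

definition adic_topology :: "'a ring \<Rightarrow> 'a set \<Rightarrow> ('a, 'm) module \<Rightarrow> 'm topology" where
  "adic_topology A I M = topology (\<lambda>U. U \<subseteq> carrier M \<and>
     (\<forall>x \<in> U. \<exists>n. \<forall>y \<in> smult_span (ideal_power A I n) M (carrier M). x \<oplus>\<^bsub>M\<^esub> y \<in> U))"

text \<open>A Cayley--Hamilton algebra is a finite module over its base, so over \<open>(A, \<mm>)\<close> it carries the
  \<open>\<mm>\<close>-adic topology.\<close>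

definition cayley_hamilton_rep ::
    "'g monoid \<Rightarrow> 'g topology \<Rightarrow> 'a ring \<Rightarrow> 'a set \<Rightarrow> 'e ring \<Rightarrow> ('a \<Rightarrow> 'e) \<Rightarrow> ('g \<Rightarrow> 'e)
       \<Rightarrow> nat \<Rightarrow> ('a, 'e, 'u) poly_law \<Rightarrow> bool" where
  "cayley_hamilton_rep G T A \<mm> E \<eta> \<rho> d D \<longleftrightarrow>
     cayley_hamilton_algebra A E \<eta> d D
     \<and> \<rho> \<in> hom G (units_of E)
     \<and> continuous_map T
         (subtopology (adic_topology A \<mm> (restrict_scalars \<eta> (regular_module E))) (Units E)) \<rho>"

definition cayley_hamilton_rep_satisfies ::
    "nat \<Rightarrow> 'g monoid \<Rightarrow> 'g padic_rep set \<Rightarrow> 'a ring \<Rightarrow> 'a set \<Rightarrow> ((nat \<Rightarrow> int) \<Rightarrow> 'a)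
       \<Rightarrow> 'e ring \<Rightarrow> ('a \<Rightarrow> 'e) \<Rightarrow> ('g \<Rightarrow> 'e) \<Rightarrow> bool" where
  "cayley_hamilton_rep_satisfies p G \<C> A \<mm> \<zeta> E \<eta> \<rho> \<longleftrightarrow>
     module_satisfies p G \<C> A \<mm> \<zeta> (restrict_scalars \<eta> (regular_module E)) (\<lambda>g x. \<rho> g \<otimes>\<^bsub>E\<^esub> x)"

end

theory Submission
  imports Defs
begin

text \<open>Choose \<open>A\<close>-generators \<open>n\<^sub>1, \<dots>, n\<^sub>k\<close> of \<open>N\<close>. The \<open>A[G]\<close>-linear orbit maps \<open>f\<^sub>l : E \<rightarrow> N\<close>, \<open>e \<mapsto> e n\<^sub>l\<close>,
  exhibit \<open>N\<close> as a quotient of \<open>E\<^sup>k\<close> and, as \<open>N\<close> is faithful, embed \<open>E\<close> into \<open>N\<^sup>k\<close>. The first fact makes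
  \<open>N / \<mm>\<^sup>iN\<close> a quotient of \<open>(E / \<mm>\<^sup>iE)\<^sup>k\<close>. By the Artin--Rees lemma some \<open>j\<close> satisfies
  \<open>E \<inter> \<mm>\<^sup>jN\<^sup>k \<subseteq> \<mm>\<^sup>iE\<close>, so \<open>E / \<mm>\<^sup>iE\<close> is a subquotient of \<open>(N / \<mm>\<^sup>jN)\<^sup>k\<close>.\<close>

section \<open>Linear maps and submodules\<close>

text \<open>The two directions differ in their exponents: an \<open>A\<close>-linear map carries
  \<open>\<mm>^i E\<close> into \<open>\<mm>^i N\<close>, whereas an element of \<open>E\<close>
  whose images all lie in \<open>\<mm>^i N\<close> need not lie in \<open>\<mm>^i E\<close>. The
  exponent has to be raised, by an amount that only a chain condition controls. Artin-Rees is
  derived here without Rees algebras, from submodules of the target that are maximal with a suitable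
  property; the orbit maps are treated one after another, each on the common kernel of the earlier
  ones, so that \<open>N^k\<close> is never formed over \<open>A\<close>. The second obstacle is
  formal: a stable condition consists of modules carried by \<open>nat\<close>, while quotients have
  sets and powers have functions as elements. Direct powers are therefore formed only of the finite
  modules in \<open>\<C>\<close> and moved back to \<open>nat\<close> along a bijection, and a
  subquotient is described by a linear relation between such a module and \<open>E\<close> or
  \<open>N\<close>, so that the intermediate submodules and quotients need not be named for each
  application.\<close>

lemma ideal_power_0 [simp]: "ideal_power A I 0 = carrier A"
  by (simp add: ideal_power_def nat_pow_def ideals_set_def)

lemma ideal_power_Suc: "ideal_power A I (Suc n) = ideal_prod A (ideal_power A I n) I"
  by (simp add: ideal_power_def ideals_set_def)

lemma ideal_power_ideal:
  assumes "ring R" "ideal I R" shows "ideal (ideal_power R I n) R"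
  by (induction n)
     (simp_all add: ideal_power_Suc ring.ideal_prod_is_ideal assms ring.oneideal)

lemma ideal_power_antimono:
  assumes "ring R" "ideal I R" and "i \<le> j"
  shows "ideal_power R I j \<subseteq> ideal_power R I i"
  using \<open>i \<le> j\<close>
proof (induction j rule: dec_induct)
  case (step n)
  then show ?case
    using ring.ideal_prod_inter[OF assms(1) ideal_power_ideal[OF assms(1,2)] assms(2), of n]
    by (auto simp: ideal_power_Suc)
qed simp

text \<open>Ideals under product form a commutative monoid, whose power law this is. It turns an
  Artin-Rees bound for powers of \<open>I^i\<close> into one for powers of \<open>I\<close>.\<close>

lemma ideal_power_ideal_power:
  assumes "cring R" "ideal I R"
  shows "ideal_power R (ideal_power R I i) n = ideal_power R I (i * n)"
proof -
  interpret S: comm_monoid "ideals_set R" by (rule cring.ideals_set_is_comm_monoid[OF assms(1)])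
  show ?thesis
    using assms S.nat_pow_pow[of I i n] by (simp add: ideal_power_def ideals_set_def)
qed

text \<open>The locale \<^locale>\<open>Module.module\<close> for records that are not extended, as required by \<^const>\<open>smult_span\<close>.\<close>

locale plain_module = Module.module R M
  for R :: "'r ring" (structure) and M :: "('r, 'm) module" (structure)

text \<open>No module axioms are included, so that the notion also applies to a target not yet known
  to be a module; \<open>plain_module_image\<close> transports the axioms along such a map.
  Preservation of zero and of negatives follows once both sides are modules.\<close>

definition linear_map ::
    "'r ring \<Rightarrow> ('r, 'm) module \<Rightarrow> ('r, 'n) module \<Rightarrow> ('m \<Rightarrow> 'n) \<Rightarrow> bool" where
  "linear_map R M N f \<longleftrightarrow> f \<in> carrier M \<rightarrow> carrier N
     \<and> (\<forall>x \<in> carrier M. \<forall>y \<in> carrier M. f (x \<oplus>\<^bsub>M\<^esub> y) = f x \<oplus>\<^bsub>N\<^esub> f y)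
     \<and> (\<forall>r \<in> carrier R. \<forall>x \<in> carrier M. f (r \<odot>\<^bsub>M\<^esub> x) = r \<odot>\<^bsub>N\<^esub> f x)"

lemma linear_mapD:
  assumes "linear_map R M N f"
  shows "x \<in> carrier M \<Longrightarrow> f x \<in> carrier N"
    and "x \<in> carrier M \<Longrightarrow> y \<in> carrier M \<Longrightarrow> f (x \<oplus>\<^bsub>M\<^esub> y) = f x \<oplus>\<^bsub>N\<^esub> f y"
    and "r \<in> carrier R \<Longrightarrow> x \<in> carrier M \<Longrightarrow> f (r \<odot>\<^bsub>M\<^esub> x) = r \<odot>\<^bsub>N\<^esub> f x"
  using assms by (auto simp: linear_map_def)

lemma linear_map_zero:
  assumes "plain_module R M" "plain_module R N" "linear_map R M N f"
  shows "f \<zero>\<^bsub>M\<^esub> = \<zero>\<^bsub>N\<^esub>"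
proof -
  interpret M: plain_module R M by fact
  interpret N: plain_module R N by fact
  have "f \<zero>\<^bsub>M\<^esub> = f (\<zero>\<^bsub>R\<^esub> \<odot>\<^bsub>M\<^esub> \<zero>\<^bsub>M\<^esub>)" by simp
  also have "\<dots> = \<zero>\<^bsub>R\<^esub> \<odot>\<^bsub>N\<^esub> f \<zero>\<^bsub>M\<^esub>" by (rule linear_mapD(3)[OF assms(3)]) auto
  also have "\<dots> = \<zero>\<^bsub>N\<^esub>"
    by (rule N.smult_l_null) (rule linear_mapD(1)[OF assms(3) M.M.zero_closed])
  finally show ?thesis .
qed

lemma linear_map_minus:
  assumes "plain_module R M" "plain_module R N" "linear_map R M N f" "x \<in> carrier M"
  shows "f (\<ominus>\<^bsub>M\<^esub> x) = \<ominus>\<^bsub>N\<^esub> f x"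
proof -
  interpret M: plain_module R M by fact
  interpret N: plain_module R N by fact
  have "f (\<ominus>\<^bsub>M\<^esub> x) = f ((\<ominus>\<^bsub>R\<^esub> \<one>\<^bsub>R\<^esub>) \<odot>\<^bsub>M\<^esub> x)"
    using assms(4) by (simp add: M.smult_l_minus)
  also have "\<dots> = (\<ominus>\<^bsub>R\<^esub> \<one>\<^bsub>R\<^esub>) \<odot>\<^bsub>N\<^esub> f x"
    using assms(3,4) by (simp add: linear_mapD(3))
  also have "\<dots> = \<ominus>\<^bsub>N\<^esub> f x"
    using linear_mapD(1)[OF assms(3,4)] by (simp add: N.smult_l_minus)
  finally show ?thesis .
qed

lemma (in plain_module) submoduleI_smult:
  assumes "H \<subseteq> carrier M" "\<zero>\<^bsub>M\<^esub> \<in> H"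
    and "\<And>x y. x \<in> H \<Longrightarrow> y \<in> H \<Longrightarrow> x \<oplus>\<^bsub>M\<^esub> y \<in> H"
    and "\<And>a x. a \<in> carrier R \<Longrightarrow> x \<in> H \<Longrightarrow> a \<odot>\<^bsub>M\<^esub> x \<in> H"
  shows "submodule H R M"
proof (rule submoduleI)
  fix x assume "x \<in> H"
  then have "(\<ominus> \<one>) \<odot>\<^bsub>M\<^esub> x \<in> H" "x \<in> carrier M" using assms by auto
  then show "\<ominus>\<^bsub>M\<^esub> x \<in> H" by (simp add: smult_l_minus)
qed (use assms in auto)

lemma (in plain_module) submodule_zero: "submodule H R M \<Longrightarrow> \<zero>\<^bsub>M\<^esub> \<in> H"
  using subgroup.one_closed[OF submodule.axioms(1)] by fastforce

lemma (in plain_module) submodule_minus: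
  "submodule H R M \<Longrightarrow> x \<in> H \<Longrightarrow> y \<in> H \<Longrightarrow> x \<ominus>\<^bsub>M\<^esub> y \<in> H"
  by (simp add: a_minus_def submoduleE)

lemma submodule_vimage:
  assumes "plain_module R M" "plain_module R N" "linear_map R M N f" "submodule L R N"
  shows "submodule {x \<in> carrier M. f x \<in> L} R M"
proof -
  interpret M: plain_module R M by fact
  interpret N: plain_module R N by fact
  show ?thesis
    by (rule M.submoduleI_smult)
       (auto simp: linear_mapD[OF assms(3)] linear_map_zero[OF assms(1-3)]
         N.submodule_zero[OF assms(4)] N.submoduleE[OF assms(4)])
qed

lemma submodule_image:
  assumes "plain_module R M" "plain_module R N" "linear_map R M N f" "submodule L R M"
  shows "submodule (f ` L) R N"
proof -
  interpret M: plain_module R M by fact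
  interpret N: plain_module R N by fact
  note L = M.submoduleE[OF assms(4)]
  note f = linear_mapD[OF assms(3)]
  show ?thesis
  proof (rule N.submoduleI_smult)
    show "f ` L \<subseteq> carrier N" using f(1) L(1) by blast
    show "\<zero>\<^bsub>N\<^esub> \<in> f ` L"
      using linear_map_zero[OF assms(1-3)] M.submodule_zero[OF assms(4)] by (metis imageI)
  next
    fix x y assume "x \<in> f ` L" "y \<in> f ` L"
    then obtain a b where ab: "a \<in> L" "b \<in> L" "x = f a" "y = f b" by auto
    then have "x \<oplus>\<^bsub>N\<^esub> y = f (a \<oplus>\<^bsub>M\<^esub> b)"
      using f(2)[OF subsetD[OF L(1)] subsetD[OF L(1)], of a b] by simp
    then show "x \<oplus>\<^bsub>N\<^esub> y \<in> f ` L" using ab L(5) by (metis imageI)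
  next
    fix r x assume r: "r \<in> carrier R" "x \<in> f ` L"
    then obtain a where a: "a \<in> L" "x = f a" by auto
    then have "r \<odot>\<^bsub>N\<^esub> x = f (r \<odot>\<^bsub>M\<^esub> a)"
      using f(3)[OF r(1) subsetD[OF L(1)], of a] by simp
    then show "r \<odot>\<^bsub>N\<^esub> x \<in> f ` L" using a r L(4) by (metis imageI)
  qed
qed

lemma (in plain_module) linear_map_smult:
  "a \<in> carrier R \<Longrightarrow> linear_map R M M (\<lambda>x. a \<odot>\<^bsub>M\<^esub> x)"
  by (simp add: linear_map_def smult_r_distr smult_assoc1[symmetric] R.m_comm)

section \<open>Spans of products of scalars from an ideal with module elements\<close>

lemma smult_span_incl:
  "a \<in> I \<Longrightarrow> x \<in> S \<Longrightarrow> a \<odot>\<^bsub>M\<^esub> x \<in> smult_span I M S"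
  unfolding smult_span_def by (rule generate.incl) auto

text \<open>Serves as the induction principle for spans: \<open>L\<close> is taken to be the set of
  elements with the wanted property.\<close>

lemma (in plain_module) smult_span_minimal:
  assumes "submodule L R M" "\<And>a x. a \<in> I \<Longrightarrow> x \<in> S \<Longrightarrow> a \<odot>\<^bsub>M\<^esub> x \<in> L"
  shows "smult_span I M S \<subseteq> L"
  unfolding smult_span_def
  by (rule M.add.generate_subgroup_incl[OF _ submodule.axioms(1)[OF assms(1)]]) (use assms(2) in blast)

text \<open>The span is generated as an additive group only. It is stable under scalars because
  \<open>I\<close> absorbs them: \<open>r (a x) = (r a) x\<close> is again a generator, and the
  inverse of a generator \<open>a x\<close> is the generator \<open>(-a) x\<close>.\<close>

lemma (in plain_module) smult_span_submodule:
  assumes "ideal I R" "S \<subseteq> carrier M"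
  shows "submodule (smult_span I M S) R M"
proof -
  have I: "I \<subseteq> carrier R" using ideal.Icarr[OF assms(1)] by (rule subsetI)
  let ?X = "{a \<odot>\<^bsub>M\<^esub> x | a x. a \<in> I \<and> x \<in> S}"
  have X: "?X \<subseteq> carrier M" using I assms(2) by (auto intro!: smult_closed)
  have sg: "subgroup (smult_span I M S) (add_monoid M)"
    unfolding smult_span_def by (rule M.add.generate_is_subgroup) (use X in auto)
  show ?thesis
  proof (intro submodule.intro submodule_axioms.intro sg)
    fix r x assume r: "r \<in> carrier R" "x \<in> smult_span I M S"
    show "r \<odot>\<^bsub>M\<^esub> x \<in> smult_span I M S"
      using r(2) unfolding smult_span_def
    proof (induction x rule: generate.induct)
      case one
      then show ?case using r(1) by (auto intro: generate.one[of "add_monoid M", simplified])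
    next
      case (incl h)
      then obtain a x where h: "h = a \<odot>\<^bsub>M\<^esub> x" "a \<in> I" "x \<in> S"
        "a \<in> carrier R" "x \<in> carrier M" using I assms(2) by blast
      then have "r \<odot>\<^bsub>M\<^esub> h = (r \<otimes> a) \<odot>\<^bsub>M\<^esub> x" using r h by (simp add: smult_assoc1)
      moreover have "r \<otimes> a \<in> I" using h r assms(1) by (simp add: ideal.I_l_closed)
      ultimately show ?case using h by (intro generate.incl) auto
    next
      case (inv h)
      then obtain a x where h: "h = a \<odot>\<^bsub>M\<^esub> x" "a \<in> I" "x \<in> S"
        "a \<in> carrier R" "x \<in> carrier M" using I assms(2) by blast
      have "inv\<^bsub>add_monoid M\<^esub> h = (\<ominus> a) \<odot>\<^bsub>M\<^esub> x"
        using h by (simp add: smult_l_minus a_inv_def[symmetric])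
      then have "r \<odot>\<^bsub>M\<^esub> (inv\<^bsub>add_monoid M\<^esub> h) = (r \<otimes> (\<ominus> a)) \<odot>\<^bsub>M\<^esub> x"
        using r h by (simp add: smult_assoc1)
      moreover have "r \<otimes> (\<ominus> a) \<in> I"
        using h r assms(1) by (simp add: ideal.I_l_closed additive_subgroup.a_inv_closed ideal.axioms(1))
      ultimately show ?case using h by (intro generate.incl) auto
    next
      case (eng x y)
      have "x \<in> carrier M" "y \<in> carrier M"
        using eng M.add.generate_in_carrier[OF X] by auto
      then show ?case using eng r generate.eng[of _ "add_monoid M"] by (auto simp: smult_r_distr)
    qed
  qed
qed

lemma (in plain_module) smult_span_subset:
  assumes "ideal I R" "submodule L R M" shows "smult_span I M L \<subseteq> L"
  by (rule smult_span_minimal[OF assms(2)]) (rule submoduleE(4)[OF assms(2) ideal.Icarr[OF assms(1)]])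

lemma smult_span_mono:
  assumes "plain_module R M" "I \<subseteq> J" "S \<subseteq> S'"
  shows "smult_span I M S \<subseteq> smult_span J M S'"
proof -
  interpret plain_module R M by fact
  show ?thesis unfolding smult_span_def
    by (rule M.add.mono_generate) (use assms in auto)
qed

lemma linear_map_smult_span:
  assumes "plain_module R M" "plain_module R N" "linear_map R M N f"
    and "ideal I R" "f ` S \<subseteq> S'" "S \<subseteq> carrier M" "S' \<subseteq> carrier N" "x \<in> smult_span I M S"
  shows "f x \<in> smult_span I N S'"
proof -
  interpret M: plain_module R M by fact
  interpret N: plain_module R N by fact
  have "smult_span I M S \<subseteq> {x \<in> carrier M. f x \<in> smult_span I N S'}"
  proof (rule M.smult_span_minimal[OF submodule_vimage[OF assms(1-3)]])
    show "submodule (smult_span I N S') R N" by (rule N.smult_span_submodule[OF assms(4,7)])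
  next
    fix a x assume a: "a \<in> I" "x \<in> S"
    then have "a \<in> carrier R" "x \<in> carrier M" using assms(4,6) ideal.Icarr by auto
    then show "a \<odot>\<^bsub>M\<^esub> x \<in> {x \<in> carrier M. f x \<in> smult_span I N S'}"
      using a assms(5) by (auto simp: linear_mapD(3)[OF assms(3)] intro!: smult_span_incl)
  qed
  then show ?thesis using assms(8) by auto
qed

section \<open>Noetherian modules\<close>

text \<open>The ascending chain condition, as well-foundedness of reverse inclusion; in this form
  two chain conditions combine through a lexicographic product. \<open>W\<close> is a subset of a
  fixed module, so that the condition can be built up generator by generator inside
  \<open>M\<close>.\<close>

definition noetherian_on ::
    "'r ring \<Rightarrow> ('r, 'm) module \<Rightarrow> 'm set \<Rightarrow> bool" where
  "noetherian_on R M W \<longleftrightarrow>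
     wf {(K, L). submodule K R M \<and> submodule L R M \<and> L \<subset> K \<and> K \<subseteq> W}"

lemma noetherian_on_maximal:
  assumes "noetherian_on R M W" "L0 \<in> \<F>" "\<And>L. L \<in> \<F> \<Longrightarrow> submodule L R M \<and> L \<subseteq> W"
  obtains L where "L \<in> \<F>" "\<And>K. K \<in> \<F> \<Longrightarrow> L \<subseteq> K \<Longrightarrow> K = L"
proof -
  define r where "r = {(K, L). submodule K R M \<and> submodule L R M \<and> L \<subset> K \<and> K \<subseteq> W}"
  have "wf r" using assms(1) by (simp add: noetherian_on_def r_def)
  then obtain L where L: "L \<in> \<F>" and min: "\<And>K. (K, L) \<in> r \<Longrightarrow> K \<notin> \<F>"
    using wfE_min[OF _ assms(2), of r] by metis
  show ?thesis
  proof (rule that[OF L])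
    fix K assume K: "K \<in> \<F>" "L \<subseteq> K"
    then have "(K, L) \<notin> r" using min by blast
    then show "K = L" using K(2) assms(3)[OF L] assms(3)[OF K(1)] unfolding r_def by blast
  qed
qed

text \<open>An infinite strictly increasing sequence of ideals is a chain for inclusion, so its
  union is one of its members; the next member would then exceed the union.\<close>

lemma (in noetherian_ring) wf_ideals:
  "wf {(K, L). ideal K R \<and> ideal L R \<and> L \<subset> K}"
  unfolding wf_iff_no_infinite_down_chain
proof (rule notI, elim exE)
  fix f assume f: "\<forall>i::nat. (f (Suc i), f i) \<in> {(K, L). ideal K R \<and> ideal L R \<and> L \<subset> K}"
  have mono: "f i \<subseteq> f j" if "i \<le> j" for i j
  proof (rule lift_Suc_mono_le[OF _ that])
    show "f n \<subseteq> f (Suc n)" for n using spec[OF f, of n] by (simp add: psubset_eq)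
  qed
  have "subset.chain {I. ideal I R} (range f)"
    unfolding pred_on.chain_def
  proof (intro conjI ballI)
    show "range f \<subseteq> {I. ideal I R}" using f by simp blast
    fix x y assume "x \<in> range f" "y \<in> range f"
    then obtain i j where "x = f i" "y = f j" by auto
    then show "(\<subset>)\<^sup>=\<^sup>= x y \<or> (\<subset>)\<^sup>=\<^sup>= y x"
      using mono[of i j] mono[of j i] by (cases "i \<le> j") auto
  qed
  then have "\<Union>(range f) \<in> range f" by (intro ideal_chain_is_trivial) auto
  then obtain n where "\<Union>(range f) = f n" by auto
  moreover have "f n \<subset> f (Suc n)" using spec[OF f, of n] by simp
  ultimately show False by blast
qed

lemma (in plain_module) minus_zero: "\<ominus>\<^bsub>M\<^esub> \<zero>\<^bsub>M\<^esub> = \<zero>\<^bsub>M\<^esub>"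
  using M.r_neg[OF M.zero_closed] by simp

text \<open>\<open>W'\<close> lies in \<open>W + R x\<close>. A submodule \<open>L\<close> leaves
  two traces: the ideal \<open>?J L\<close> of the coefficients of \<open>x\<close> that occur in
  \<open>L\<close> modulo \<open>W\<close>, and the intersection \<open>L \<inter> W\<close>. Both
  grow with \<open>L\<close>, and within \<open>W'\<close> an inclusion that changes neither is an
  equality. Hence a strict inclusion is a descent in the lexicographic product of two well-founded
  orders.\<close>

lemma (in plain_module) noetherian_on_extend:
  assumes "noetherian_ring R" "submodule W R M" "noetherian_on R M W"
    and x: "x \<in> carrier M"
    and W': "\<And>w. w \<in> W' \<Longrightarrow> \<exists>a\<in>carrier R. w \<ominus>\<^bsub>M\<^esub> a \<odot>\<^bsub>M\<^esub> x \<in> W"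
  shows "noetherian_on R M W'"
proof -
  interpret nr: noetherian_ring R by fact
  let ?J = "\<lambda>L. {a \<in> carrier R. \<exists>w\<in>L. w \<ominus>\<^bsub>M\<^esub> a \<odot>\<^bsub>M\<^esub> x \<in> W}"
  let ?r = "{(K, L). ideal K R \<and> ideal L R \<and> L \<subset> K}"
  let ?s = "{(K, L). submodule K R M \<and> submodule L R M \<and> L \<subset> K \<and> K \<subseteq> W}"
  have J: "ideal (?J L) R" if L: "submodule L R M" for L
  proof -
    note LE = submoduleE[OF L]
    note WE = submoduleE[OF assms(2)]
    have add: "a \<oplus> b \<in> ?J L" if "a \<in> ?J L" "b \<in> ?J L" for a b
    proof -
      from that obtain v w where vw: "a \<in> carrier R" "b \<in> carrier R" "v \<in> L" "w \<in> L"
        "v \<ominus>\<^bsub>M\<^esub> a \<odot>\<^bsub>M\<^esub> x \<in> W" "w \<ominus>\<^bsub>M\<^esub> b \<odot>\<^bsub>M\<^esub> x \<in> W" by auto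
      then have c: "v \<in> carrier M" "w \<in> carrier M" using LE by auto
      have "(v \<oplus>\<^bsub>M\<^esub> w) \<ominus>\<^bsub>M\<^esub> (a \<oplus> b) \<odot>\<^bsub>M\<^esub> x = (v \<ominus>\<^bsub>M\<^esub> a \<odot>\<^bsub>M\<^esub> x) \<oplus>\<^bsub>M\<^esub> (w \<ominus>\<^bsub>M\<^esub> b \<odot>\<^bsub>M\<^esub> x)"
        using vw c x by (simp add: smult_l_distr a_minus_def M.minus_add M.a_ac)
      then have "(v \<oplus>\<^bsub>M\<^esub> w) \<ominus>\<^bsub>M\<^esub> (a \<oplus> b) \<odot>\<^bsub>M\<^esub> x \<in> W" using WE(5)[OF vw(5,6)] by simp
      then show ?thesis using vw LE(5)[OF vw(3,4)] by blast
    qed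
    have mul: "r \<otimes> a \<in> ?J L" if "a \<in> ?J L" "r \<in> carrier R" for a r
    proof -
      from that obtain v where v: "a \<in> carrier R" "v \<in> L" "v \<ominus>\<^bsub>M\<^esub> a \<odot>\<^bsub>M\<^esub> x \<in> W" by auto
      then have c: "v \<in> carrier M" using LE by auto
      have "r \<odot>\<^bsub>M\<^esub> v \<ominus>\<^bsub>M\<^esub> (r \<otimes> a) \<odot>\<^bsub>M\<^esub> x = r \<odot>\<^bsub>M\<^esub> (v \<ominus>\<^bsub>M\<^esub> a \<odot>\<^bsub>M\<^esub> x)"
        using v c x that by (simp add: smult_r_distr smult_assoc1 smult_r_minus a_minus_def)
      then have "r \<odot>\<^bsub>M\<^esub> v \<ominus>\<^bsub>M\<^esub> (r \<otimes> a) \<odot>\<^bsub>M\<^esub> x \<in> W" using WE(4)[OF that(2) v(3)] by simp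
      then show ?thesis using v that LE(4)[OF that(2) v(2)] by blast
    qed
    have zero: "\<zero> \<in> ?J L"
      using x submodule_zero[OF L] submodule_zero[OF assms(2)]
      by (auto intro!: bexI[of _ "\<zero>\<^bsub>M\<^esub>"] simp: a_minus_def minus_zero)
    show ?thesis
    proof (rule idealI)
      show "ring R" by (rule R.ring_axioms)
      show "subgroup (?J L) (add_monoid R)"
      proof (rule R.add.subgroupI)
        fix a assume a: "a \<in> ?J L"
        then have "(\<ominus> \<one>) \<otimes> a \<in> ?J L" by (intro mul) auto
        then show "\<ominus> a \<in> ?J L" using a by (simp add: R.l_minus)
      qed (use add zero in auto)
    next
      fix a r assume "a \<in> ?J L" "r \<in> carrier R"
      then show "r \<otimes> a \<in> ?J L" "a \<otimes> r \<in> ?J L"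
        using mul[of a r] R.m_comm[of a r] by auto
    qed
  qed
  have int: "submodule (L \<inter> W) R M" if L: "submodule L R M" for L
    by (rule submoduleI_smult)
       (use submoduleE[OF L] submodule_zero[OF L] submodule_zero[OF assms(2)] submoduleE[OF assms(2)] in auto)
  \<comment> \<open>An element \<open>w\<close> of \<open>K\<close> is compared with some
    \<open>v\<close> in \<open>L\<close> that has the same coefficient of \<open>x\<close> modulo
    \<open>W\<close>. Their difference lies in \<open>K \<inter> W\<close>, hence in
    \<open>L\<close>, and so does \<open>w\<close>.\<close>
  have strict: "L = K"
    if K: "submodule K R M" and L: "submodule L R M" and "L \<subseteq> K" and KW: "K \<subseteq> W'"
      and JKL: "?J K \<subseteq> ?J L" and KWL: "K \<inter> W \<subseteq> L" for K L
  proof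
    show "K \<subseteq> L"
    proof
      fix w assume w: "w \<in> K"
      then obtain a where a: "a \<in> carrier R" "w \<ominus>\<^bsub>M\<^esub> a \<odot>\<^bsub>M\<^esub> x \<in> W" using W'[of w] KW by blast
      then have "a \<in> ?J K" using w by auto
      then obtain v where v: "v \<in> L" "v \<ominus>\<^bsub>M\<^esub> a \<odot>\<^bsub>M\<^esub> x \<in> W" using JKL by blast
      have c: "v \<in> carrier M" "w \<in> carrier M" using v w submoduleE(1)[OF K] submoduleE(1)[OF L] by auto
      have "w \<ominus>\<^bsub>M\<^esub> v = (w \<ominus>\<^bsub>M\<^esub> a \<odot>\<^bsub>M\<^esub> x) \<ominus>\<^bsub>M\<^esub> (v \<ominus>\<^bsub>M\<^esub> a \<odot>\<^bsub>M\<^esub> x)"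
        using c a x by (simp add: a_minus_def M.minus_add M.a_ac M.r_neg M.r_neg1 M.r_neg2 M.minus_minus)
      then have "w \<ominus>\<^bsub>M\<^esub> v \<in> W" using submodule_minus[OF assms(2) a(2) v(2)] by simp
      moreover have "w \<ominus>\<^bsub>M\<^esub> v \<in> K" using submodule_minus[OF K w] v \<open>L \<subseteq> K\<close> by auto
      ultimately have "w \<ominus>\<^bsub>M\<^esub> v \<in> L" using KWL by blast
      then have "(w \<ominus>\<^bsub>M\<^esub> v) \<oplus>\<^bsub>M\<^esub> v \<in> L" using submoduleE(5)[OF L] v by auto
      moreover have "(w \<ominus>\<^bsub>M\<^esub> v) \<oplus>\<^bsub>M\<^esub> v = w" using c by (simp add: a_minus_def M.a_assoc M.l_neg)
      ultimately show "w \<in> L" by simp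
    qed
  qed fact
  have "wf (inv_image (?r <*lex*> ?s) (\<lambda>L. (?J L, L \<inter> W)))"
    using nr.wf_ideals assms(3) by (auto simp: noetherian_on_def)
  then show ?thesis
    unfolding noetherian_on_def
  proof (rule wf_subset, intro subrelI)
    fix K L
    assume "(K, L) \<in> {(K, L). submodule K R M \<and> submodule L R M \<and> L \<subset> K \<and> K \<subseteq> W'}"
    then have KL: "submodule K R M" "submodule L R M" "L \<subset> K" "K \<subseteq> W'" by auto
    show "(K, L) \<in> inv_image (?r <*lex*> ?s) (\<lambda>L. (?J L, L \<inter> W))"
    proof (cases "?J L = ?J K")
      case True
      then have "L \<inter> W \<subset> K \<inter> W" using strict[OF KL(1,2)] KL by blast
      then have "(K \<inter> W, L \<inter> W) \<in> ?s" using int[OF KL(1)] int[OF KL(2)] by simp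
      then show ?thesis using True by (simp add: in_inv_image del: mem_Collect_eq)
    next
      case False
      moreover have "?J L \<subseteq> ?J K" using KL(3) by auto
      ultimately have "(?J K, ?J L) \<in> ?r" using J[OF KL(1)] J[OF KL(2)] by blast
      then show ?thesis by (simp add: in_inv_image del: mem_Collect_eq)
    qed
  qed
qed

lemma (in plain_module) noetherian_on_zero: "noetherian_on R M {\<zero>\<^bsub>M\<^esub>}"
proof -
  have "\<not> (submodule K R M \<and> submodule L R M \<and> L \<subset> K \<and> K \<subseteq> {\<zero>\<^bsub>M\<^esub>})" for K L
    using submodule_zero[of L] by blast
  then have "{(K, L). submodule K R M \<and> submodule L R M \<and> L \<subset> K \<and> K \<subseteq> {\<zero>\<^bsub>M\<^esub>}} = {}"
    by blast
  then show ?thesis unfolding noetherian_on_def by (rule ssubst[where P = wf]) (simp add: wf_def)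
qed

text \<open>Induction over the generators, each new one being an extension by a cyclic
  module.\<close>

lemma (in plain_module) noetherian_on_span:
  assumes "noetherian_ring R" "finite S" "S \<subseteq> carrier M"
  shows "noetherian_on R M (smult_span (carrier R) M S)"
  using assms(2,3)
proof (induction S rule: finite_induct)
  case empty
  have "smult_span (carrier R) M {} \<subseteq> {\<zero>\<^bsub>M\<^esub>}"
    by (rule smult_span_minimal[OF submoduleI_smult]) auto
  moreover have "submodule (smult_span (carrier R) M {}) R M"
    by (rule smult_span_submodule) (auto simp: R.oneideal)
  ultimately have "smult_span (carrier R) M {} = {\<zero>\<^bsub>M\<^esub>}" using submodule_zero by blast
  then show ?case using noetherian_on_zero by simp
next
  case (insert x S)
  let ?W = "smult_span (carrier R) M S"
  have W: "submodule ?W R M" by (rule smult_span_submodule) (use insert in \<open>auto simp: R.oneideal\<close>)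
  note WE = submoduleE[OF W]
  have x: "x \<in> carrier M" using insert by auto
  \<comment> \<open>This is \<open>?W + R x\<close>, written with an existential coefficient so as
    to match the hypothesis of \<open>noetherian_on_extend\<close>. Being a submodule that contains
    all multiples of the generators, it contains the new span.\<close>
  let ?V = "{w \<in> carrier M. \<exists>a\<in>carrier R. w \<ominus>\<^bsub>M\<^esub> a \<odot>\<^bsub>M\<^esub> x \<in> ?W}"
  have V: "submodule ?V R M"
  proof (rule submoduleI_smult)
    show "\<zero>\<^bsub>M\<^esub> \<in> ?V"
      using x submodule_zero[OF W] by (auto intro!: bexI[of _ "\<zero>"] simp: a_minus_def minus_zero)
  next
    fix v w assume "v \<in> ?V" "w \<in> ?V"
    then obtain a b where ab: "v \<in> carrier M" "w \<in> carrier M" "a \<in> carrier R" "b \<in> carrier R"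
      "v \<ominus>\<^bsub>M\<^esub> a \<odot>\<^bsub>M\<^esub> x \<in> ?W" "w \<ominus>\<^bsub>M\<^esub> b \<odot>\<^bsub>M\<^esub> x \<in> ?W" by auto
    have "(v \<oplus>\<^bsub>M\<^esub> w) \<ominus>\<^bsub>M\<^esub> (a \<oplus> b) \<odot>\<^bsub>M\<^esub> x = (v \<ominus>\<^bsub>M\<^esub> a \<odot>\<^bsub>M\<^esub> x) \<oplus>\<^bsub>M\<^esub> (w \<ominus>\<^bsub>M\<^esub> b \<odot>\<^bsub>M\<^esub> x)"
      using ab x by (simp add: smult_l_distr a_minus_def M.minus_add M.a_ac)
    then have "(v \<oplus>\<^bsub>M\<^esub> w) \<ominus>\<^bsub>M\<^esub> (a \<oplus> b) \<odot>\<^bsub>M\<^esub> x \<in> ?W" using ab WE by auto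
    then show "v \<oplus>\<^bsub>M\<^esub> w \<in> ?V" using ab by blast
  next
    fix r v assume "r \<in> carrier R" "v \<in> ?V"
    then obtain a where a: "v \<in> carrier M" "a \<in> carrier R" "r \<in> carrier R" "v \<ominus>\<^bsub>M\<^esub> a \<odot>\<^bsub>M\<^esub> x \<in> ?W" by auto
    have "r \<odot>\<^bsub>M\<^esub> v \<ominus>\<^bsub>M\<^esub> (r \<otimes> a) \<odot>\<^bsub>M\<^esub> x = r \<odot>\<^bsub>M\<^esub> (v \<ominus>\<^bsub>M\<^esub> a \<odot>\<^bsub>M\<^esub> x)"
      using a x by (simp add: smult_r_distr smult_assoc1 smult_r_minus a_minus_def)
    then have "r \<odot>\<^bsub>M\<^esub> v \<ominus>\<^bsub>M\<^esub> (r \<otimes> a) \<odot>\<^bsub>M\<^esub> x \<in> ?W" using a WE by auto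
    then show "r \<odot>\<^bsub>M\<^esub> v \<in> ?V" using a by blast
  qed auto
  have "smult_span (carrier R) M (insert x S) \<subseteq> ?V"
  proof (rule smult_span_minimal[OF V])
    fix a y assume a: "a \<in> carrier R" "y \<in> insert x S"
    show "a \<odot>\<^bsub>M\<^esub> y \<in> ?V"
    proof (cases "y = x")
      case True
      have "a \<odot>\<^bsub>M\<^esub> x \<ominus>\<^bsub>M\<^esub> a \<odot>\<^bsub>M\<^esub> x \<in> ?W"
        using a x submodule_zero[OF W] by (simp add: M.r_neg a_minus_def)
      then show ?thesis using True a x by blast
    next
      case False
      then have "a \<odot>\<^bsub>M\<^esub> y \<in> ?W" using a by (auto intro: smult_span_incl)
      then show ?thesis using x WE(1) by (auto intro!: bexI[of _ "\<zero>"] simp: a_minus_def minus_zero)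
    qed
  qed
  then have *: "\<exists>a\<in>carrier R. w \<ominus>\<^bsub>M\<^esub> a \<odot>\<^bsub>M\<^esub> x \<in> ?W"
    if "w \<in> smult_span (carrier R) M (insert x S)" for w
    using that by blast
  have "noetherian_on R M ?W" using insert by blast
  from noetherian_on_extend[OF assms(1) W this x *] show ?case by blast
qed

section \<open>The Artin-Rees lemma\<close>

text \<open>The colon \<open>(L : S)\<close> inside \<open>M\<close>; stability under scalars rests
  on commutativity of the ring. \<open>S\<close> is a bare set because the lemma is applied both to
  a power of an ideal and to a single power of an element.\<close>

lemma (in plain_module) colon_submodule:
  assumes L: "submodule L R M" and S: "S \<subseteq> carrier R"
  shows "submodule {x \<in> carrier M. \<forall>a\<in>S. a \<odot>\<^bsub>M\<^esub> x \<in> L} R M"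
proof (rule submoduleI_smult)
  show "\<zero>\<^bsub>M\<^esub> \<in> {x \<in> carrier M. \<forall>a\<in>S. a \<odot>\<^bsub>M\<^esub> x \<in> L}"
    using submodule_zero[OF L] S by (auto simp: subset_iff)
next
  fix x y assume xy: "x \<in> {x \<in> carrier M. \<forall>a\<in>S. a \<odot>\<^bsub>M\<^esub> x \<in> L}"
    "y \<in> {x \<in> carrier M. \<forall>a\<in>S. a \<odot>\<^bsub>M\<^esub> x \<in> L}"
  have "a \<odot>\<^bsub>M\<^esub> (x \<oplus>\<^bsub>M\<^esub> y) \<in> L" if "a \<in> S" for a
    using xy that S submoduleE(5)[OF L, of "a \<odot>\<^bsub>M\<^esub> x" "a \<odot>\<^bsub>M\<^esub> y"]
    by (simp add: smult_r_distr subset_iff)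
  then show "x \<oplus>\<^bsub>M\<^esub> y \<in> {x \<in> carrier M. \<forall>a\<in>S. a \<odot>\<^bsub>M\<^esub> x \<in> L}" using xy by simp
next
  fix r x assume r: "r \<in> carrier R" and x: "x \<in> {x \<in> carrier M. \<forall>a\<in>S. a \<odot>\<^bsub>M\<^esub> x \<in> L}"
  have "a \<odot>\<^bsub>M\<^esub> (r \<odot>\<^bsub>M\<^esub> x) \<in> L" if "a \<in> S" for a
  proof -
    have a: "a \<in> carrier R" using S that by blast
    have "a \<odot>\<^bsub>M\<^esub> (r \<odot>\<^bsub>M\<^esub> x) = r \<odot>\<^bsub>M\<^esub> (a \<odot>\<^bsub>M\<^esub> x)"
      using a r x by (simp add: smult_assoc1[symmetric] R.m_comm)
    then show ?thesis using submoduleE(4)[OF L r, of "a \<odot>\<^bsub>M\<^esub> x"] x that by simp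
  qed
  then show "r \<odot>\<^bsub>M\<^esub> x \<in> {x \<in> carrier M. \<forall>a\<in>S. a \<odot>\<^bsub>M\<^esub> x \<in> L}" using r x by simp
qed auto

text \<open>Through minimality of the generated ideal, this reduces a condition on all elements of
  an ideal to its generators.\<close>

lemma (in plain_module) colon_ideal:
  assumes L: "submodule L R M" and x: "x \<in> carrier M"
  shows "ideal {a \<in> carrier R. a \<odot>\<^bsub>M\<^esub> x \<in> L} R"
proof (rule idealI)
  show "ring R" by (rule R.ring_axioms)
  show "subgroup {a \<in> carrier R. a \<odot>\<^bsub>M\<^esub> x \<in> L} (add_monoid R)"
  proof (rule R.add.subgroupI)
    show "{a \<in> carrier R. a \<odot>\<^bsub>M\<^esub> x \<in> L} \<noteq> {}"
      using submodule_zero[OF L] x by (auto intro!: exI[of _ \<zero>])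
  qed (use x submoduleE(3,5)[OF L] in \<open>auto simp: smult_l_minus smult_l_distr\<close>)
next
  fix a r assume a: "a \<in> {a \<in> carrier R. a \<odot>\<^bsub>M\<^esub> x \<in> L}" and r: "r \<in> carrier R"
  show "r \<otimes> a \<in> {a \<in> carrier R. a \<odot>\<^bsub>M\<^esub> x \<in> L}"
    using a r x submoduleE(4)[OF L r] by (simp add: smult_assoc1)
  then show "a \<otimes> r \<in> {a \<in> carrier R. a \<odot>\<^bsub>M\<^esub> x \<in> L}"
    using a r by (simp add: R.m_comm)
qed

text \<open>The chain condition takes the place of a pigeonhole count on monomials. The colons
  \<open>C n\<close> of \<open>L\<close> by \<open>I^n\<close> stabilise, and at a stable stage an
  \<open>x\<close> with \<open>I x\<close> inside \<open>C n\<close> lies in \<open>C n\<close>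
  itself (\<open>colon\<close>). An element outside \<open>C n\<close> could be modified until every
  generator sends it into \<open>C n\<close>, which is then a contradiction; so \<open>C n\<close>
  is all of \<open>M\<close>.\<close>

lemma (in plain_module) ideal_power_nilpotent:
  assumes noeth: "noetherian_on R M (carrier M)" and L: "submodule L R M"
    and S: "finite S" "S \<subseteq> carrier R"
    and nil: "\<And>s. s \<in> S \<Longrightarrow> \<exists>n::nat. \<forall>x\<in>carrier M. s [^] n \<odot>\<^bsub>M\<^esub> x \<in> L"
  shows "\<exists>n. \<forall>a\<in>ideal_power R (Idl S) n. \<forall>x\<in>carrier M. a \<odot>\<^bsub>M\<^esub> x \<in> L"
proof -
  define I where "I = Idl S"
  have I: "ideal I R" unfolding I_def by (rule R.genideal_ideal[OF S(2)])
  have In: "ideal (ideal_power R I n) R" for n by (rule ideal_power_ideal[OF R.ring_axioms I])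
  define C where "C n = {x \<in> carrier M. \<forall>a\<in>ideal_power R I n. a \<odot>\<^bsub>M\<^esub> x \<in> L}" for n
  have C: "submodule (C n) R M" for n
    unfolding C_def by (rule colon_submodule[OF L]) (use ideal.Icarr[OF In] in blast)
  note CE = submoduleE[OF C]
  obtain K where K: "K \<in> range C" "\<And>J. J \<in> range C \<Longrightarrow> K \<subseteq> J \<Longrightarrow> J = K"
    using noetherian_on_maximal[OF noeth, of "C 0" "range C"] C CE(1) by blast
  then obtain n where n: "K = C n" by blast
  have "C n \<subseteq> C (Suc n)"
    using ideal_power_antimono[OF R.ring_axioms I, of n "Suc n"] unfolding C_def by auto
  then have stable: "C (Suc n) = C n" using K(2)[of "C (Suc n)"] n by blast
  have LC: "L \<subseteq> C n"
  proof
    fix x assume "x \<in> L"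
    then show "x \<in> C n"
      unfolding C_def using submoduleE(1,4)[OF L] ideal.Icarr[OF In] by blast
  qed
  have colon: "x \<in> C n" if x: "x \<in> carrier M" and Sx: "\<And>s. s \<in> S \<Longrightarrow> s \<odot>\<^bsub>M\<^esub> x \<in> C n" for x
  proof -
    have "I \<subseteq> {a \<in> carrier R. a \<odot>\<^bsub>M\<^esub> x \<in> C n}"
      unfolding I_def by (rule R.genideal_minimal[OF colon_ideal[OF C x]]) (use Sx S(2) in blast)
    then have Ix: "c \<odot>\<^bsub>M\<^esub> x \<in> C n" if "c \<in> I" for c using that by blast
    have "a \<odot>\<^bsub>M\<^esub> x \<in> L" if "a \<in> ideal_prod R (ideal_power R I n) I" for a
      using that
    proof (induction a rule: ideal_prod.induct)
      case (prod b c)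
      have "b \<in> carrier R" "c \<in> carrier R" using prod ideal.Icarr[OF In] ideal.Icarr[OF I] by auto
      then have "(b \<otimes> c) \<odot>\<^bsub>M\<^esub> x = b \<odot>\<^bsub>M\<^esub> (c \<odot>\<^bsub>M\<^esub> x)" using x by (rule smult_assoc1)
      then show ?case using Ix[OF prod(2)] prod(1) unfolding C_def by simp
    next
      case (sum b c)
      have "b \<in> carrier R" "c \<in> carrier R"
        using sum R.ideal_prod_in_carrier[OF In I] by blast+
      then have "(b \<oplus> c) \<odot>\<^bsub>M\<^esub> x = b \<odot>\<^bsub>M\<^esub> x \<oplus>\<^bsub>M\<^esub> c \<odot>\<^bsub>M\<^esub> x" using x by (rule smult_l_distr)
      then show ?case using submoduleE(5)[OF L sum(3,4)] by simp
    qed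
    then have "x \<in> C (Suc n)" unfolding C_def ideal_power_Suc using x by simp
    then show ?thesis using stable by simp
  qed
  have "x \<in> C n" if x: "x \<in> carrier M" for x
  proof (rule ccontr)
    assume notin: "x \<notin> C n"
    \<comment> \<open>The generators are treated one at a time: \<open>y\<close> is replaced by
      \<open>s^j y\<close> for the largest \<open>j\<close> that keeps it outside
      \<open>C n\<close>, so that one more factor \<open>s\<close> brings it inside. What was
      reached for earlier generators persists because \<open>C n\<close> is a submodule.\<close>
    have "\<exists>y\<in>carrier M - C n. \<forall>s\<in>T. s \<odot>\<^bsub>M\<^esub> y \<in> C n" if "T \<subseteq> S" for T
      using finite_subset[OF that S(1)] that
    proof (induction T rule: finite_induct)
      case empty
      then show ?case using x notin by blast
    next
      case (insert s T)
      then obtain y where y: "y \<in> carrier M" "y \<notin> C n" "\<And>t. t \<in> T \<Longrightarrow> t \<odot>\<^bsub>M\<^esub> y \<in> C n" by blast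
      have s: "s \<in> S" "s \<in> carrier R" using insert S(2) by auto
      obtain m :: nat where "s [^] m \<odot>\<^bsub>M\<^esub> y \<in> C n" using nil[OF s(1)] y(1) LC by blast
      then obtain k :: nat where k: "s [^] k \<odot>\<^bsub>M\<^esub> y \<in> C n"
        and least: "\<And>j. j < k \<Longrightarrow> s [^] j \<odot>\<^bsub>M\<^esub> y \<notin> C n"
        using exists_least_iff[of "\<lambda>k. s [^] k \<odot>\<^bsub>M\<^esub> y \<in> C n"] by blast
      have "k \<noteq> 0"
      proof
        assume "k = 0"
        then show False using k y(1,2) by simp
      qed
      then obtain j where j: "k = Suc j" using not0_implies_Suc by blast
      let ?z = "s [^] j \<odot>\<^bsub>M\<^esub> y"
      have pj: "s [^] j \<in> carrier R" using s(2) by simp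
      have z: "?z \<in> carrier M" "?z \<notin> C n" using pj y(1) least[of j] j by auto
      have "s \<odot>\<^bsub>M\<^esub> ?z = s [^] k \<odot>\<^bsub>M\<^esub> y"
        using s(2) pj y(1) j by (simp add: smult_assoc1[symmetric] R.m_comm)
      then have "s \<odot>\<^bsub>M\<^esub> ?z \<in> C n" using k by simp
      moreover have "t \<odot>\<^bsub>M\<^esub> ?z \<in> C n" if "t \<in> T" for t
      proof -
        have "t \<in> carrier R" using that insert S(2) by blast
        then have "t \<odot>\<^bsub>M\<^esub> ?z = s [^] j \<odot>\<^bsub>M\<^esub> (t \<odot>\<^bsub>M\<^esub> y)"
          using pj y(1) by (simp add: smult_assoc1[symmetric] R.m_comm)
        then show ?thesis using CE(4)[OF pj y(3)[OF that]] by simp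
      qed
      ultimately show ?case using z by blast
    qed
    then obtain y where "y \<in> carrier M - C n" "\<forall>s\<in>S. s \<odot>\<^bsub>M\<^esub> y \<in> C n" by blast
    then show False using colon by blast
  qed
  then show ?thesis unfolding C_def I_def by blast
qed

text \<open>A submodule \<open>L\<close> of \<open>M\<close> maximal with \<open>f\<inverse>(L) \<inter> E' = I E' + (ker f \<inter> E')\<close> contains \<open>I\<^sup>n M\<close> for some \<open>n\<close>:
  for \<open>a \<in> I\<close> and large \<open>n\<close>, stabilisation of \<open>(L : a\<^sup>n)\<close> shows that \<open>L + a\<^sup>n M\<close> has the same property.\<close>

lemma artin_rees:
  assumes E: "plain_module R E" and M: "plain_module R M" and f: "linear_map R E M f"
    and R: "noetherian_ring R" and noeth: "noetherian_on R M (carrier M)"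
    and I: "ideal I R" and E': "submodule E' R E"
  shows "\<exists>n. \<forall>e\<in>E'. f e \<in> smult_span (ideal_power R I n) M (carrier M)
                 \<longrightarrow> f e \<in> f ` smult_span I E E'"
proof -
  interpret M: plain_module R M by fact
  interpret E: plain_module R E by fact
  note fD = linear_mapD[OF f]
  note EE = E.submoduleE[OF E']
  define P where "P = smult_span I E E'"
  have P: "submodule P R E" unfolding P_def by (rule E.smult_span_submodule[OF I EE(1)])
  define \<F> where "\<F> = {L. submodule L R M \<and> f ` P \<subseteq> L \<and> (\<forall>e\<in>E'. f e \<in> L \<longrightarrow> f e \<in> f ` P)}"
  have "f ` P \<in> \<F>" using submodule_image[OF E M f P] by (simp add: \<F>_def)
  moreover have "submodule L R M \<and> L \<subseteq> carrier M" if "L \<in> \<F>" for L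
    using that M.submoduleE(1)[of L] by (simp add: \<F>_def)
  ultimately obtain L where "L \<in> \<F>" and maxL: "\<And>K. K \<in> \<F> \<Longrightarrow> L \<subseteq> K \<Longrightarrow> K = L"
    using noetherian_on_maximal[OF noeth, of "f ` P" \<F>] by blast
  then have L: "submodule L R M" and PL: "f ` P \<subseteq> L"
    and EL: "\<And>e. e \<in> E' \<Longrightarrow> f e \<in> L \<Longrightarrow> f e \<in> f ` P"
    by (simp_all add: \<F>_def)
  note LE = M.submoduleE[OF L]
  have nil: "\<exists>n::nat. \<forall>x\<in>carrier M. a [^]\<^bsub>R\<^esub> n \<odot>\<^bsub>M\<^esub> x \<in> L" if a: "a \<in> I" for a
  proof -
    have aR: "a \<in> carrier R" using ideal.Icarr[OF I a] .
    have pn: "a [^]\<^bsub>R\<^esub> n \<in> carrier R" for n :: nat using aR by simp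
    define C where "C n = {x \<in> carrier M. \<forall>b\<in>{a [^]\<^bsub>R\<^esub> n}. b \<odot>\<^bsub>M\<^esub> x \<in> L}" for n :: nat
    have C: "submodule (C n) R M" for n
      unfolding C_def by (rule M.colon_submodule[OF L]) (use pn in blast)
    obtain K where K: "K \<in> range C" "\<And>J. J \<in> range C \<Longrightarrow> K \<subseteq> J \<Longrightarrow> J = K"
      using noetherian_on_maximal[OF noeth, of "C 0" "range C"] C M.submoduleE(1)[OF C] by blast
    then obtain n where n: "K = C n" by blast
    have pow_Suc: "a [^]\<^bsub>R\<^esub> Suc n \<odot>\<^bsub>M\<^esub> y = a \<odot>\<^bsub>M\<^esub> (a [^]\<^bsub>R\<^esub> n \<odot>\<^bsub>M\<^esub> y)" if "y \<in> carrier M" for y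
      using that aR pn[of n] by (simp add: M.smult_assoc1[symmetric] M.R.m_comm)
    have "C n \<subseteq> C (Suc n)"
    proof
      fix y assume "y \<in> C n"
      then have y: "y \<in> carrier M" "a [^]\<^bsub>R\<^esub> n \<odot>\<^bsub>M\<^esub> y \<in> L" by (auto simp: C_def)
      then have "a [^]\<^bsub>R\<^esub> Suc n \<odot>\<^bsub>M\<^esub> y \<in> L" using pow_Suc LE(4)[OF aR] by simp
      then show "y \<in> C (Suc n)" using y(1) by (simp add: C_def)
    qed
    then have stable: "C (Suc n) = C n" using K(2)[of "C (Suc n)"] n by blast
    let ?a = "\<lambda>y. a [^]\<^bsub>R\<^esub> n \<odot>\<^bsub>M\<^esub> y"
    \<comment> \<open>This is \<open>L + a^n M\<close>. Once it is shown to belong to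
      \<open>\<F>\<close>, maximality of \<open>L\<close> makes it equal to \<open>L\<close>, which
      says that \<open>a^n\<close> maps \<open>M\<close> into \<open>L\<close>.\<close>
    let ?K = "{l \<oplus>\<^bsub>M\<^esub> ?a y | l y. l \<in> L \<and> y \<in> carrier M}"
    have ac: "?a y \<in> carrier M" if "y \<in> carrier M" for y using that pn[of n] by simp
    have lc: "l \<in> carrier M" if "l \<in> L" for l using that LE(1) by blast
    have K: "submodule ?K R M"
    proof (rule M.submoduleI_smult)
      show "?K \<subseteq> carrier M" using ac lc by auto
      have "\<zero>\<^bsub>M\<^esub> = \<zero>\<^bsub>M\<^esub> \<oplus>\<^bsub>M\<^esub> ?a \<zero>\<^bsub>M\<^esub>" using pn[of n] by simp
      then show "\<zero>\<^bsub>M\<^esub> \<in> ?K" using M.submodule_zero[OF L] M.M.zero_closed by blast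
    next
      fix x y assume "x \<in> ?K" "y \<in> ?K"
      then obtain l u k v where *: "x = l \<oplus>\<^bsub>M\<^esub> ?a u" "y = k \<oplus>\<^bsub>M\<^esub> ?a v"
        "l \<in> L" "k \<in> L" "u \<in> carrier M" "v \<in> carrier M" by blast
      have "x \<oplus>\<^bsub>M\<^esub> y = (l \<oplus>\<^bsub>M\<^esub> k) \<oplus>\<^bsub>M\<^esub> ?a (u \<oplus>\<^bsub>M\<^esub> v)"
        using * lc[OF *(3)] lc[OF *(4)] ac pn[of n] by (simp add: M.smult_r_distr M.M.a_ac)
      then show "x \<oplus>\<^bsub>M\<^esub> y \<in> ?K" using LE(5)[OF *(3,4)] M.M.add.m_closed[OF *(5,6)] by blast
    next
      fix r x assume r: "r \<in> carrier R" and "x \<in> ?K"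
      then obtain l u where *: "x = l \<oplus>\<^bsub>M\<^esub> ?a u" "l \<in> L" "u \<in> carrier M" by blast
      have "r \<odot>\<^bsub>M\<^esub> ?a u = ?a (r \<odot>\<^bsub>M\<^esub> u)"
        using r *(3) pn[of n] by (simp add: M.smult_assoc1[symmetric] M.R.m_comm)
      then have "r \<odot>\<^bsub>M\<^esub> x = r \<odot>\<^bsub>M\<^esub> l \<oplus>\<^bsub>M\<^esub> ?a (r \<odot>\<^bsub>M\<^esub> u)"
        using * r lc[OF *(2)] ac[OF *(3)] by (simp add: M.smult_r_distr)
      then show "r \<odot>\<^bsub>M\<^esub> x \<in> ?K" using LE(4)[OF r *(2)] M.smult_closed[OF r *(3)] by blast
    qed
    have LK: "L \<subseteq> ?K"
    proof
      fix l assume l: "l \<in> L"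
      have "l = l \<oplus>\<^bsub>M\<^esub> ?a \<zero>\<^bsub>M\<^esub>" using pn[of n] lc[OF l] by simp
      then show "l \<in> ?K" using l M.M.zero_closed by blast
    qed
    \<comment> \<open>Multiplying \<open>f e = l + a^n y\<close> by \<open>a\<close> gives
      \<open>a^(n+1) y = f (a e) - a l\<close>. Here \<open>a e\<close> lies in \<open>P\<close>
      because \<open>a\<close> is in \<open>I\<close>, so the right-hand side is in
      \<open>L\<close>. Stability of the colons lowers the exponent: already \<open>a^n y\<close> is
      in \<open>L\<close>, hence so is \<open>f e\<close>, and the defining property of
      \<open>L\<close> applies.\<close>
    have "f e \<in> f ` P" if e: "e \<in> E'" and "f e \<in> ?K" for e
    proof -
      from that(2) obtain l y where ly: "f e = l \<oplus>\<^bsub>M\<^esub> ?a y" "l \<in> L" "y \<in> carrier M" by blast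
      have ec: "e \<in> carrier E" using e EE(1) by blast
      have al: "a \<odot>\<^bsub>M\<^esub> l \<in> L" using LE(4)[OF aR ly(2)] .
      have "a \<odot>\<^bsub>E\<^esub> e \<in> P" unfolding P_def by (rule smult_span_incl[OF a e])
      then have "f (a \<odot>\<^bsub>E\<^esub> e) \<in> L" using PL by blast
      moreover have eq: "f (a \<odot>\<^bsub>E\<^esub> e) = a \<odot>\<^bsub>M\<^esub> l \<oplus>\<^bsub>M\<^esub> a [^]\<^bsub>R\<^esub> Suc n \<odot>\<^bsub>M\<^esub> y"
        unfolding fD(3)[OF aR ec] ly(1) pow_Suc[OF ly(3)]
        by (rule M.smult_r_distr[OF aR lc[OF ly(2)] ac[OF ly(3)]])
      moreover have "a [^]\<^bsub>R\<^esub> Suc n \<odot>\<^bsub>M\<^esub> y \<in> carrier M"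
        using M.smult_closed[OF pn ly(3)] .
      then have "(a \<odot>\<^bsub>M\<^esub> l \<oplus>\<^bsub>M\<^esub> a [^]\<^bsub>R\<^esub> Suc n \<odot>\<^bsub>M\<^esub> y) \<ominus>\<^bsub>M\<^esub> a \<odot>\<^bsub>M\<^esub> l = a [^]\<^bsub>R\<^esub> Suc n \<odot>\<^bsub>M\<^esub> y"
        using lc[OF al] by (simp add: a_minus_def M.M.a_ac M.M.r_neg2 M.M.r_neg1 M.M.r_neg del: nat_pow_Suc M.R.nat_pow_Suc)
      ultimately have "a [^]\<^bsub>R\<^esub> Suc n \<odot>\<^bsub>M\<^esub> y \<in> L"
        using M.submodule_minus[OF L _ al, of "f (a \<odot>\<^bsub>E\<^esub> e)"] by simp
      then have "y \<in> C (Suc n)" using ly(3) by (simp add: C_def)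
      then have "y \<in> C n" by (simp only: stable)
      then have "?a y \<in> L" by (simp add: C_def)
      then have "f e \<in> L" using ly(1,2) LE(5) by simp
      then show ?thesis by (rule EL[OF e])
    qed
    moreover have "f ` P \<subseteq> ?K" using PL LK by (rule subset_trans)
    ultimately have "?K \<in> \<F>" using K by (simp only: \<F>_def mem_Collect_eq) blast
    then have KL: "?K = L" using LK by (rule maxL)
    have "?a x \<in> L" if x: "x \<in> carrier M" for x
    proof -
      have "?a x = \<zero>\<^bsub>M\<^esub> \<oplus>\<^bsub>M\<^esub> ?a x" using ac[OF x] by simp
      then have "?a x \<in> ?K" using M.submodule_zero[OF L] x by blast
      then show ?thesis using KL by simp
    qed
    then show ?thesis by blast
  qed
  \<comment> \<open>The exponent found above depends on \<open>a\<close>. A common exponent for a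
    power of the ideal needs finitely many generators, each lying in \<open>I\<close>.\<close>
  obtain S where S: "S \<subseteq> carrier R" "finite S" "I = Idl\<^bsub>R\<^esub> S"
    using noetherian_ring.finetely_gen[OF R I] by blast
  have "S \<subseteq> I" unfolding S(3) by (rule M.R.genideal_self[OF S(1)])
  then obtain n where n: "\<forall>a\<in>ideal_power R I n. \<forall>x\<in>carrier M. a \<odot>\<^bsub>M\<^esub> x \<in> L"
    using M.ideal_power_nilpotent[OF noeth L S(2,1)] nil S(3) by blast
  have "smult_span (ideal_power R I n) M (carrier M) \<subseteq> L"
    by (rule M.smult_span_minimal[OF L]) (use n in blast)
  then show ?thesis using EL unfolding P_def by blast
qed

text \<open>Induction on the number of maps. An element with small images is first matched on the
  earlier maps by the induction hypothesis; the difference lies in their common kernel, where the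
  last map is corrected by \<open>artin_rees\<close>. The exponent \<open>i\<close> is left general
  because the induction hypothesis is invoked at a larger one.\<close>

lemma artin_rees_family:
  fixes f :: "nat \<Rightarrow> 'e \<Rightarrow> 'm"
  assumes E: "plain_module R E" and M: "plain_module R M"
    and f: "\<And>l. l < k \<Longrightarrow> linear_map R E M (f l)"
    and R: "noetherian_ring R" and noeth: "noetherian_on R M (carrier M)" and I: "ideal I R"
  shows "\<exists>n. \<forall>e\<in>carrier E. (\<forall>l<k. f l e \<in> smult_span (ideal_power R I n) M (carrier M))
           \<longrightarrow> (\<exists>e'\<in>smult_span (ideal_power R I i) E (carrier E). \<forall>l<k. f l e = f l e')"
  using f
proof (induction k arbitrary: i)
  interpret E: plain_module R E by fact
  have Ii: "ideal (ideal_power R I i) R" for i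
    by (rule ideal_power_ideal[OF noetherian_ring.axioms(1)[OF R] I])
  case 0
  have "\<zero>\<^bsub>E\<^esub> \<in> smult_span (ideal_power R I i) E (carrier E)"
    by (rule E.submodule_zero[OF E.smult_span_submodule[OF Ii subset_refl]])
  then show ?case by blast
next
  interpret M: plain_module R M by fact
  interpret E: plain_module R E by fact
  have Ii: "ideal (ideal_power R I i) R" for i
    by (rule ideal_power_ideal[OF noetherian_ring.axioms(1)[OF R] I])
  have span_E: "submodule (smult_span (ideal_power R I i) E (carrier E)) R E" for i
    by (rule E.smult_span_submodule[OF Ii subset_refl])
  have span_M: "submodule (smult_span (ideal_power R I i) M (carrier M)) R M" for i
    by (rule M.smult_span_submodule[OF Ii subset_refl])
  have mono: "smult_span (ideal_power R I j) N (carrier N) \<subseteq> smult_span (ideal_power R I i) N (carrier N)"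
    if "i \<le> j" "plain_module R N" for i j and N :: "('a, 'x) module"
    by (rule smult_span_mono[OF that(2) ideal_power_antimono[OF noetherian_ring.axioms(1)[OF R] I that(1)] subset_refl])
  case (Suc k)
  have fl: "linear_map R E M (f l)" if "l \<le> k" for l using Suc.prems that by simp
  note fD = linear_mapD[OF fl]
  \<comment> \<open>This is the reason why \<open>artin_rees\<close> speaks of a submodule
    \<open>E'\<close>: a correction taken from \<open>I^i K\<close> adjusts \<open>f k\<close> and
    leaves the values of the earlier maps alone.\<close>
  define K where "K = {e \<in> carrier E. \<forall>l<k. f l e = \<zero>\<^bsub>M\<^esub>}"
  have K: "submodule K R E"
    unfolding K_def
  proof (rule E.submoduleI_smult)
    show "\<zero>\<^bsub>E\<^esub> \<in> {e \<in> carrier E. \<forall>l<k. f l e = \<zero>\<^bsub>M\<^esub>}"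
      using linear_map_zero[OF E M fl] by simp
  qed (auto simp: fD(2)[OF less_imp_le] fD(3)[OF less_imp_le])
  obtain n1 where n1: "\<And>e. e \<in> K \<Longrightarrow>
      f k e \<in> smult_span (ideal_power R (ideal_power R I i) n1) M (carrier M) \<Longrightarrow>
      f k e \<in> f k ` smult_span (ideal_power R I i) E K"
    using artin_rees[OF E M fl[OF order_refl] R noeth Ii K] by blast
  have pow: "ideal_power R (ideal_power R I i) n1 = ideal_power R I (i * n1)"
    by (rule ideal_power_ideal_power[OF M.is_cring I])
  \<comment> \<open>There are two demands on \<open>e'\<close>: an exponent at least
    \<open>i\<close>, since \<open>e'\<close> is a summand of the final witness, and at least
    \<open>i * n1\<close>, so that \<open>f k e'\<close> is small enough for \<open>n1\<close> to
    apply to \<open>e - e'\<close>. Hence \<open>n1\<close> is fixed before the induction hypothesis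
    is invoked.\<close>
  define i' where "i' = max i (i * n1)"
  obtain n2 where n2: "\<And>e. e \<in> carrier E \<Longrightarrow>
      (\<And>l. l < k \<Longrightarrow> f l e \<in> smult_span (ideal_power R I n2) M (carrier M)) \<Longrightarrow>
      \<exists>e'\<in>smult_span (ideal_power R I i') E (carrier E). \<forall>l<k. f l e = f l e'"
    using Suc.IH[of i'] Suc.prems by (metis less_SucI)
  show ?case
  proof (intro exI[of _ "max n2 (i * n1)"] ballI impI)
    fix e assume e: "e \<in> carrier E"
      and *: "\<forall>l<Suc k. f l e \<in> smult_span (ideal_power R I (max n2 (i * n1))) M (carrier M)"
    have "f l e \<in> smult_span (ideal_power R I n2) M (carrier M)" if "l < k" for l
      by (rule subsetD[OF mono[OF max.cobounded1[of n2 "i * n1"] M]]) (use * that in simp)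
    then obtain e' where e': "e' \<in> smult_span (ideal_power R I i') E (carrier E)"
      and fe': "\<And>l. l < k \<Longrightarrow> f l e = f l e'"
      using n2[OF e] by blast
    have e'c: "e' \<in> carrier E" using e' E.submoduleE(1)[OF span_E] by blast
    have sub: "f l (e \<ominus>\<^bsub>E\<^esub> e') = f l e \<ominus>\<^bsub>M\<^esub> f l e'" if "l \<le> k" for l
      using e e'c by (simp add: a_minus_def fD(2)[OF that] linear_map_minus[OF E M fl[OF that]])
    have dc: "e \<ominus>\<^bsub>E\<^esub> e' \<in> carrier E" using e e'c by simp
    have "f l (e \<ominus>\<^bsub>E\<^esub> e') = \<zero>\<^bsub>M\<^esub>" if "l < k" for l
      using sub[of l] fe'[OF that] fD(1)[of l e'] that e'c by (simp add: a_minus_def M.M.r_neg)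
    then have dK: "e \<ominus>\<^bsub>E\<^esub> e' \<in> K" using dc by (simp add: K_def)
    have fe: "f k e \<in> smult_span (ideal_power R I (i * n1)) M (carrier M)"
      by (rule subsetD[OF mono[OF max.cobounded2[of "i * n1" n2] M]]) (use * in simp)
    have e'E: "e' \<in> smult_span (ideal_power R I (i * n1)) E (carrier E)"
      by (rule subsetD[OF mono[OF max.cobounded2 E] e'[unfolded i'_def]])
    have "f k ` carrier E \<subseteq> carrier M" using fD(1)[OF order_refl] by blast
    then have "f k e' \<in> smult_span (ideal_power R I (i * n1)) M (carrier M)"
      by (rule linear_map_smult_span[OF E M fl[OF order_refl] Ii _ subset_refl subset_refl e'E])
    then have "f k (e \<ominus>\<^bsub>E\<^esub> e') \<in> smult_span (ideal_power R (ideal_power R I i) n1) M (carrier M)"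
      unfolding pow sub[OF order_refl] by (rule M.submodule_minus[OF span_M fe])
    then obtain u where u: "u \<in> smult_span (ideal_power R I i) E K" and fu: "f k (e \<ominus>\<^bsub>E\<^esub> e') = f k u"
      using n1[OF dK] by blast
    have uK: "u \<in> K" using u E.smult_span_subset[OF Ii K] by blast
    then have uc: "u \<in> carrier E" by (simp add: K_def)
    have "u \<in> smult_span (ideal_power R I i) E (carrier E)"
      by (rule subsetD[OF smult_span_mono[OF E subset_refl E.submoduleE(1)[OF K]] u])
    moreover have "e' \<in> smult_span (ideal_power R I i) E (carrier E)"
      by (rule subsetD[OF mono[OF max.cobounded1 E] e'[unfolded i'_def]])
    ultimately have "e' \<oplus>\<^bsub>E\<^esub> u \<in> smult_span (ideal_power R I i) E (carrier E)"
      by (intro E.submoduleE(5)[OF span_E])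
    moreover have "f l e = f l (e' \<oplus>\<^bsub>E\<^esub> u)" if "l < Suc k" for l
    proof (cases "l = k")
      case True
      have "f k (e' \<oplus>\<^bsub>E\<^esub> u) = f k e' \<oplus>\<^bsub>M\<^esub> (f k e \<ominus>\<^bsub>M\<^esub> f k e')"
        using fD(2)[OF order_refl e'c uc] fu sub[OF order_refl] by simp
      also have "\<dots> = f k e"
        using fD(1)[OF order_refl e] fD(1)[OF order_refl e'c]
        by (simp add: M.M.a_comm[of "f k e'"] a_minus_def M.M.a_assoc M.M.l_neg)
      finally show ?thesis using True by simp
    next
      case False
      then have l: "l < k" using that by simp
      then have "f l u = \<zero>\<^bsub>M\<^esub>" using uK by (simp add: K_def)
      then show ?thesis
        using fD(1)[OF less_imp_le[OF l] e'c] fD(2)[OF less_imp_le[OF l] e'c uc] fe'[OF l] by simp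
    qed
    ultimately show "\<exists>e'\<in>smult_span (ideal_power R I i) E (carrier E). \<forall>l<Suc k. f l e = f l e'"
      by blast
  qed
qed

section \<open>Finite representations\<close>

definition rep_hom ::
    "'g monoid \<Rightarrow> 'r ring \<Rightarrow> ('r, 'm) module \<Rightarrow> ('g \<Rightarrow> 'm \<Rightarrow> 'm)
       \<Rightarrow> ('r, 'n) module \<Rightarrow> ('g \<Rightarrow> 'n \<Rightarrow> 'n) \<Rightarrow> ('m \<Rightarrow> 'n) \<Rightarrow> bool" where
  "rep_hom G R M act N act' h \<longleftrightarrow> linear_map R M N h
     \<and> (\<forall>g \<in> carrier G. \<forall>x \<in> carrier M. h (act g x) = act' g (h x))"

lemma rep_hom_isomorphic:
  assumes "rep_hom G R M act N act' h" "bij_betw h (carrier M) (carrier N)"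
  shows "group_ring_isomorphic G R M act N act'"
  unfolding group_ring_isomorphic_def
  using assms by (intro exI[of _ h]) (simp add: rep_hom_def linear_map_def)

text \<open>Transport of the module axioms to a bare record along a surjection. The condition on
  zero has to be assumed: \<open>linear_map_zero\<close> would derive it from the axioms of the
  target, which are the point at issue.\<close>

lemma plain_module_image:
  assumes M: "plain_module R M" and h: "linear_map R M N h"
    and surj: "h ` carrier M = carrier N" and zero: "h \<zero>\<^bsub>M\<^esub> = \<zero>\<^bsub>N\<^esub>"
  shows "plain_module R N"
proof -
  interpret M: plain_module R M by fact
  note hD = linear_mapD[OF h]
  have ex: "\<exists>a\<in>carrier M. x = h a" if "x \<in> carrier N" for x
    using that surj by blast
  have z: "\<zero>\<^bsub>N\<^esub> \<in> carrier N" unfolding zero[symmetric] by (rule hD(1)) simp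
  have ab: "abelian_group N"
  proof (rule abelian_groupI)
    fix x y assume "x \<in> carrier N" "y \<in> carrier N"
    then obtain a b where ab: "a \<in> carrier M" "b \<in> carrier M" "x = h a" "y = h b"
      using ex by meson
    then have eq: "x \<oplus>\<^bsub>N\<^esub> y = h (a \<oplus>\<^bsub>M\<^esub> b)" "y \<oplus>\<^bsub>N\<^esub> x = h (b \<oplus>\<^bsub>M\<^esub> a)"
      using hD(2) by simp_all
    then show "x \<oplus>\<^bsub>N\<^esub> y \<in> carrier N" using ab hD(1) by simp
    show "x \<oplus>\<^bsub>N\<^esub> y = y \<oplus>\<^bsub>N\<^esub> x" unfolding eq using ab(1,2) M.M.a_comm by simp
    fix w assume "w \<in> carrier N"
    then obtain c where c: "c \<in> carrier M" "w = h c" using ex by blast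
    then show "x \<oplus>\<^bsub>N\<^esub> y \<oplus>\<^bsub>N\<^esub> w = x \<oplus>\<^bsub>N\<^esub> (y \<oplus>\<^bsub>N\<^esub> w)"
      using ab hD(2)[symmetric] by (simp add: M.M.a_assoc)
  next
    fix x assume "x \<in> carrier N"
    then obtain a where a: "a \<in> carrier M" "x = h a" using ex by blast
    show "\<zero>\<^bsub>N\<^esub> \<oplus>\<^bsub>N\<^esub> x = x"
      unfolding zero[symmetric] a(2) hD(2)[OF M.M.zero_closed a(1), symmetric] using a(1) by simp
    have "h (\<ominus>\<^bsub>M\<^esub> a) \<oplus>\<^bsub>N\<^esub> x = \<zero>\<^bsub>N\<^esub>"
      unfolding zero[symmetric] a(2) hD(2)[OF M.M.a_inv_closed[OF a(1)] a(1), symmetric]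
      using a(1) by (simp add: M.M.l_neg)
    then show "\<exists>y\<in>carrier N. y \<oplus>\<^bsub>N\<^esub> x = \<zero>\<^bsub>N\<^esub>"
      using hD(1)[OF M.M.a_inv_closed[OF a(1)]] by blast
  qed (rule z)
  show ?thesis
    unfolding plain_module_def
  proof (rule moduleI[OF M.is_cring ab])
    fix a x assume a: "a \<in> carrier R" and "x \<in> carrier N"
    then obtain u where u: "u \<in> carrier M" "x = h u" using ex by blast
    show "a \<odot>\<^bsub>N\<^esub> x \<in> carrier N"
      unfolding u(2) hD(3)[OF a u(1), symmetric] by (rule hD(1)) (simp add: a u)
    show "(a \<oplus>\<^bsub>R\<^esub> b) \<odot>\<^bsub>N\<^esub> x = a \<odot>\<^bsub>N\<^esub> x \<oplus>\<^bsub>N\<^esub> b \<odot>\<^bsub>N\<^esub> x"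
      and "(a \<otimes>\<^bsub>R\<^esub> b) \<odot>\<^bsub>N\<^esub> x = a \<odot>\<^bsub>N\<^esub> (b \<odot>\<^bsub>N\<^esub> x)" if "b \<in> carrier R" for b
      using a that u(1) unfolding u(2)
      by (simp_all add: hD(2)[symmetric] hD(3)[symmetric] M.smult_l_distr M.smult_assoc1)
    show "a \<odot>\<^bsub>N\<^esub> (x \<oplus>\<^bsub>N\<^esub> y) = a \<odot>\<^bsub>N\<^esub> x \<oplus>\<^bsub>N\<^esub> a \<odot>\<^bsub>N\<^esub> y" if "y \<in> carrier N" for y
    proof -
      obtain v where v: "v \<in> carrier M" "y = h v" using ex \<open>y \<in> carrier N\<close> by blast
      show ?thesis using a u(1) v(1) unfolding u(2) v(2)
        by (simp add: hD(2)[symmetric] hD(3)[symmetric] M.smult_r_distr)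
    qed
  next
    fix x assume "x \<in> carrier N"
    then obtain u where u: "u \<in> carrier M" "x = h u" using ex by blast
    show "\<one>\<^bsub>R\<^esub> \<odot>\<^bsub>N\<^esub> x = x"
      using u(1) unfolding u(2) by (simp add: hD(3)[symmetric])
  qed
qed

lemma group_ring_moduleD:
  assumes "group_ring_module G R M act"
  shows "plain_module R M"
    and "g \<in> carrier G \<Longrightarrow> linear_map R M M (act g)"
    and "g \<in> carrier G \<Longrightarrow> g' \<in> carrier G \<Longrightarrow> x \<in> carrier M \<Longrightarrow> act (g \<otimes>\<^bsub>G\<^esub> g') x = act g (act g' x)"
    and "x \<in> carrier M \<Longrightarrow> act \<one>\<^bsub>G\<^esub> x = x"
  using assms by (simp_all add: group_ring_module_def plain_module_def linear_map_def)

lemma group_ring_moduleI: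
  assumes "plain_module R M"
    and "\<And>g. g \<in> carrier G \<Longrightarrow> linear_map R M M (act g)"
    and "\<And>g g' x. g \<in> carrier G \<Longrightarrow> g' \<in> carrier G \<Longrightarrow> x \<in> carrier M \<Longrightarrow>
           act (g \<otimes>\<^bsub>G\<^esub> g') x = act g (act g' x)"
    and "\<And>x. x \<in> carrier M \<Longrightarrow> act \<one>\<^bsub>G\<^esub> x = x"
  shows "group_ring_module G R M act"
  using assms by (simp add: group_ring_module_def plain_module_def linear_map_def)

lemma group_ring_module_image:
  assumes G: "monoid G" and M: "group_ring_module G R M act" and h: "rep_hom G R M act N act' h"
    and surj: "h ` carrier M = carrier N" and zero: "h \<zero>\<^bsub>M\<^esub> = \<zero>\<^bsub>N\<^esub>"
  shows "group_ring_module G R N act'"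
proof -
  interpret G: monoid G by fact
  note MD = group_ring_moduleD[OF M]
  interpret M: plain_module R M by (rule MD(1))
  have hl: "linear_map R M N h" and ha: "\<And>g x. g \<in> carrier G \<Longrightarrow> x \<in> carrier M \<Longrightarrow> h (act g x) = act' g (h x)"
    using h by (auto simp: rep_hom_def)
  note hD = linear_mapD[OF hl]
  have ex: "\<exists>a\<in>carrier M. x = h a" if "x \<in> carrier N" for x
    using that surj by blast
  show ?thesis
  proof (rule group_ring_moduleI)
    show "plain_module R N" by (rule plain_module_image[OF MD(1) hl surj zero])
  next
    fix g assume g: "g \<in> carrier G"
    note aD = linear_mapD[OF MD(2)[OF g]]
    have 1: "act' g x \<in> carrier N" if "x \<in> carrier N" for x
    proof -
      obtain a where a: "a \<in> carrier M" "x = h a" using ex \<open>x \<in> carrier N\<close> by blast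
      show ?thesis unfolding a(2) ha[OF g a(1), symmetric] by (rule hD(1)[OF aD(1)[OF a(1)]])
    qed
    have 2: "act' g (x \<oplus>\<^bsub>N\<^esub> y) = act' g x \<oplus>\<^bsub>N\<^esub> act' g y" if "x \<in> carrier N" "y \<in> carrier N" for x y
    proof -
      obtain a where a: "a \<in> carrier M" "x = h a" using ex \<open>x \<in> carrier N\<close> by blast
      obtain b where b: "b \<in> carrier M" "y = h b" using ex \<open>y \<in> carrier N\<close> by blast
      show ?thesis unfolding a(2) b(2)
        using a(1) b(1) aD(1)[of a] aD(1)[of b] g
        by (simp add: hD(2)[symmetric] ha[symmetric] aD(2))
    qed
    have 3: "act' g (r \<odot>\<^bsub>N\<^esub> x) = r \<odot>\<^bsub>N\<^esub> act' g x" if "r \<in> carrier R" "x \<in> carrier N" for r x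
    proof -
      obtain a where a: "a \<in> carrier M" "x = h a" using ex \<open>x \<in> carrier N\<close> by blast
      show ?thesis unfolding a(2)
        using a(1) aD(1)[of a] g that(1)
        by (simp add: hD(3)[symmetric] ha[symmetric] aD(3))
    qed
    show "linear_map R N N (act' g)" unfolding linear_map_def using 1 2 3 by simp
  next
    fix g g' x assume g: "g \<in> carrier G" "g' \<in> carrier G" and "x \<in> carrier N"
    then obtain a where a: "a \<in> carrier M" "x = h a" using ex by blast
    have "act g' a \<in> carrier M" by (rule linear_mapD(1)[OF MD(2)[OF g(2)] a(1)])
    then show "act' (g \<otimes>\<^bsub>G\<^esub> g') x = act' g (act' g' x)"
      unfolding a(2) using g a(1) by (simp add: ha[symmetric] MD(3))
  next
    fix x assume "x \<in> carrier N"
    then obtain a where a: "a \<in> carrier M" "x = h a" using ex by blast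
    then show "act' \<one>\<^bsub>G\<^esub> x = x" by (simp add: ha[symmetric] MD(4))
  qed
qed

text \<open>For a finite discrete module the action is continuous iff all the transporters
  \<open>{g. g x = y}\<close> are open.\<close>

definition finite_rep ::
    "nat \<Rightarrow> 'g monoid \<Rightarrow> 'g topology \<Rightarrow> (nat \<Rightarrow> int, 'm) module \<Rightarrow> ('g \<Rightarrow> 'm \<Rightarrow> 'm) \<Rightarrow> bool" where
  "finite_rep p G T M act \<longleftrightarrow> group_ring_module G (padic_ints p) M act \<and> finite (carrier M)
     \<and> (\<forall>x \<in> carrier M. \<forall>y \<in> carrier M. openin T {g \<in> carrier G. act g x = y})"

text \<open>In one direction the action is restricted to the slice of a fixed \<open>x\<close>; in
  the other, the preimage of a set is a union of boxes formed by a transporter and a point. Unlike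
  membership in \<open>finite_padic_reps\<close>, \<open>finite_rep\<close> makes sense for every
  carrier type, as is required for quotients and powers.\<close>

lemma finite_padic_reps_iff:
  assumes T: "topspace T = carrier G"
  shows "(M, act) \<in> finite_padic_reps p G T \<longleftrightarrow> finite_rep p G T M act"
proof -
  let ?X = "discrete_topology (carrier M)"
  have "continuous_map (prod_topology T ?X) ?X (\<lambda>(g, x). act g x) \<longleftrightarrow>
      (\<forall>x \<in> carrier M. \<forall>y \<in> carrier M. openin T {g \<in> carrier G. act g x = y})"
    if M: "group_ring_module G (padic_ints p) M act"
  proof
    assume cont: "continuous_map (prod_topology T ?X) ?X (\<lambda>(g, x). act g x)"
    show "\<forall>x \<in> carrier M. \<forall>y \<in> carrier M. openin T {g \<in> carrier G. act g x = y}"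
    proof (intro ballI)
      fix x y assume xy: "x \<in> carrier M" "y \<in> carrier M"
      have "continuous_map T (prod_topology T ?X) (\<lambda>g. (g, x))"
        using xy by (simp add: continuous_map_pairwise o_def)
      from continuous_map_compose[OF this cont]
      have "continuous_map T ?X (\<lambda>g. act g x)" by (simp add: o_def)
      then have "openin T {g \<in> topspace T. act g x \<in> {y}}"
        by (rule openin_continuous_map_preimage) (use xy in simp)
      then show "openin T {g \<in> carrier G. act g x = y}" using T by simp
    qed
  next
    assume op: "\<forall>x \<in> carrier M. \<forall>y \<in> carrier M. openin T {g \<in> carrier G. act g x = y}"
    show "continuous_map (prod_topology T ?X) ?X (\<lambda>(g, x). act g x)"
      unfolding continuous_map
    proof (intro conjI allI impI)
      show "(\<lambda>(g, x). act g x) ` topspace (prod_topology T ?X) \<subseteq> topspace ?X"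
        using T linear_mapD(1)[OF group_ring_moduleD(2)[OF M]] by auto
    next
      fix U assume U: "openin ?X U"
      have "{z \<in> topspace (prod_topology T ?X). (\<lambda>(g, x). act g x) z \<in> U}
          = (\<Union>(x, y) \<in> carrier M \<times> U. {g \<in> carrier G. act g x = y} \<times> {x})"
        using T by auto
      also have "openin (prod_topology T ?X) \<dots>"
        using op U by (intro openin_Union) (auto simp: openin_prod_Times_iff)
      finally show "openin (prod_topology T ?X)
        {z \<in> topspace (prod_topology T ?X). (\<lambda>(g, x). act g x) z \<in> U}" .
    qed
  qed
  then show ?thesis by (auto simp: finite_padic_reps_def finite_rep_def)
qed

text \<open>With a preimage \<open>a\<close> of \<open>x\<close> fixed, the transporter from
  \<open>x\<close> to \<open>y\<close> is the union of the transporters from \<open>a\<close> to the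
  preimages of \<open>y\<close>, hence open.\<close>

lemma finite_rep_image:
  assumes G: "monoid G" and M: "finite_rep p G T M act"
    and h: "rep_hom G (padic_ints p) M act N act' h"
    and surj: "h ` carrier M = carrier N" and zero: "h \<zero>\<^bsub>M\<^esub> = \<zero>\<^bsub>N\<^esub>"
  shows "finite_rep p G T N act'"
  unfolding finite_rep_def
proof (intro conjI ballI)
  have M': "group_ring_module G (padic_ints p) M act" "finite (carrier M)"
    and op: "\<And>x y. x \<in> carrier M \<Longrightarrow> y \<in> carrier M \<Longrightarrow> openin T {g \<in> carrier G. act g x = y}"
    using M by (auto simp: finite_rep_def)
  have ha: "\<And>g x. g \<in> carrier G \<Longrightarrow> x \<in> carrier M \<Longrightarrow> h (act g x) = act' g (h x)"
    using h by (auto simp: rep_hom_def)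
  show "group_ring_module G (padic_ints p) N act'"
    by (rule group_ring_module_image[OF G M'(1) h surj zero])
  show "finite (carrier N)" using M'(2) surj by (metis finite_imageI)
  fix x y assume "x \<in> carrier N" "y \<in> carrier N"
  then obtain a where a: "a \<in> carrier M" "x = h a" using surj by blast
  have "act g a \<in> carrier M" if "g \<in> carrier G" for g
    by (rule linear_mapD(1)[OF group_ring_moduleD(2)[OF M'(1) that] a(1)])
  then have "{g \<in> carrier G. act' g x = y} = (\<Union>b \<in> {b \<in> carrier M. h b = y}. {g \<in> carrier G. act g a = b})"
    using ha[OF _ a(1)] unfolding a(2) by auto
  also have "openin T \<dots>" using op[OF a(1)] by (intro openin_Union) auto
  finally show "openin T {g \<in> carrier G. act' g x = y}" .
qed

text \<open>Brings a finite representation with any carrier, such as a power or a quotient, into the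
  range of a stable condition, whose members are carried by \<open>nat\<close>.\<close>

lemma finite_rep_nat_copy:
  fixes M :: "(nat \<Rightarrow> int, 'm) module"
  assumes G: "monoid G" and M: "finite_rep p G T M act"
  obtains N :: "(nat \<Rightarrow> int, nat) module" and act' h where
    "finite_rep p G T N act'" "rep_hom G (padic_ints p) M act N act' h"
    "bij_betw h (carrier M) (carrier N)" "h \<zero>\<^bsub>M\<^esub> = \<zero>\<^bsub>N\<^esub>"
proof -
  have fin: "finite (carrier M)" and gm: "group_ring_module G (padic_ints p) M act"
    using M by (auto simp: finite_rep_def)
  interpret M: plain_module "padic_ints p" M by (rule group_ring_moduleD(1)[OF gm])
  obtain h :: "'m \<Rightarrow> nat" where inj: "inj_on h (carrier M)"
    using finite_imp_inj_to_nat_seg[OF fin] by blast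
  define k where "k = inv_into (carrier M) h"
  have kh: "k (h x) = x" if "x \<in> carrier M" for x
    unfolding k_def by (rule inv_into_f_f[OF inj that])
  define N :: "(nat \<Rightarrow> int, nat) module" where
    "N = \<lparr> carrier = h ` carrier M, monoid.mult = undefined, one = undefined,
      ring.zero = h \<zero>\<^bsub>M\<^esub>, add = (\<lambda>x y. h (k x \<oplus>\<^bsub>M\<^esub> k y)), smult = (\<lambda>r x. h (r \<odot>\<^bsub>M\<^esub> k x)) \<rparr>"
  define act' where "act' = (\<lambda>g x. h (act g (k x)))"
  have hom: "rep_hom G (padic_ints p) M act N act' h"
    by (simp add: rep_hom_def linear_map_def N_def act'_def kh)
  have bij: "bij_betw h (carrier M) (carrier N)"
    using inj by (simp add: bij_betw_def N_def)
  have zero: "h \<zero>\<^bsub>M\<^esub> = \<zero>\<^bsub>N\<^esub>" by (simp add: N_def)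
  have "finite_rep p G T N act'"
    by (rule finite_rep_image[OF G M hom _ zero]) (simp add: N_def)
  then show ?thesis using hom bij zero by (rule that)
qed

section \<open>Quotients and stable conditions\<close>

lemma (in plain_module) coset_mem_iff:
  assumes S: "submodule S R M" and x: "x \<in> carrier M" and y: "y \<in> carrier M"
  shows "y \<in> S +>\<^bsub>M\<^esub> x \<longleftrightarrow> y \<ominus>\<^bsub>M\<^esub> x \<in> S"
proof
  assume "y \<in> S +>\<^bsub>M\<^esub> x"
  then obtain s where s: "s \<in> S" "y = s \<oplus>\<^bsub>M\<^esub> x" by (auto simp: a_r_coset_def')
  then have "s \<in> carrier M" using submoduleE(1)[OF S] by blast
  then have "y \<ominus>\<^bsub>M\<^esub> x = s" using x unfolding s(2) by (simp add: a_minus_def M.a_assoc M.r_neg)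
  then show "y \<ominus>\<^bsub>M\<^esub> x \<in> S" using s(1) by simp
next
  assume s: "y \<ominus>\<^bsub>M\<^esub> x \<in> S"
  have "y = (y \<ominus>\<^bsub>M\<^esub> x) \<oplus>\<^bsub>M\<^esub> x" using x y by (simp add: a_minus_def M.a_assoc M.l_neg)
  then show "y \<in> S +>\<^bsub>M\<^esub> x" using s unfolding a_r_coset_def' by blast
qed

lemma (in plain_module) coset_eq_iff:
  assumes S: "submodule S R M" and x: "x \<in> carrier M" and y: "y \<in> carrier M"
  shows "S +>\<^bsub>M\<^esub> x = S +>\<^bsub>M\<^esub> y \<longleftrightarrow> x \<ominus>\<^bsub>M\<^esub> y \<in> S"
proof
  assume "S +>\<^bsub>M\<^esub> x = S +>\<^bsub>M\<^esub> y"
  moreover have "x \<in> S +>\<^bsub>M\<^esub> x"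
    using coset_mem_iff[OF S x x] submodule_zero[OF S] x by (simp add: a_minus_def M.r_neg)
  ultimately show "x \<ominus>\<^bsub>M\<^esub> y \<in> S" using coset_mem_iff[OF S y x] by simp
next
  assume "x \<ominus>\<^bsub>M\<^esub> y \<in> S"
  then have "x \<in> S +>\<^bsub>M\<^esub> y" using coset_mem_iff[OF S y x] by simp
  then show "S +>\<^bsub>M\<^esub> x = S +>\<^bsub>M\<^esub> y"
    using M.a_repr_independence[OF _ y submodule.axioms(1)[OF S]] by simp
qed

text \<open>Well-definedness of the induced map on a quotient: the unions in
  \<open>quotient_module\<close> and \<open>quotient_action\<close> run over all representatives of
  a coset, and stability of \<open>S\<close> under \<open>f\<close> makes all the terms
  equal.\<close>

lemma (in plain_module) Union_cosets_linear:
  assumes S: "submodule S R M" and x: "x \<in> carrier M" and f: "linear_map R M M f"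
    and fS: "f ` S \<subseteq> S"
  shows "(\<Union>y\<in>S +>\<^bsub>M\<^esub> x. S +>\<^bsub>M\<^esub> f y) = S +>\<^bsub>M\<^esub> f x"
proof -
  have eq: "S +>\<^bsub>M\<^esub> f y = S +>\<^bsub>M\<^esub> f x" if y: "y \<in> S +>\<^bsub>M\<^esub> x" for y
  proof -
    obtain s where s: "s \<in> S" "y = s \<oplus>\<^bsub>M\<^esub> x" using y by (auto simp: a_r_coset_def')
    have sc: "s \<in> carrier M" using s(1) submoduleE(1)[OF S] by blast
    have "f y = f s \<oplus>\<^bsub>M\<^esub> f x" unfolding s(2) by (rule linear_mapD(2)[OF f sc x])
    then have "f y \<in> S +>\<^bsub>M\<^esub> f x" using s(1) fS unfolding a_r_coset_def' by blast
    then show ?thesis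
      using M.a_repr_independence[OF _ linear_mapD(1)[OF f x] submodule.axioms(1)[OF S]] by simp
  qed
  have "x \<in> S +>\<^bsub>M\<^esub> x"
    using coset_mem_iff[OF S x x] submodule_zero[OF S] x by (simp add: a_minus_def M.r_neg)
  then show ?thesis by (rule UN_constant_eq) (use eq in blast)
qed

lemma quotient_rep_hom:
  assumes M: "group_ring_module G R M act" and S: "group_ring_submodule G R M act S"
  shows "rep_hom G R M act (quotient_module M S) (quotient_action M S act) (\<lambda>x. S +>\<^bsub>M\<^esub> x)"
    and "(\<lambda>x. S +>\<^bsub>M\<^esub> x) ` carrier M = carrier (quotient_module M S)"
proof -
  interpret M: plain_module R M by (rule group_ring_moduleD(1)[OF M])
  have S': "submodule S R M" and actS: "\<And>g. g \<in> carrier G \<Longrightarrow> act g ` S \<subseteq> S"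
    using S by (auto simp: group_ring_submodule_def)
  interpret S: abelian_subgroup S M
    by (rule abelian_subgroupI3[OF additive_subgroup.intro[OF submodule.axioms(1)[OF S']] M.M.abelian_group_axioms])
  show "rep_hom G R M act (quotient_module M S) (quotient_action M S act) (\<lambda>x. S +>\<^bsub>M\<^esub> x)"
    unfolding rep_hom_def linear_map_def
  proof (intro conjI ballI)
    show "(\<lambda>x. S +>\<^bsub>M\<^esub> x) \<in> carrier M \<rightarrow> carrier (quotient_module M S)"
      using M.M.a_rcosetsI[OF M.submoduleE(1)[OF S']] by (simp add: quotient_module_def)
  next
    fix x y assume xy: "x \<in> carrier M" "y \<in> carrier M"
    show "S +>\<^bsub>M\<^esub> (x \<oplus>\<^bsub>M\<^esub> y) = (S +>\<^bsub>M\<^esub> x) \<oplus>\<^bsub>quotient_module M S\<^esub> (S +>\<^bsub>M\<^esub> y)"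
      using S.a_rcos_sum[OF xy] by (simp add: quotient_module_def)
  next
    fix r x assume rx: "r \<in> carrier R" "x \<in> carrier M"
    have "(\<lambda>y. r \<odot>\<^bsub>M\<^esub> y) ` S \<subseteq> S" using M.submoduleE(4)[OF S' rx(1)] by blast
    from M.Union_cosets_linear[OF S' rx(2) M.linear_map_smult[OF rx(1)] this]
    show "S +>\<^bsub>M\<^esub> (r \<odot>\<^bsub>M\<^esub> x) = r \<odot>\<^bsub>quotient_module M S\<^esub> (S +>\<^bsub>M\<^esub> x)"
      by (simp add: quotient_module_def)
  next
    fix g x assume gx: "g \<in> carrier G" "x \<in> carrier M"
    from M.Union_cosets_linear[OF S' gx(2) group_ring_moduleD(2)[OF M gx(1)] actS[OF gx(1)]]
    show "S +>\<^bsub>M\<^esub> act g x = quotient_action M S act g (S +>\<^bsub>M\<^esub> x)"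
      by (simp add: quotient_action_def)
  qed
  show "(\<lambda>x. S +>\<^bsub>M\<^esub> x) ` carrier M = carrier (quotient_module M S)"
    by (auto simp: quotient_module_def A_RCOSETS_def')
qed

lemma rep_hom_compose:
  assumes "rep_hom G R M act N act' h" "rep_hom G R N act' N' act'' k"
  shows "rep_hom G R M act N' act'' (k \<circ> h)"
proof -
  have "h x \<in> carrier N" if "x \<in> carrier M" for x
    using assms(1) that unfolding rep_hom_def linear_map_def by blast
  then show ?thesis using assms by (simp add: rep_hom_def linear_map_def Pi_iff)
qed

section \<open>Kernels and the first isomorphism theorem\<close>

lemma rep_hom_kernel:
  assumes M: "group_ring_module G R M act" and N: "group_ring_module G R N act'"
    and h: "rep_hom G R M act N act' h"
  shows "group_ring_submodule G R M act {x \<in> carrier M. h x = \<zero>\<^bsub>N\<^esub>}"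
proof -
  interpret N: plain_module R N by (rule group_ring_moduleD(1)[OF N])
  have hl: "linear_map R M N h" and ha: "\<And>g x. g \<in> carrier G \<Longrightarrow> x \<in> carrier M \<Longrightarrow> h (act g x) = act' g (h x)"
    using h by (auto simp: rep_hom_def)
  have "submodule {\<zero>\<^bsub>N\<^esub>} R N" by (rule N.submoduleI_smult) auto
  from submodule_vimage[OF group_ring_moduleD(1)[OF M] group_ring_moduleD(1)[OF N] hl this]
  have "submodule {x \<in> carrier M. h x = \<zero>\<^bsub>N\<^esub>} R M" by simp
  moreover have "act g x \<in> carrier M \<and> h (act g x) = \<zero>\<^bsub>N\<^esub>"
    if "g \<in> carrier G" "x \<in> carrier M" "h x = \<zero>\<^bsub>N\<^esub>" for g x
    using that linear_mapD(1)[OF group_ring_moduleD(2)[OF M that(1)] that(2)] ha[OF that(1,2)]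
      linear_map_zero[OF group_ring_moduleD(1)[OF N] group_ring_moduleD(1)[OF N] group_ring_moduleD(2)[OF N that(1)]]
    by simp
  ultimately show ?thesis by (simp add: group_ring_submodule_def)
qed

lemma rep_hom_quotient_isomorphic:
  assumes M: "group_ring_module G R M act" and N: "group_ring_module G R N act'"
    and h: "rep_hom G R M act N act' h" and surj: "h ` carrier M = carrier N"
  defines "K \<equiv> {x \<in> carrier M. h x = \<zero>\<^bsub>N\<^esub>}"
  shows "group_ring_isomorphic G R (quotient_module M K) (quotient_action M K act) N act'"
proof -
  interpret M: plain_module R M by (rule group_ring_moduleD(1)[OF M])
  interpret N: plain_module R N by (rule group_ring_moduleD(1)[OF N])
  have hl: "linear_map R M N h" and ha: "\<And>g x. g \<in> carrier G \<Longrightarrow> x \<in> carrier M \<Longrightarrow> h (act g x) = act' g (h x)"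
    using h by (auto simp: rep_hom_def)
  note hD = linear_mapD[OF hl]
  have K: "group_ring_submodule G R M act K" unfolding K_def by (rule rep_hom_kernel[OF M N h])
  then have K': "submodule K R M" by (simp add: group_ring_submodule_def)
  note q = quotient_rep_hom[OF M K]
  let ?\<pi> = "\<lambda>x. K +>\<^bsub>M\<^esub> x" and ?Q = "quotient_module M K"
  \<comment> \<open>The induced map: \<open>h\<close> is constant on each coset of its kernel, and
    \<open>the_elem\<close> reads off that one value.\<close>
  define f where "f = (\<lambda>U. the_elem (h ` U))"
  have f: "f (?\<pi> x) = h x" if x: "x \<in> carrier M" for x
  proof -
    have "h ` ?\<pi> x = {h x}"
    proof -
      have "h (k \<oplus>\<^bsub>M\<^esub> x) = h x" if "k \<in> K" for k
        using that x hD(1,2) by (auto simp: K_def)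
      then have "h ` ?\<pi> x \<subseteq> {h x}" unfolding a_r_coset_def' by blast
      moreover have "\<zero>\<^bsub>M\<^esub> \<oplus>\<^bsub>M\<^esub> x \<in> ?\<pi> x"
        unfolding a_r_coset_def' using M.submodule_zero[OF K'] by blast
      then have "h ` ?\<pi> x \<noteq> {}" by (metis empty_iff image_is_empty)
      ultimately show ?thesis by (metis subset_singletonD)
    qed
    then show ?thesis by (simp add: f_def)
  qed
  have ex: "\<exists>x\<in>carrier M. U = ?\<pi> x" if "U \<in> carrier ?Q" for U
    using that q(2) by blast
  have "inj_on f (carrier ?Q)"
  proof (rule inj_onI)
    fix U V assume UV: "U \<in> carrier ?Q" "V \<in> carrier ?Q" "f U = f V"
    obtain x where x: "x \<in> carrier M" "U = ?\<pi> x" using ex UV by blast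
    obtain y where y: "y \<in> carrier M" "V = ?\<pi> y" using ex UV by blast
    have "h (x \<ominus>\<^bsub>M\<^esub> y) = \<zero>\<^bsub>N\<^esub>"
      using UV(3) x(1) y(1) hD(1)[OF y(1)] unfolding x(2) y(2)
      by (simp add: f a_minus_def hD(2) linear_map_minus[OF M.plain_module_axioms N.plain_module_axioms hl] N.M.r_neg)
    then show "U = V" unfolding x(2) y(2) using M.coset_eq_iff[OF K' x(1) y(1)] x(1) y(1)
      by (simp add: K_def)
  qed
  moreover have "f ` carrier ?Q = carrier N"
    unfolding q(2)[symmetric] surj[symmetric] image_image using f by (rule image_cong[OF refl])
  ultimately have bij: "bij_betw f (carrier ?Q) (carrier N)" by (simp add: bij_betw_def)
  have \<pi>D: "?\<pi> x \<oplus>\<^bsub>?Q\<^esub> ?\<pi> y = ?\<pi> (x \<oplus>\<^bsub>M\<^esub> y)" if "x \<in> carrier M" "y \<in> carrier M" for x y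
    using q(1) that by (simp add: rep_hom_def linear_map_def)
  have \<pi>s: "r \<odot>\<^bsub>?Q\<^esub> ?\<pi> x = ?\<pi> (r \<odot>\<^bsub>M\<^esub> x)" if "r \<in> carrier R" "x \<in> carrier M" for x r
    using q(1) that by (simp add: rep_hom_def linear_map_def)
  have \<pi>a: "quotient_action M K act g (?\<pi> x) = ?\<pi> (act g x)" if "g \<in> carrier G" "x \<in> carrier M" for x g
    using q(1) that by (simp add: rep_hom_def)
  show ?thesis
    unfolding group_ring_isomorphic_def
  proof (intro exI[of _ f] conjI ballI bij)
    fix U V assume UV: "U \<in> carrier ?Q" "V \<in> carrier ?Q"
    obtain x where x: "x \<in> carrier M" "U = ?\<pi> x" using ex UV by blast
    obtain y where y: "y \<in> carrier M" "V = ?\<pi> y" using ex UV by blast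
    show "f (U \<oplus>\<^bsub>?Q\<^esub> V) = f U \<oplus>\<^bsub>N\<^esub> f V"
      unfolding x(2) y(2) using x(1) y(1) by (simp add: \<pi>D f hD(2))
  next
    fix r U assume r: "r \<in> carrier R" and U: "U \<in> carrier ?Q"
    obtain x where x: "x \<in> carrier M" "U = ?\<pi> x" using ex U by blast
    show "f (r \<odot>\<^bsub>?Q\<^esub> U) = r \<odot>\<^bsub>N\<^esub> f U"
      unfolding x(2) using x(1) r by (simp add: \<pi>s f hD(3))
  next
    fix g U assume g: "g \<in> carrier G" and U: "U \<in> carrier ?Q"
    obtain x where x: "x \<in> carrier M" "U = ?\<pi> x" using ex U by blast
    have "act g x \<in> carrier M" by (rule linear_mapD(1)[OF group_ring_moduleD(2)[OF M g] x(1)])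
    then show "f (quotient_action M K act g U) = act' g (f U)"
      unfolding x(2) using x(1) g by (simp add: \<pi>a f ha)
  qed
qed

text \<open>The relation \<open>P\<close> stands for a subrepresentation of \<open>Q\<close> with a
  surjection onto \<open>Y\<close>: its domain \<open>S\<close> is the subrepresentation, and
  single-valuedness makes it the graph of a homomorphism \<open>h\<close>. The axioms for
  \<open>Y\<close>, a bare record, come through \<open>h\<close>. Closure under submodules gives
  \<open>S\<close>; closure under quotients is then applied to the copy \<open>N\<close> of
  \<open>Y\<close> on natural numbers.\<close>

lemma stable_subquotient:
  fixes Y :: "(nat \<Rightarrow> int, 'm) module"
  assumes G: "monoid G" and T: "topspace T = carrier G"
    and stable: "stable_condition p G T \<C>" and Q: "(Q, act) \<in> \<C>"
    and P: "\<And>q y. P q y \<Longrightarrow> q \<in> carrier Q \<and> y \<in> carrier Y"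
    and zero: "P \<zero>\<^bsub>Q\<^esub> \<zero>\<^bsub>Y\<^esub>"
    and add: "\<And>q y q' y'. P q y \<Longrightarrow> P q' y' \<Longrightarrow> P (q \<oplus>\<^bsub>Q\<^esub> q') (y \<oplus>\<^bsub>Y\<^esub> y')"
    and smult: "\<And>r q y. r \<in> carrier (padic_ints p) \<Longrightarrow> P q y \<Longrightarrow> P (r \<odot>\<^bsub>Q\<^esub> q) (r \<odot>\<^bsub>Y\<^esub> y)"
    and action: "\<And>g q y. g \<in> carrier G \<Longrightarrow> P q y \<Longrightarrow> P (act g q) (actY g y)"
    and single: "\<And>q y y'. P q y \<Longrightarrow> P q y' \<Longrightarrow> y = y'"
    and total: "\<And>y. y \<in> carrier Y \<Longrightarrow> \<exists>q. P q y"
  shows "\<exists>(Q', act') \<in> \<C>. group_ring_isomorphic G (padic_ints p) Y actY Q' act'"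
proof -
  let ?Z = "padic_ints p"
  have sub\<C>: "\<C> \<subseteq> finite_padic_reps p G T" using stable by (simp add: stable_condition_def)
  have Qr: "finite_rep p G T Q act" using sub\<C> Q finite_padic_reps_iff[OF T] by blast
  then have Qm: "group_ring_module G ?Z Q act" by (simp add: finite_rep_def)
  interpret Q: plain_module ?Z Q by (rule group_ring_moduleD(1)[OF Qm])
  define S where "S = {q. \<exists>y. P q y}"
  have "submodule S ?Z Q"
    by (rule Q.submoduleI_smult) (use P zero add smult in \<open>auto simp: S_def, blast+\<close>)
  then have S: "group_ring_submodule G ?Z Q act S"
    using action unfolding group_ring_submodule_def S_def by blast
  define QS where "QS = Q\<lparr>carrier := S\<rparr>"
  have QS: "(QS, act) \<in> \<C>" using stable Q S unfolding stable_condition_def QS_def by blast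
  have QSr: "finite_rep p G T QS act" using sub\<C> QS finite_padic_reps_iff[OF T] by blast
  then have QSm: "group_ring_module G ?Z QS act" by (simp add: finite_rep_def)
  define h where "h q = (THE y. P q y)" for q
  have h: "h q = y" if "P q y" for q y
    unfolding h_def using that single[OF _ that] by (rule the_equality)
  have Ph: "P q (h q)" if "q \<in> S" for q using that h unfolding S_def by auto
  have hom: "rep_hom G ?Z QS act Y actY h"
    unfolding rep_hom_def linear_map_def
    using Ph P by (auto simp: QS_def intro!: h add smult action)
  have surj: "h ` carrier QS = carrier Y"
  proof
    show "h ` carrier QS \<subseteq> carrier Y" using Ph P by (auto simp: QS_def)
    show "carrier Y \<subseteq> h ` carrier QS"
    proof
      fix y assume "y \<in> carrier Y"
      then obtain q where "P q y" using total by blast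
      then show "y \<in> h ` carrier QS" using h[of q y] by (auto simp: QS_def S_def intro!: image_eqI[of _ _ q])
    qed
  qed
  have hz: "h \<zero>\<^bsub>QS\<^esub> = \<zero>\<^bsub>Y\<^esub>" using h[OF zero] by (simp add: QS_def)
  have Yr: "finite_rep p G T Y actY" by (rule finite_rep_image[OF G QSr hom surj hz])
  obtain N :: "(nat \<Rightarrow> int, nat) module" and act' n where N: "finite_rep p G T N act'"
    and n: "rep_hom G ?Z Y actY N act' n" "bij_betw n (carrier Y) (carrier N)" "n \<zero>\<^bsub>Y\<^esub> = \<zero>\<^bsub>N\<^esub>"
    by (rule finite_rep_nat_copy[OF G Yr])
  have Nm: "group_ring_module G ?Z N act'" using N by (simp add: finite_rep_def)
  have N': "(N, act') \<in> finite_padic_reps p G T" using N finite_padic_reps_iff[OF T] by blast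
  have hn: "rep_hom G ?Z QS act N act' (n \<circ> h)"
    by (rule rep_hom_compose[OF hom n(1)])
  have sn: "(n \<circ> h) ` carrier QS = carrier N"
    unfolding image_comp[symmetric] surj using n(2) by (simp add: bij_betw_def)
  let ?K = "{x \<in> carrier QS. (n \<circ> h) x = \<zero>\<^bsub>N\<^esub>}"
  have K: "group_ring_submodule G ?Z QS act ?K" by (rule rep_hom_kernel[OF QSm Nm hn])
  have "group_ring_isomorphic G ?Z (quotient_module QS ?K) (quotient_action QS ?K act) N act'"
    by (rule rep_hom_quotient_isomorphic[OF QSm Nm hn sn])
  moreover have "\<forall>(M, act) \<in> \<C>. \<forall>S. group_ring_submodule G (padic_ints p) M act S \<longrightarrow>
          (\<forall>(N, act') \<in> finite_padic_reps p G T.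
             group_ring_isomorphic G (padic_ints p)
               (quotient_module M S) (quotient_action M S act) N act' \<longrightarrow> (N, act') \<in> \<C>)"
    using stable unfolding stable_condition_def by (elim conjE)
  ultimately have "(N, act') \<in> \<C>" using QS K N' by blast
  then show ?thesis using rep_hom_isomorphic[OF n(1,2)] by blast
qed

section \<open>Direct powers of a finite representation\<close>

lemma plain_module_direct_power:
  assumes "plain_module R M"
  shows "plain_module R (direct_sum_module k (\<lambda>_. M))"
proof -
  interpret M: plain_module R M by fact
  let ?D = "direct_sum_module k (\<lambda>_. M)"
  have D: "x \<in> carrier ?D \<Longrightarrow> i < k \<Longrightarrow> x i \<in> carrier M" for x i
    by (auto simp: direct_sum_module_def)
  have eqI: "x = y" if "x \<in> carrier ?D" "y \<in> carrier ?D" "\<And>i. i < k \<Longrightarrow> x i = y i" for x y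
    using that by (auto simp: direct_sum_module_def intro: PiE_ext)
  have add: "x \<oplus>\<^bsub>?D\<^esub> y \<in> carrier ?D" if "x \<in> carrier ?D" "y \<in> carrier ?D" for x y
    using that by (auto simp: direct_sum_module_def)
  have smult: "r \<odot>\<^bsub>?D\<^esub> x \<in> carrier ?D" if "r \<in> carrier R" "x \<in> carrier ?D" for r x
    using that by (auto simp: direct_sum_module_def)
  have zero: "\<zero>\<^bsub>?D\<^esub> \<in> carrier ?D" by (simp add: direct_sum_module_def)
  have app: "(x \<oplus>\<^bsub>?D\<^esub> y) i = x i \<oplus>\<^bsub>M\<^esub> y i" "(r \<odot>\<^bsub>?D\<^esub> x) i = r \<odot>\<^bsub>M\<^esub> x i"
    "\<zero>\<^bsub>?D\<^esub> i = \<zero>\<^bsub>M\<^esub>" if "i < k" for x y r i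
    using that by (simp_all add: direct_sum_module_def)
  have ab: "abelian_group ?D"
  proof (rule abelian_groupI)
    fix x assume x: "x \<in> carrier ?D"
    show "\<zero>\<^bsub>?D\<^esub> \<oplus>\<^bsub>?D\<^esub> x = x"
      by (rule eqI) (simp_all add: add zero x app D)
    have n: "(\<lambda>i\<in>{..<k}. \<ominus>\<^bsub>M\<^esub> x i) \<in> carrier ?D"
      using D[OF x] by (simp add: direct_sum_module_def)
    have "(\<lambda>i\<in>{..<k}. \<ominus>\<^bsub>M\<^esub> x i) \<oplus>\<^bsub>?D\<^esub> x = \<zero>\<^bsub>?D\<^esub>"
      by (rule eqI) (simp_all add: add n zero x app D M.M.l_neg)
    then show "\<exists>y\<in>carrier ?D. y \<oplus>\<^bsub>?D\<^esub> x = \<zero>\<^bsub>?D\<^esub>" using n by blast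
    fix y assume y: "y \<in> carrier ?D"
    show "x \<oplus>\<^bsub>?D\<^esub> y \<in> carrier ?D" by (rule add[OF x y])
    show "x \<oplus>\<^bsub>?D\<^esub> y = y \<oplus>\<^bsub>?D\<^esub> x"
      by (rule eqI) (simp_all add: add x y app D M.M.a_comm)
    fix z assume z: "z \<in> carrier ?D"
    show "x \<oplus>\<^bsub>?D\<^esub> y \<oplus>\<^bsub>?D\<^esub> z = x \<oplus>\<^bsub>?D\<^esub> (y \<oplus>\<^bsub>?D\<^esub> z)"
      by (rule eqI) (simp_all add: add x y z app D M.M.a_assoc)
  qed (rule zero)
  show ?thesis
    unfolding plain_module_def
  proof (rule moduleI[OF M.is_cring ab])
    fix a x assume a: "a \<in> carrier R" and x: "x \<in> carrier ?D"
    show "a \<odot>\<^bsub>?D\<^esub> x \<in> carrier ?D" by (rule smult[OF a x])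
    show "(a \<oplus>\<^bsub>R\<^esub> b) \<odot>\<^bsub>?D\<^esub> x = a \<odot>\<^bsub>?D\<^esub> x \<oplus>\<^bsub>?D\<^esub> b \<odot>\<^bsub>?D\<^esub> x" if "b \<in> carrier R" for b
      by (rule eqI) (simp_all add: add smult a that x app D M.smult_l_distr)
    show "(a \<otimes>\<^bsub>R\<^esub> b) \<odot>\<^bsub>?D\<^esub> x = a \<odot>\<^bsub>?D\<^esub> (b \<odot>\<^bsub>?D\<^esub> x)" if "b \<in> carrier R" for b
      by (rule eqI) (simp_all add: smult a that x app D M.smult_assoc1)
    show "a \<odot>\<^bsub>?D\<^esub> (x \<oplus>\<^bsub>?D\<^esub> y) = a \<odot>\<^bsub>?D\<^esub> x \<oplus>\<^bsub>?D\<^esub> a \<odot>\<^bsub>?D\<^esub> y" if "y \<in> carrier ?D" for y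
      by (rule eqI) (simp_all add: add smult a that x app D M.smult_r_distr)
  next
    fix x assume x: "x \<in> carrier ?D"
    show "\<one>\<^bsub>R\<^esub> \<odot>\<^bsub>?D\<^esub> x = x"
      by (rule eqI) (simp_all add: smult x app D)
  qed
qed

lemma group_ring_module_direct_power:
  assumes G: "monoid G" and M: "group_ring_module G R M act"
  shows "group_ring_module G R (direct_sum_module k (\<lambda>_. M)) (direct_sum_action k (\<lambda>_. act))"
proof -
  interpret G: monoid G by fact
  let ?D = "direct_sum_module k (\<lambda>_. M)" and ?a = "direct_sum_action k (\<lambda>_. act)"
  note MD = group_ring_moduleD[OF M]
  interpret M: plain_module R M by (rule MD(1))
  have D: "x \<in> carrier ?D \<Longrightarrow> i < k \<Longrightarrow> x i \<in> carrier M" for x i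
    by (auto simp: direct_sum_module_def)
  show ?thesis
  proof (rule group_ring_moduleI)
    show "plain_module R ?D" by (rule plain_module_direct_power[OF MD(1)])
  next
    fix g assume g: "g \<in> carrier G"
    note aD = linear_mapD[OF MD(2)[OF g]]
    show "linear_map R ?D ?D (?a g)"
      unfolding linear_map_def
    proof (intro conjI ballI)
      show "?a g \<in> carrier ?D \<rightarrow> carrier ?D"
      proof
        fix x assume x: "x \<in> carrier ?D"
        show "?a g x \<in> carrier ?D"
          using aD(1)[OF D[OF x]] by (simp add: direct_sum_module_def direct_sum_action_def)
      qed
    next
      fix x y assume x: "x \<in> carrier ?D" and y: "y \<in> carrier ?D"
      show "?a g (x \<oplus>\<^bsub>?D\<^esub> y) = ?a g x \<oplus>\<^bsub>?D\<^esub> ?a g y"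
        using D[OF x] D[OF y]
        by (simp add: direct_sum_module_def direct_sum_action_def aD(2) cong: restrict_cong)
    next
      fix r x assume r: "r \<in> carrier R" and x: "x \<in> carrier ?D"
      show "?a g (r \<odot>\<^bsub>?D\<^esub> x) = r \<odot>\<^bsub>?D\<^esub> ?a g x"
        using r D[OF x]
        by (simp add: direct_sum_module_def direct_sum_action_def aD(3) cong: restrict_cong)
    qed
  next
    fix g g' x assume g: "g \<in> carrier G" "g' \<in> carrier G" and x: "x \<in> carrier ?D"
    show "?a (g \<otimes>\<^bsub>G\<^esub> g') x = ?a g (?a g' x)"
      using g D[OF x] by (simp add: direct_sum_action_def MD(3) cong: restrict_cong)
  next
    fix x assume "x \<in> carrier ?D"
    then show "?a \<one>\<^bsub>G\<^esub> x = x"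
      by (auto simp: direct_sum_module_def direct_sum_action_def fun_eq_iff PiE_def extensional_def Pi_iff MD(4))
  qed
qed

lemma finite_rep_direct_power:
  assumes G: "monoid G" and T: "topspace T = carrier G" and M: "finite_rep p G T M act"
  shows "finite_rep p G T (direct_sum_module k (\<lambda>_. M)) (direct_sum_action k (\<lambda>_. act))"
  unfolding finite_rep_def
proof (intro conjI ballI)
  let ?D = "direct_sum_module k (\<lambda>_. M)" and ?a = "direct_sum_action k (\<lambda>_. act)"
  have gm: "group_ring_module G (padic_ints p) M act" and fin: "finite (carrier M)"
    and op: "\<And>x y. x \<in> carrier M \<Longrightarrow> y \<in> carrier M \<Longrightarrow> openin T {g \<in> carrier G. act g x = y}"
    using M by (auto simp: finite_rep_def)
  show "group_ring_module G (padic_ints p) ?D ?a"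
    by (rule group_ring_module_direct_power[OF G gm])
  show "finite (carrier ?D)" using fin by (simp add: direct_sum_module_def finite_PiE)
  fix x y assume xy: "x \<in> carrier ?D" "y \<in> carrier ?D"
  have "?a g x = y \<longleftrightarrow> (\<forall>i<k. act g (x i) = y i)" for g
  proof
    assume "?a g x = y"
    then show "\<forall>i<k. act g (x i) = y i" by (auto simp: direct_sum_action_def)
  next
    assume "\<forall>i<k. act g (x i) = y i"
    then show "?a g x = y"
      using xy(2) by (auto simp: direct_sum_action_def direct_sum_module_def fun_eq_iff PiE_def extensional_def)
  qed
  then have "{g \<in> carrier G. ?a g x = y} = (\<Inter>i\<in>{..<k}. {g \<in> carrier G. act g (x i) = y i}) \<inter> topspace T"
    using T by auto
  also have "openin T \<dots>"
    using xy by (intro openin_INT) (auto simp: direct_sum_module_def intro!: op)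
  finally show "openin T {g \<in> carrier G. ?a g x = y}" .
qed

text \<open>\<open>\<delta>\<close> is the isomorphism of the power with its copy on natural
  numbers. Its injectivity is what later allows components to be compared after passing to
  \<open>Q'\<close>.\<close>

lemma stable_direct_power:
  assumes G: "monoid G" and T: "topspace T = carrier G"
    and stable: "stable_condition p G T \<C>" and Q: "(Q, act) \<in> \<C>"
  obtains Q' act' \<delta> where "(Q', act') \<in> \<C>"
    "rep_hom G (padic_ints p) (direct_sum_module k (\<lambda>_. Q)) (direct_sum_action k (\<lambda>_. act)) Q' act' \<delta>"
    "inj_on \<delta> (carrier (direct_sum_module k (\<lambda>_. Q)))"
    "\<delta> \<zero>\<^bsub>direct_sum_module k (\<lambda>_. Q)\<^esub> = \<zero>\<^bsub>Q'\<^esub>"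
proof -
  let ?D = "direct_sum_module k (\<lambda>_. Q)" and ?a = "direct_sum_action k (\<lambda>_. act)"
  have "\<C> \<subseteq> finite_padic_reps p G T" using stable by (simp add: stable_condition_def)
  then have Qr: "finite_rep p G T Q act" using Q finite_padic_reps_iff[OF T] by blast
  obtain N :: "(nat \<Rightarrow> int, nat) module" and act' n where N: "finite_rep p G T N act'"
    and n: "rep_hom G (padic_ints p) ?D ?a N act' n" "bij_betw n (carrier ?D) (carrier N)"
      "n \<zero>\<^bsub>?D\<^esub> = \<zero>\<^bsub>N\<^esub>"
    by (rule finite_rep_nat_copy[OF G finite_rep_direct_power[OF G T Qr, of k]])
  have "(N, act') \<in> finite_padic_reps p G T" using N finite_padic_reps_iff[OF T] by blast
  moreover have "group_ring_isomorphic G (padic_ints p) ?D ?a N act'"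
    by (rule rep_hom_isomorphic[OF n(1,2)])
  moreover have "\<forall>k M act. (\<forall>i<k. (M i, act i) \<in> \<C>) \<longrightarrow>
          (\<forall>(N, act') \<in> finite_padic_reps p G T.
             group_ring_isomorphic G (padic_ints p)
               (direct_sum_module k M) (direct_sum_action k act) N act' \<longrightarrow> (N, act') \<in> \<C>)"
    using stable unfolding stable_condition_def by (elim conjE)
  from this[THEN spec[of _ k], THEN spec[of _ "\<lambda>_. Q"], THEN spec[of _ "\<lambda>_. act"]]
  have "\<forall>(N, act') \<in> finite_padic_reps p G T.
      group_ring_isomorphic G (padic_ints p) ?D ?a N act' \<longrightarrow> (N, act') \<in> \<C>"
    using Q by simp
  ultimately have "(N, act') \<in> \<C>" by blast
  then show ?thesis by (rule that[OF _ n(1) bij_betw_imp_inj_on[OF n(2)] n(3)])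
qed

section \<open>Modules over an algebra with a group action\<close>

lemma restrict_scalars_simps [simp]:
  "carrier (restrict_scalars \<phi> M) = carrier M"
  "\<zero>\<^bsub>restrict_scalars \<phi> M\<^esub> = \<zero>\<^bsub>M\<^esub>"
  "x \<oplus>\<^bsub>restrict_scalars \<phi> M\<^esub> y = x \<oplus>\<^bsub>M\<^esub> y"
  "r \<odot>\<^bsub>restrict_scalars \<phi> M\<^esub> x = \<phi> r \<odot>\<^bsub>M\<^esub> x"
  by (simp_all add: restrict_scalars_def)

lemma regular_module_simps [simp]:
  "carrier (regular_module R) = carrier R"
  "\<zero>\<^bsub>regular_module R\<^esub> = \<zero>\<^bsub>R\<^esub>"
  "x \<oplus>\<^bsub>regular_module R\<^esub> y = x \<oplus>\<^bsub>R\<^esub> y"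
  "r \<odot>\<^bsub>regular_module R\<^esub> x = r \<otimes>\<^bsub>R\<^esub> x"
  by (simp_all add: regular_module_def)

lemma left_module_regular:
  assumes "ring R" shows "left_module R (regular_module R)"
proof -
  interpret R: ring R by fact
  have "abelian_group (regular_module R)"
    by (rule abelian_groupI) (auto simp: R.a_ac intro!: bexI[of _ "\<ominus>\<^bsub>R\<^esub> _"] R.l_neg)
  then show ?thesis
    by (intro left_module.intro left_module_axioms.intro)
       (auto simp: R.l_distr R.r_distr R.m_assoc R.ring_axioms)
qed

lemma plain_module_restrict_scalars:
  assumes "is_algebra A E \<eta>" "left_module E N"
  shows "plain_module A (restrict_scalars \<eta> N)"
proof -
  interpret N: left_module E N by fact
  have A: "cring A" and \<eta>: "\<eta> \<in> ring_hom A E" using assms(1) by (auto simp: is_algebra_def)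
  note h = ring_hom_closed[OF \<eta>] ring_hom_mult[OF \<eta>] ring_hom_add[OF \<eta>] ring_hom_one[OF \<eta>]
  have "abelian_group (restrict_scalars \<eta> N)"
  proof (rule abelian_groupI)
    fix x assume "x \<in> carrier (restrict_scalars \<eta> N)"
    then show "\<exists>y\<in>carrier (restrict_scalars \<eta> N). y \<oplus>\<^bsub>restrict_scalars \<eta> N\<^esub> x = \<zero>\<^bsub>restrict_scalars \<eta> N\<^esub>"
      using N.M.l_neg by (auto intro!: bexI[of _ "\<ominus>\<^bsub>N\<^esub> x"])
  qed (simp_all add: N.M.a_ac)
  then show ?thesis
    unfolding plain_module_def
    by (intro moduleI A)
       (simp_all add: h N.smult_closed N.smult_l_distr N.smult_r_distr N.smult_assoc N.smult_one)
qed

text \<open>The action of \<open>G\<close> is \<open>A\<close>-linear because the image of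
  \<open>\<eta>\<close> is central in \<open>E\<close>; its multiplicativity is that of
  \<open>\<rho>\<close> together with associativity of the \<open>E\<close>-action.\<close>

lemma algebra_group_ring_module:
  assumes alg: "is_algebra A E \<eta>" and N: "left_module E N" and G: "group G"
    and \<rho>: "\<rho> \<in> hom G (units_of E)"
  shows "group_ring_module G A (restrict_scalars \<eta> N) (\<lambda>g x. \<rho> g \<odot>\<^bsub>N\<^esub> x)"
proof -
  interpret N: left_module E N by fact
  interpret G: group G by fact
  have \<eta>: "\<eta> \<in> ring_hom A E"
    and central: "\<And>r x. r \<in> carrier A \<Longrightarrow> x \<in> carrier E \<Longrightarrow> \<eta> r \<otimes>\<^bsub>E\<^esub> x = x \<otimes>\<^bsub>E\<^esub> \<eta> r"
    using alg by (auto simp: is_algebra_def)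
  interpret \<rho>: group_hom G "units_of E" \<rho>
    by (intro group_hom.intro group_hom_axioms.intro G N.R.units_group \<rho>)
  have \<rho>c: "\<rho> g \<in> carrier E" if "g \<in> carrier G" for g
    using \<rho>.hom_closed[OF that] by (simp add: units_of_carrier N.R.Units_closed)
  have \<rho>m: "\<rho> (g \<otimes>\<^bsub>G\<^esub> h) = \<rho> g \<otimes>\<^bsub>E\<^esub> \<rho> h" if "g \<in> carrier G" "h \<in> carrier G" for g h
    using \<rho>.hom_mult[OF that] by (simp add: units_of_mult)
  have \<rho>1: "\<rho> \<one>\<^bsub>G\<^esub> = \<one>\<^bsub>E\<^esub>" using \<rho>.hom_one by (simp add: units_of_one)
  show ?thesis
  proof (rule group_ring_moduleI[OF plain_module_restrict_scalars[OF alg N]])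
    fix g assume g: "g \<in> carrier G"
    have "\<rho> g \<odot>\<^bsub>N\<^esub> (\<eta> r \<odot>\<^bsub>N\<^esub> x) = \<eta> r \<odot>\<^bsub>N\<^esub> (\<rho> g \<odot>\<^bsub>N\<^esub> x)"
      if "r \<in> carrier A" "x \<in> carrier N" for r x
      using that \<rho>c[OF g] central[OF that(1) \<rho>c[OF g]] ring_hom_closed[OF \<eta> that(1)]
      by (simp add: N.smult_assoc[symmetric])
    then show "linear_map A (restrict_scalars \<eta> N) (restrict_scalars \<eta> N) (\<lambda>x. \<rho> g \<odot>\<^bsub>N\<^esub> x)"
      using \<rho>c[OF g] by (simp add: linear_map_def N.smult_closed N.smult_r_distr)
  next
    fix g h x assume "g \<in> carrier G" "h \<in> carrier G" "x \<in> carrier (restrict_scalars \<eta> N)"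
    then show "\<rho> (g \<otimes>\<^bsub>G\<^esub> h) \<odot>\<^bsub>N\<^esub> x = \<rho> g \<odot>\<^bsub>N\<^esub> (\<rho> h \<odot>\<^bsub>N\<^esub> x)"
      by (simp add: \<rho>m \<rho>c N.smult_assoc del: \<rho>.hom_mult)
  next
    fix x assume "x \<in> carrier (restrict_scalars \<eta> N)"
    then show "\<rho> \<one>\<^bsub>G\<^esub> \<odot>\<^bsub>N\<^esub> x = x" by (simp add: \<rho>1 N.smult_one del: \<rho>.hom_one)
  qed
qed

lemma smult_span_group_ring_submodule:
  assumes M: "group_ring_module G R M act" and I: "ideal I R"
  shows "group_ring_submodule G R M act (smult_span I M (carrier M))"
proof -
  note MD = group_ring_moduleD[OF M]
  have "act g x \<in> smult_span I M (carrier M)" if "g \<in> carrier G" "x \<in> smult_span I M (carrier M)" for g x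
    by (rule linear_map_smult_span[OF MD(1,1) MD(2)[OF that(1)] I _ subset_refl subset_refl that(2)])
       (use linear_mapD(1)[OF MD(2)[OF that(1)]] in blast)
  then show ?thesis
    using plain_module.smult_span_submodule[OF MD(1) I subset_refl] by (simp add: group_ring_submodule_def)
qed

section \<open>Passing to subquotients\<close>

text \<open>A \<open>\<int>\<^sub>p[G]\<close>-linear correspondence from \<open>Q\<close> to \<open>M\<close> that is total on \<open>M\<close> and single-valued modulo \<open>S\<close>
  exhibits \<open>M / S\<close> as a subquotient of \<open>Q\<close>.\<close>

definition subquotient_relation ::
    "nat \<Rightarrow> 'g monoid \<Rightarrow> ((nat \<Rightarrow> int) \<Rightarrow> 'a) \<Rightarrow> (nat \<Rightarrow> int, 'q) module \<Rightarrow> ('g \<Rightarrow> 'q \<Rightarrow> 'q)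
       \<Rightarrow> ('a, 'm) module \<Rightarrow> ('g \<Rightarrow> 'm \<Rightarrow> 'm) \<Rightarrow> 'm set \<Rightarrow> ('q \<Rightarrow> 'm \<Rightarrow> bool) \<Rightarrow> bool" where
  "subquotient_relation p G \<zeta> Q actQ M act S P \<longleftrightarrow>
     (\<forall>q x. P q x \<longrightarrow> q \<in> carrier Q \<and> x \<in> carrier M)
     \<and> P \<zero>\<^bsub>Q\<^esub> \<zero>\<^bsub>M\<^esub>
     \<and> (\<forall>q x q' x'. P q x \<and> P q' x' \<longrightarrow> P (q \<oplus>\<^bsub>Q\<^esub> q') (x \<oplus>\<^bsub>M\<^esub> x'))
     \<and> (\<forall>r \<in> carrier (padic_ints p). \<forall>q x. P q x \<longrightarrow> P (r \<odot>\<^bsub>Q\<^esub> q) (\<zeta> r \<odot>\<^bsub>M\<^esub> x))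
     \<and> (\<forall>g \<in> carrier G. \<forall>q x. P q x \<longrightarrow> P (actQ g q) (act g x))
     \<and> (\<forall>q x x'. P q x \<and> P q x' \<longrightarrow> x \<ominus>\<^bsub>M\<^esub> x' \<in> S)
     \<and> (\<forall>x \<in> carrier M. \<exists>q. P q x)"

text \<open>Composing \<open>P\<close> with the projection of \<open>M\<close> onto
  \<open>M / S\<close> turns single-valuedness modulo \<open>S\<close> into genuine
  single-valuedness, so that \<open>stable_subquotient\<close> applies with
  \<open>Y = M / S\<close>.\<close>

lemma stable_subquotient_relation:
  fixes M :: "('a, 'm) module"
  assumes G: "monoid G" and T: "topspace T = carrier G"
    and stable: "stable_condition p G T \<C>" and Q: "(Q, actQ) \<in> \<C>"
    and M: "group_ring_module G A M act" and S: "group_ring_submodule G A M act S"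
    and \<zeta>: "\<zeta> \<in> carrier (padic_ints p) \<rightarrow> carrier A"
    and P: "subquotient_relation p G \<zeta> Q actQ M act S P"
  shows "\<exists>(Q', act') \<in> \<C>. group_ring_isomorphic G (padic_ints p)
           (restrict_scalars \<zeta> (quotient_module M S)) (quotient_action M S act) Q' act'"
proof -
  interpret M: plain_module A M by (rule group_ring_moduleD(1)[OF M])
  have S': "submodule S A M" using S by (simp add: group_ring_submodule_def)
  let ?\<pi> = "\<lambda>x. S +>\<^bsub>M\<^esub> x" and ?Y = "quotient_module M S"
  note q = quotient_rep_hom[OF M S]
  have \<pi>: "x \<in> carrier M \<Longrightarrow> ?\<pi> x \<in> carrier ?Y"
    and \<pi>add: "x \<in> carrier M \<Longrightarrow> y \<in> carrier M \<Longrightarrow> ?\<pi> x \<oplus>\<^bsub>?Y\<^esub> ?\<pi> y = ?\<pi> (x \<oplus>\<^bsub>M\<^esub> y)"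
    and \<pi>smult: "r \<in> carrier A \<Longrightarrow> x \<in> carrier M \<Longrightarrow> r \<odot>\<^bsub>?Y\<^esub> ?\<pi> x = ?\<pi> (r \<odot>\<^bsub>M\<^esub> x)"
    and \<pi>act: "g \<in> carrier G \<Longrightarrow> x \<in> carrier M \<Longrightarrow> quotient_action M S act g (?\<pi> x) = ?\<pi> (act g x)"
    for x y r g
    using q(1) by (auto simp: rep_hom_def linear_map_def)
  have zero: "?\<pi> \<zero>\<^bsub>M\<^esub> = \<zero>\<^bsub>?Y\<^esub>"
    using M.M.a_coset_add_zero[OF M.submoduleE(1)[OF S']] by (simp add: quotient_module_def)
  note p1 = P[unfolded subquotient_relation_def]
  note p2 = conjunct2[OF p1]
  note p3 = conjunct2[OF p2]
  note p4 = conjunct2[OF p3]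
  note p5 = conjunct2[OF p4]
  note p6 = conjunct2[OF p5]
  have Pc: "P q x \<Longrightarrow> q \<in> carrier Q" "P q x \<Longrightarrow> x \<in> carrier M" for q x
    using conjunct1[OF p1] by blast+
  have P0: "P \<zero>\<^bsub>Q\<^esub> \<zero>\<^bsub>M\<^esub>" by (rule conjunct1[OF p2])
  have Padd: "P q x \<Longrightarrow> P q' x' \<Longrightarrow> P (q \<oplus>\<^bsub>Q\<^esub> q') (x \<oplus>\<^bsub>M\<^esub> x')" for q x q' x'
    using conjunct1[OF p3] by blast
  have Psmult: "r \<in> carrier (padic_ints p) \<Longrightarrow> P q x \<Longrightarrow> P (r \<odot>\<^bsub>Q\<^esub> q) (\<zeta> r \<odot>\<^bsub>M\<^esub> x)" for r q x
    using conjunct1[OF p4] by blast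
  have Pact: "g \<in> carrier G \<Longrightarrow> P q x \<Longrightarrow> P (actQ g q) (act g x)" for g q x
    using conjunct1[OF p5] by blast
  have Psingle: "P q x \<Longrightarrow> P q x' \<Longrightarrow> x \<ominus>\<^bsub>M\<^esub> x' \<in> S" for q x x'
    using conjunct1[OF p6] by blast
  have Ptotal: "x \<in> carrier M \<Longrightarrow> \<exists>q. P q x" for x
    using conjunct2[OF p6] by blast
  show ?thesis
  proof (rule stable_subquotient[OF G T stable Q, where P = "\<lambda>q y. \<exists>x. P q x \<and> y = ?\<pi> x"])
    fix q y assume "\<exists>x. P q x \<and> y = ?\<pi> x"
    then show "q \<in> carrier Q \<and> y \<in> carrier (restrict_scalars \<zeta> ?Y)" using Pc \<pi> by auto
  next
    show "\<exists>x. P \<zero>\<^bsub>Q\<^esub> x \<and> \<zero>\<^bsub>restrict_scalars \<zeta> ?Y\<^esub> = ?\<pi> x" using P0 zero by auto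
  next
    fix q y q' y' assume "\<exists>x. P q x \<and> y = ?\<pi> x" "\<exists>x. P q' x \<and> y' = ?\<pi> x"
    then obtain x x' where "P q x" "y = ?\<pi> x" "P q' x'" "y' = ?\<pi> x'" by blast
    then show "\<exists>x. P (q \<oplus>\<^bsub>Q\<^esub> q') x \<and> y \<oplus>\<^bsub>restrict_scalars \<zeta> ?Y\<^esub> y' = ?\<pi> x"
      using Padd \<pi>add Pc(2) by (intro exI[of _ "x \<oplus>\<^bsub>M\<^esub> x'"]) simp
  next
    fix r q y assume r: "r \<in> carrier (padic_ints p)" and "\<exists>x. P q x \<and> y = ?\<pi> x"
    then obtain x where "P q x" "y = ?\<pi> x" by blast
    then show "\<exists>x. P (r \<odot>\<^bsub>Q\<^esub> q) x \<and> r \<odot>\<^bsub>restrict_scalars \<zeta> ?Y\<^esub> y = ?\<pi> x"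
      using Psmult[OF r] \<pi>smult[OF funcset_mem[OF \<zeta> r]] Pc(2) by (intro exI[of _ "\<zeta> r \<odot>\<^bsub>M\<^esub> x"]) simp
  next
    fix g q y assume g: "g \<in> carrier G" and "\<exists>x. P q x \<and> y = ?\<pi> x"
    then obtain x where "P q x" "y = ?\<pi> x" by blast
    then show "\<exists>x. P (actQ g q) x \<and> quotient_action M S act g y = ?\<pi> x"
      using Pact[OF g] \<pi>act[OF g] Pc(2) by (intro exI[of _ "act g x"]) simp
  next
    fix q y y' assume "\<exists>x. P q x \<and> y = ?\<pi> x" "\<exists>x. P q x \<and> y' = ?\<pi> x"
    then obtain x x' where "P q x" "y = ?\<pi> x" "P q x'" "y' = ?\<pi> x'" by blast
    then show "y = y'" using Psingle M.coset_eq_iff[OF S' Pc(2) Pc(2)] by blast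
  next
    fix y assume "y \<in> carrier (restrict_scalars \<zeta> ?Y)"
    then obtain x where "x \<in> carrier M" "y = ?\<pi> x" using q(2) by auto
    then show "\<exists>q x. P q x \<and> y = ?\<pi> x" using Ptotal by blast
  qed
qed

text \<open>Restates the condition on the level of elements: \<open>\<phi>\<close> is the projection
  of \<open>M\<close> onto \<open>M / \<mm>^i M\<close> followed by the isomorphism with a member
  \<open>Q\<close> of \<open>\<C>\<close>. It is linear over the p-adic integers only, the ring over
  which \<open>Q\<close> is a module.\<close>

lemma module_satisfies_quotient_map:
  assumes G: "monoid G" and T: "topspace T = carrier G"
    and stable: "stable_condition p G T \<C>"
    and M: "group_ring_module G A M act" and A: "ring A" and \<mm>: "ideal \<mm> A"
    and \<zeta>: "\<zeta> \<in> carrier (padic_ints p) \<rightarrow> carrier A"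
    and sat: "module_satisfies p G \<C> A \<mm> \<zeta> M act" and i: "1 \<le> i"
  obtains Q actQ \<phi> where "(Q, actQ) \<in> \<C>" "\<phi> \<in> carrier M \<rightarrow> carrier Q" "\<phi> \<zero>\<^bsub>M\<^esub> = \<zero>\<^bsub>Q\<^esub>"
    "\<And>x y. x \<in> carrier M \<Longrightarrow> y \<in> carrier M \<Longrightarrow> \<phi> (x \<oplus>\<^bsub>M\<^esub> y) = \<phi> x \<oplus>\<^bsub>Q\<^esub> \<phi> y"
    "\<And>r x. r \<in> carrier (padic_ints p) \<Longrightarrow> x \<in> carrier M \<Longrightarrow> \<phi> (\<zeta> r \<odot>\<^bsub>M\<^esub> x) = r \<odot>\<^bsub>Q\<^esub> \<phi> x"
    "\<And>g x. g \<in> carrier G \<Longrightarrow> x \<in> carrier M \<Longrightarrow> \<phi> (act g x) = actQ g (\<phi> x)"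
    "\<And>x y. x \<in> carrier M \<Longrightarrow> y \<in> carrier M \<Longrightarrow> \<phi> x = \<phi> y \<Longrightarrow>
       x \<ominus>\<^bsub>M\<^esub> y \<in> smult_span (ideal_power A \<mm> i) M (carrier M)"
proof -
  define S where "S = smult_span (ideal_power A \<mm> i) M (carrier M)"
  interpret M: plain_module A M by (rule group_ring_moduleD(1)[OF M])
  have S: "group_ring_submodule G A M act S"
    unfolding S_def by (rule smult_span_group_ring_submodule[OF M ideal_power_ideal[OF A \<mm>]])
  then have S': "submodule S A M" by (simp add: group_ring_submodule_def)
  let ?\<pi> = "\<lambda>x. S +>\<^bsub>M\<^esub> x" and ?Y = "quotient_module M S"
  note q = quotient_rep_hom[OF M S]
  have \<pi>: "x \<in> carrier M \<Longrightarrow> ?\<pi> x \<in> carrier ?Y"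
    and \<pi>add: "x \<in> carrier M \<Longrightarrow> y \<in> carrier M \<Longrightarrow> ?\<pi> (x \<oplus>\<^bsub>M\<^esub> y) = ?\<pi> x \<oplus>\<^bsub>?Y\<^esub> ?\<pi> y"
    and \<pi>smult: "r \<in> carrier A \<Longrightarrow> x \<in> carrier M \<Longrightarrow> ?\<pi> (r \<odot>\<^bsub>M\<^esub> x) = r \<odot>\<^bsub>?Y\<^esub> ?\<pi> x"
    and \<pi>act: "g \<in> carrier G \<Longrightarrow> x \<in> carrier M \<Longrightarrow> ?\<pi> (act g x) = quotient_action M S act g (?\<pi> x)"
    for x y r g
    using q(1) by (auto simp: rep_hom_def linear_map_def)
  obtain Q actQ where Q: "(Q, actQ) \<in> \<C>"
    and iso: "group_ring_isomorphic G (padic_ints p)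
      (restrict_scalars \<zeta> (quotient_module M S)) (quotient_action M S act) Q actQ"
    using sat i unfolding module_satisfies_def Let_def S_def by blast
  obtain f where bij: "bij_betw f (carrier ?Y) (carrier Q)"
    and fadd: "\<And>x y. x \<in> carrier ?Y \<Longrightarrow> y \<in> carrier ?Y \<Longrightarrow> f (x \<oplus>\<^bsub>?Y\<^esub> y) = f x \<oplus>\<^bsub>Q\<^esub> f y"
    and fsmult: "\<And>r x. r \<in> carrier (padic_ints p) \<Longrightarrow> x \<in> carrier ?Y \<Longrightarrow> f (\<zeta> r \<odot>\<^bsub>?Y\<^esub> x) = r \<odot>\<^bsub>Q\<^esub> f x"
    and fact: "\<And>g x. g \<in> carrier G \<Longrightarrow> x \<in> carrier ?Y \<Longrightarrow> f (quotient_action M S act g x) = actQ g (f x)"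
    using iso unfolding group_ring_isomorphic_def restrict_scalars_simps by blast
  have "\<C> \<subseteq> finite_padic_reps p G T" using stable by (simp add: stable_condition_def)
  then have "finite_rep p G T Q actQ" using Q finite_padic_reps_iff[OF T] by blast
  then have "group_ring_module G (padic_ints p) Q actQ" by (simp add: finite_rep_def)
  then interpret Q: plain_module "padic_ints p" Q by (rule group_ring_moduleD(1))
  define \<phi> where "\<phi> x = f (?\<pi> x)" for x
  have \<phi>c: "\<phi> x \<in> carrier Q" if "x \<in> carrier M" for x
    unfolding \<phi>_def by (rule bij_betwE[OF bij, rule_format, OF \<pi>[OF that]])
  have \<phi>add: "\<phi> (x \<oplus>\<^bsub>M\<^esub> y) = \<phi> x \<oplus>\<^bsub>Q\<^esub> \<phi> y" if "x \<in> carrier M" "y \<in> carrier M" for x y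
    unfolding \<phi>_def \<pi>add[OF that] by (rule fadd[OF \<pi>[OF that(1)] \<pi>[OF that(2)]])
  show ?thesis
  proof (rule that[OF Q, of \<phi>])
    show "\<phi> \<in> carrier M \<rightarrow> carrier Q" using \<phi>c by blast
    show "\<phi> \<zero>\<^bsub>M\<^esub> = \<zero>\<^bsub>Q\<^esub>"
      using \<phi>add[of "\<zero>\<^bsub>M\<^esub>" "\<zero>\<^bsub>M\<^esub>"] \<phi>c[of "\<zero>\<^bsub>M\<^esub>"] Q.M.add.l_cancel_one[of "\<phi> \<zero>\<^bsub>M\<^esub>" "\<phi> \<zero>\<^bsub>M\<^esub>"] by simp
  next
    fix r x assume rx: "r \<in> carrier (padic_ints p)" "x \<in> carrier M"
    show "\<phi> (\<zeta> r \<odot>\<^bsub>M\<^esub> x) = r \<odot>\<^bsub>Q\<^esub> \<phi> x"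
      unfolding \<phi>_def \<pi>smult[OF funcset_mem[OF \<zeta> rx(1)] rx(2)] by (rule fsmult[OF rx(1) \<pi>[OF rx(2)]])
  next
    fix g x assume gx: "g \<in> carrier G" "x \<in> carrier M"
    show "\<phi> (act g x) = actQ g (\<phi> x)"
      unfolding \<phi>_def \<pi>act[OF gx] by (rule fact[OF gx(1) \<pi>[OF gx(2)]])
  next
    fix x y assume xy: "x \<in> carrier M" "y \<in> carrier M" and "\<phi> x = \<phi> y"
    then have "?\<pi> x = ?\<pi> y"
      using inj_onD[OF bij_betw_imp_inj_on[OF bij]] \<pi> unfolding \<phi>_def by blast
    then show "x \<ominus>\<^bsub>M\<^esub> y \<in> smult_span (ideal_power A \<mm> i) M (carrier M)"
      using M.coset_eq_iff[OF S' xy] unfolding S_def by blast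
  qed (rule \<phi>add)
qed

text \<open>\<open>w\<close> is the map from \<open>M^k\<close> to a member of \<open>\<C>\<close>
  isomorphic to a power of \<open>M / \<mm>^i M\<close>. Families are plain functions on
  \<open>nat\<close> constrained only below \<open>k\<close>; \<open>c\<close> restricts them to the
  extensional functions that make up the direct sum. This keeps restrictions out of the pointwise
  operations in the applications.\<close>

lemma module_satisfies_power_map:
  fixes k :: nat
  assumes G: "monoid G" and T: "topspace T = carrier G"
    and stable: "stable_condition p G T \<C>"
    and M: "group_ring_module G A M act" and A: "ring A" and \<mm>: "ideal \<mm> A"
    and \<zeta>: "\<zeta> \<in> carrier (padic_ints p) \<rightarrow> carrier A"
    and sat: "module_satisfies p G \<C> A \<mm> \<zeta> M act" and i: "1 \<le> i"
  obtains Q actQ w where "(Q, actQ) \<in> \<C>"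
    "w (\<lambda>_. \<zero>\<^bsub>M\<^esub>) = \<zero>\<^bsub>Q\<^esub>"
    "\<And>u. u \<in> {..<k} \<rightarrow> carrier M \<Longrightarrow> w u \<in> carrier Q"
    "\<And>u v. u \<in> {..<k} \<rightarrow> carrier M \<Longrightarrow> v \<in> {..<k} \<rightarrow> carrier M \<Longrightarrow>
       w (\<lambda>l. u l \<oplus>\<^bsub>M\<^esub> v l) = w u \<oplus>\<^bsub>Q\<^esub> w v"
    "\<And>r u. r \<in> carrier (padic_ints p) \<Longrightarrow> u \<in> {..<k} \<rightarrow> carrier M \<Longrightarrow>
       w (\<lambda>l. \<zeta> r \<odot>\<^bsub>M\<^esub> u l) = r \<odot>\<^bsub>Q\<^esub> w u"
    "\<And>g u. g \<in> carrier G \<Longrightarrow> u \<in> {..<k} \<rightarrow> carrier M \<Longrightarrow> w (\<lambda>l. act g (u l)) = actQ g (w u)"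
    "\<And>u v l. u \<in> {..<k} \<rightarrow> carrier M \<Longrightarrow> v \<in> {..<k} \<rightarrow> carrier M \<Longrightarrow> w u = w v \<Longrightarrow> l < k \<Longrightarrow>
       u l \<ominus>\<^bsub>M\<^esub> v l \<in> smult_span (ideal_power A \<mm> i) M (carrier M)"
proof -
  obtain Q actQ \<phi> where Q: "(Q, actQ) \<in> \<C>" and \<phi>: "\<phi> \<in> carrier M \<rightarrow> carrier Q" "\<phi> \<zero>\<^bsub>M\<^esub> = \<zero>\<^bsub>Q\<^esub>"
    and \<phi>add: "\<And>x y. x \<in> carrier M \<Longrightarrow> y \<in> carrier M \<Longrightarrow> \<phi> (x \<oplus>\<^bsub>M\<^esub> y) = \<phi> x \<oplus>\<^bsub>Q\<^esub> \<phi> y"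
    and \<phi>smult: "\<And>r x. r \<in> carrier (padic_ints p) \<Longrightarrow> x \<in> carrier M \<Longrightarrow> \<phi> (\<zeta> r \<odot>\<^bsub>M\<^esub> x) = r \<odot>\<^bsub>Q\<^esub> \<phi> x"
    and \<phi>act: "\<And>g x. g \<in> carrier G \<Longrightarrow> x \<in> carrier M \<Longrightarrow> \<phi> (act g x) = actQ g (\<phi> x)"
    and \<phi>ker: "\<And>x y. x \<in> carrier M \<Longrightarrow> y \<in> carrier M \<Longrightarrow> \<phi> x = \<phi> y \<Longrightarrow>
       x \<ominus>\<^bsub>M\<^esub> y \<in> smult_span (ideal_power A \<mm> i) M (carrier M)"
  proof (rule module_satisfies_quotient_map[OF G T stable M A \<mm> \<zeta> sat i], goal_cases)
    case (1 Q actQ \<phi>)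
    show thesis by (rule 1(1)[OF 1(2-4)]) (rule 1(5-8); assumption)+
  qed
  let ?D = "direct_sum_module k (\<lambda>_. Q)"
  obtain Q' act' \<delta> where Q': "(Q', act') \<in> \<C>"
    and \<delta>: "rep_hom G (padic_ints p) ?D (direct_sum_action k (\<lambda>_. actQ)) Q' act' \<delta>"
    and inj: "inj_on \<delta> (carrier ?D)" and \<delta>0: "\<delta> \<zero>\<^bsub>?D\<^esub> = \<zero>\<^bsub>Q'\<^esub>"
    by (rule stable_direct_power[OF G T stable Q, of k])
  have \<delta>l: "linear_map (padic_ints p) ?D Q' \<delta>"
    and \<delta>a: "\<And>g x. g \<in> carrier G \<Longrightarrow> x \<in> carrier ?D \<Longrightarrow>
      \<delta> (direct_sum_action k (\<lambda>_. actQ) g x) = act' g (\<delta> x)"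
    using \<delta> by (auto simp: rep_hom_def)
  note \<delta>D = linear_mapD[OF \<delta>l]
  define c where "c u = (\<lambda>l\<in>{..<k}. \<phi> (u l))" for u
  have uD: "u l \<in> carrier M" if "u \<in> {..<k} \<rightarrow> carrier M" "l < k" for u l
    using that by blast
  have cD: "c u \<in> carrier ?D" if "u \<in> {..<k} \<rightarrow> carrier M" for u
    using funcset_mem[OF \<phi>(1) uD[OF that]] by (simp add: c_def direct_sum_module_def)
  show ?thesis
  proof (rule that[OF Q', of "\<lambda>u. \<delta> (c u)"])
    have "c (\<lambda>_. \<zero>\<^bsub>M\<^esub>) = \<zero>\<^bsub>?D\<^esub>" by (simp add: c_def \<phi>(2) direct_sum_module_def)
    then show "\<delta> (c (\<lambda>_. \<zero>\<^bsub>M\<^esub>)) = \<zero>\<^bsub>Q'\<^esub>" using \<delta>0 by simp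
  next
    fix u assume "u \<in> {..<k} \<rightarrow> carrier M"
    then show "\<delta> (c u) \<in> carrier Q'" by (intro \<delta>D(1) cD)
  next
    fix u v assume u: "u \<in> {..<k} \<rightarrow> carrier M" and v: "v \<in> {..<k} \<rightarrow> carrier M"
    have "c (\<lambda>l. u l \<oplus>\<^bsub>M\<^esub> v l) = c u \<oplus>\<^bsub>?D\<^esub> c v"
      using uD[OF u] uD[OF v] by (simp add: c_def direct_sum_module_def \<phi>add cong: restrict_cong)
    then show "\<delta> (c (\<lambda>l. u l \<oplus>\<^bsub>M\<^esub> v l)) = \<delta> (c u) \<oplus>\<^bsub>Q'\<^esub> \<delta> (c v)"
      using \<delta>D(2)[OF cD[OF u] cD[OF v]] by simp
  next
    fix r u assume r: "r \<in> carrier (padic_ints p)" and u: "u \<in> {..<k} \<rightarrow> carrier M"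
    have "c (\<lambda>l. \<zeta> r \<odot>\<^bsub>M\<^esub> u l) = r \<odot>\<^bsub>?D\<^esub> c u"
      using uD[OF u] r by (simp add: c_def direct_sum_module_def \<phi>smult cong: restrict_cong)
    then show "\<delta> (c (\<lambda>l. \<zeta> r \<odot>\<^bsub>M\<^esub> u l)) = r \<odot>\<^bsub>Q'\<^esub> \<delta> (c u)"
      using \<delta>D(3)[OF r cD[OF u]] by simp
  next
    fix g u assume g: "g \<in> carrier G" and u: "u \<in> {..<k} \<rightarrow> carrier M"
    have "c (\<lambda>l. act g (u l)) = direct_sum_action k (\<lambda>_. actQ) g (c u)"
      using uD[OF u] g by (simp add: c_def direct_sum_action_def \<phi>act cong: restrict_cong)
    then show "\<delta> (c (\<lambda>l. act g (u l))) = act' g (\<delta> (c u))"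
      using \<delta>a[OF g cD[OF u]] by simp
  next
    fix u v l assume u: "u \<in> {..<k} \<rightarrow> carrier M" and v: "v \<in> {..<k} \<rightarrow> carrier M"
      and eq: "\<delta> (c u) = \<delta> (c v)" and l: "l < k"
    have "c u = c v" using inj_onD[OF inj eq cD[OF u] cD[OF v]] .
    then have "c u l = c v l" by simp
    then have "\<phi> (u l) = \<phi> (v l)" using l by (simp add: c_def)
    then show "u l \<ominus>\<^bsub>M\<^esub> v l \<in> smult_span (ideal_power A \<mm> i) M (carrier M)"
      by (rule \<phi>ker[OF uD[OF u l] uD[OF v l]])
  qed
qed

section \<open>Transfer of the condition along finite families of equivariant maps\<close>

lemma linear_map_finsum:
  assumes M: "plain_module R M" and N: "plain_module R N" and f: "linear_map R M N f"
    and u: "u \<in> I \<rightarrow> carrier M"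
  shows "f (\<Oplus>\<^bsub>M\<^esub>l\<in>I. u l) = (\<Oplus>\<^bsub>N\<^esub>l\<in>I. f (u l))"
proof -
  interpret M: plain_module R M by fact
  interpret N: plain_module R N by fact
  show ?thesis
    using u
  proof (induction I rule: infinite_finite_induct)
    case (insert l I)
    then have u: "u l \<in> carrier M" "u \<in> I \<rightarrow> carrier M" by auto
    moreover have "(\<lambda>l. f (u l)) \<in> I \<rightarrow> carrier N" "f (u l) \<in> carrier N"
      using u linear_mapD(1)[OF f] by auto
    ultimately show ?case
      using insert by (simp add: linear_mapD(2)[OF f] M.M.finsum_closed)
  qed (simp_all add: linear_map_zero[OF M N f])
qed

lemma (in plain_module) finsum_in_submodule:
  assumes S: "submodule S R M" and u: "u \<in> I \<rightarrow> S"
  shows "(\<Oplus>\<^bsub>M\<^esub>l\<in>I. u l) \<in> S"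
  using u
proof (induction I rule: infinite_finite_induct)
  case (insert l I)
  then have "u l \<in> carrier M" "u \<in> I \<rightarrow> carrier M" "u l \<in> S" "u \<in> I \<rightarrow> S"
    using submoduleE(1)[OF S] by auto
  then show ?case using insert by (simp add: submoduleE(5)[OF S])
qed (simp_all add: submodule_zero[OF S])

lemma module_satisfies_of_jointly_injective:
  fixes f :: "nat \<Rightarrow> 'e \<Rightarrow> 'm"
  assumes G: "monoid G" and T: "topspace T = carrier G"
    and stable: "stable_condition p G T \<C>"
    and E: "group_ring_module G A E actE" and M: "group_ring_module G A M actM"
    and A: "noetherian_ring A" and \<mm>: "ideal \<mm> A"
    and \<zeta>: "\<zeta> \<in> carrier (padic_ints p) \<rightarrow> carrier A"
    and noeth: "noetherian_on A M (carrier M)"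
    and f: "\<And>l. l < k \<Longrightarrow> rep_hom G A E actE M actM (f l)"
    and inj: "\<And>e e'. e \<in> carrier E \<Longrightarrow> e' \<in> carrier E \<Longrightarrow> (\<And>l. l < k \<Longrightarrow> f l e = f l e') \<Longrightarrow> e = e'"
    and sat: "module_satisfies p G \<C> A \<mm> \<zeta> M actM"
  shows "module_satisfies p G \<C> A \<mm> \<zeta> E actE"
  unfolding module_satisfies_def Let_def
proof (intro allI impI)
  fix i :: nat assume "1 \<le> i"
  note E' = group_ring_moduleD(1)[OF E] and M' = group_ring_moduleD(1)[OF M]
  interpret M: plain_module A M by (rule M')
  interpret E: plain_module A E by (rule E')
  have fl: "linear_map A E M (f l)" if "l < k" for l using f[OF that] by (simp add: rep_hom_def)
  have fa: "f l (actE g e) = actM g (f l e)" if "l < k" "g \<in> carrier G" "e \<in> carrier E" for l g e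
    using f[OF that(1)] that by (simp add: rep_hom_def)
  note fD = linear_mapD[OF fl]
  have ring: "ring A" by (rule noetherian_ring.axioms(1)[OF A])
  obtain n where n: "\<And>e. e \<in> carrier E \<Longrightarrow>
      (\<And>l. l < k \<Longrightarrow> f l e \<in> smult_span (ideal_power A \<mm> n) M (carrier M)) \<Longrightarrow>
      \<exists>e'\<in>smult_span (ideal_power A \<mm> i) E (carrier E). \<forall>l<k. f l e = f l e'"
    using artin_rees_family[where f = f and k = k and i = i, OF E' M' fl A noeth \<mm>] by blast
  let ?S = "smult_span (ideal_power A \<mm> i) E (carrier E)"
  have S: "group_ring_submodule G A E actE ?S"
    by (rule smult_span_group_ring_submodule[OF E ideal_power_ideal[OF ring \<mm>]])
  then have S': "submodule ?S A E" by (simp add: group_ring_submodule_def)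
  \<comment> \<open>The exponent is \<open>Suc n\<close> because \<open>module_satisfies\<close>
    speaks of exponents at least 1, while Artin-Rees may return 0. Artin-Rees yields only an
    \<open>e'\<close> in \<open>?S\<close> with the same images as \<open>e\<close>; joint
    injectivity identifies the two.\<close>
  have kernel: "e \<in> ?S"
    if e: "e \<in> carrier E" and fe: "\<And>l. l < k \<Longrightarrow> f l e \<in> smult_span (ideal_power A \<mm> (Suc n)) M (carrier M)" for e
  proof -
    have "f l e \<in> smult_span (ideal_power A \<mm> n) M (carrier M)" if "l < k" for l
      by (rule subsetD[OF smult_span_mono[OF M' ideal_power_antimono[OF ring \<mm>] subset_refl] fe[OF that]]) simp
    then obtain e' where e': "e' \<in> ?S" "\<And>l. l < k \<Longrightarrow> f l e = f l e'" using n[OF e] by blast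
    then have "e = e'" using inj[OF e] E.submoduleE(1)[OF S'] by blast
    then show ?thesis using e' by simp
  qed
  obtain Q actQ w where Q: "(Q, actQ) \<in> \<C>" and w0: "w (\<lambda>_. \<zero>\<^bsub>M\<^esub>) = \<zero>\<^bsub>Q\<^esub>"
    and wc: "\<And>u. u \<in> {..<k} \<rightarrow> carrier M \<Longrightarrow> w u \<in> carrier Q"
    and wadd: "\<And>u v. u \<in> {..<k} \<rightarrow> carrier M \<Longrightarrow> v \<in> {..<k} \<rightarrow> carrier M \<Longrightarrow>
       w (\<lambda>l. u l \<oplus>\<^bsub>M\<^esub> v l) = w u \<oplus>\<^bsub>Q\<^esub> w v"
    and wsmult: "\<And>r u. r \<in> carrier (padic_ints p) \<Longrightarrow> u \<in> {..<k} \<rightarrow> carrier M \<Longrightarrow>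
       w (\<lambda>l. \<zeta> r \<odot>\<^bsub>M\<^esub> u l) = r \<odot>\<^bsub>Q\<^esub> w u"
    and wact: "\<And>g u. g \<in> carrier G \<Longrightarrow> u \<in> {..<k} \<rightarrow> carrier M \<Longrightarrow> w (\<lambda>l. actM g (u l)) = actQ g (w u)"
    and wker: "\<And>u v l. u \<in> {..<k} \<rightarrow> carrier M \<Longrightarrow> v \<in> {..<k} \<rightarrow> carrier M \<Longrightarrow> w u = w v \<Longrightarrow> l < k \<Longrightarrow>
       u l \<ominus>\<^bsub>M\<^esub> v l \<in> smult_span (ideal_power A \<mm> (Suc n)) M (carrier M)"
  proof (rule module_satisfies_power_map[OF G T stable M ring \<mm> \<zeta> sat, of "Suc n" k], goal_cases)
    case 1
    show ?case by simp
  next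
    case (2 Q actQ w)
    show thesis by (rule 2(1)[of Q actQ w, OF 2(2,3)]) (rule 2(4-8); assumption)+
  qed
  \<comment> \<open>the equation for \<open>w (\<lambda>_. \<zero>)\<close> also fixes the values at \<open>l \<ge> k\<close>\<close>
  define F where "F e = (\<lambda>l. if l < k then f l e else \<zero>\<^bsub>M\<^esub>)" for e
  have F: "F e \<in> {..<k} \<rightarrow> carrier M" if "e \<in> carrier E" for e
    using fD(1) that by (simp add: F_def)
  have actE: "actE g e \<in> carrier E" if "g \<in> carrier G" "e \<in> carrier E" for g e
    by (rule linear_mapD(1)[OF group_ring_moduleD(2)[OF E that(1)] that(2)])
  have act0: "actM g \<zero>\<^bsub>M\<^esub> = \<zero>\<^bsub>M\<^esub>" if "g \<in> carrier G" for g
    by (rule linear_map_zero[OF M' M' group_ring_moduleD(2)[OF M that]])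
  \<comment> \<open>This is the converse of the graph of \<open>e \<mapsto> w (F e)\<close>. It is
    total on \<open>E\<close> by construction, and \<open>kernel\<close> makes it single-valued
    modulo \<open>?S\<close>: equal values of \<open>w\<close> mean that all the images of
    \<open>e - e'\<close> are small.\<close>
  have "subquotient_relation p G \<zeta> Q actQ E actE ?S (\<lambda>q e. e \<in> carrier E \<and> q = w (F e))"
    unfolding subquotient_relation_def
  proof (intro conjI allI ballI impI; (elim conjE)?)
    fix q e assume e: "e \<in> carrier E" "q = w (F e)"
    show "q \<in> carrier Q" "e \<in> carrier E" using e wc[OF F] by auto
  next
    have "F \<zero>\<^bsub>E\<^esub> = (\<lambda>_. \<zero>\<^bsub>M\<^esub>)" by (auto simp: F_def linear_map_zero[OF E' M' fl])
    then show "\<zero>\<^bsub>Q\<^esub> = w (F \<zero>\<^bsub>E\<^esub>)" using w0 by simp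
  next
    fix q e q' e' assume e: "e \<in> carrier E" "q = w (F e)" "e' \<in> carrier E" "q' = w (F e')"
    show "e \<oplus>\<^bsub>E\<^esub> e' \<in> carrier E" using e by simp
    have "F (e \<oplus>\<^bsub>E\<^esub> e') = (\<lambda>l. F e l \<oplus>\<^bsub>M\<^esub> F e' l)"
      using e by (auto simp: F_def fD(2))
    then show "q \<oplus>\<^bsub>Q\<^esub> q' = w (F (e \<oplus>\<^bsub>E\<^esub> e'))" using e wadd[OF F F] by simp
  next
    fix r q e assume r: "r \<in> carrier (padic_ints p)" and e: "e \<in> carrier E" "q = w (F e)"
    have \<zeta>r: "\<zeta> r \<in> carrier A" by (rule funcset_mem[OF \<zeta> r])
    show "\<zeta> r \<odot>\<^bsub>E\<^esub> e \<in> carrier E" using \<zeta>r e by simp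
    have "F (\<zeta> r \<odot>\<^bsub>E\<^esub> e) = (\<lambda>l. \<zeta> r \<odot>\<^bsub>M\<^esub> F e l)"
      using e \<zeta>r by (auto simp: F_def fD(3))
    then show "r \<odot>\<^bsub>Q\<^esub> q = w (F (\<zeta> r \<odot>\<^bsub>E\<^esub> e))" using e wsmult[OF r F] by simp
  next
    fix g q e assume g: "g \<in> carrier G" and e: "e \<in> carrier E" "q = w (F e)"
    show "actE g e \<in> carrier E" by (rule actE[OF g e(1)])
    have "F (actE g e) = (\<lambda>l. actM g (F e l))"
      using e g by (auto simp: F_def fa act0)
    then show "actQ g q = w (F (actE g e))" using e wact[OF g F] by simp
  next
    fix q e e' assume e: "e \<in> carrier E" "q = w (F e)" and e': "e' \<in> carrier E" "q = w (F e')"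
    have "f l (e \<ominus>\<^bsub>E\<^esub> e') \<in> smult_span (ideal_power A \<mm> (Suc n)) M (carrier M)" if l: "l < k" for l
    proof -
      have "f l (e \<ominus>\<^bsub>E\<^esub> e') = F e l \<ominus>\<^bsub>M\<^esub> F e' l"
        using l e e' by (simp add: F_def a_minus_def fD(2) linear_map_minus[OF E' M' fl])
      then show ?thesis using wker[OF F[OF e(1)] F[OF e'(1)] _ l] e(2) e'(2) by simp
    qed
    then show "e \<ominus>\<^bsub>E\<^esub> e' \<in> ?S" using e e' by (intro kernel) auto
  qed auto
  then show "\<exists>(Q, act') \<in> \<C>. group_ring_isomorphic G (padic_ints p)
      (restrict_scalars \<zeta> (quotient_module E ?S)) (quotient_action E ?S actE) Q act'"
    by (rule stable_subquotient_relation[OF G T stable Q E S \<zeta>])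
qed

text \<open>The exponent \<open>i\<close> is kept: the sum map \<open>L\<close> from
  \<open>E^k\<close> to \<open>M\<close> is \<open>A\<close>-linear, so it carries families from
  \<open>\<mm>^i E\<close> into \<open>\<mm>^i M\<close> and induces a map between the
  reductions.\<close>

lemma module_satisfies_of_jointly_surjective:
  fixes f :: "nat \<Rightarrow> 'e \<Rightarrow> 'm"
  assumes G: "monoid G" and T: "topspace T = carrier G"
    and stable: "stable_condition p G T \<C>"
    and E: "group_ring_module G A E actE" and M: "group_ring_module G A M actM"
    and ring: "ring A" and \<mm>: "ideal \<mm> A"
    and \<zeta>: "\<zeta> \<in> carrier (padic_ints p) \<rightarrow> carrier A"
    and f: "\<And>l. l < k \<Longrightarrow> rep_hom G A E actE M actM (f l)"
    and surj: "\<And>x. x \<in> carrier M \<Longrightarrow> \<exists>u \<in> {..<k} \<rightarrow> carrier E. x = (\<Oplus>\<^bsub>M\<^esub>l\<in>{..<k}. f l (u l))"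
    and sat: "module_satisfies p G \<C> A \<mm> \<zeta> E actE"
  shows "module_satisfies p G \<C> A \<mm> \<zeta> M actM"
  unfolding module_satisfies_def Let_def
proof (intro allI impI)
  fix i :: nat assume i: "1 \<le> i"
  note E' = group_ring_moduleD(1)[OF E] and M' = group_ring_moduleD(1)[OF M]
  interpret M: plain_module A M by (rule M')
  interpret E: plain_module A E by (rule E')
  have fl: "linear_map A E M (f l)" if "l < k" for l using f[OF that] by (simp add: rep_hom_def)
  have fa: "f l (actE g e) = actM g (f l e)" if "l < k" "g \<in> carrier G" "e \<in> carrier E" for l g e
    using f[OF that(1)] that by (simp add: rep_hom_def)
  note fD = linear_mapD[OF fl]
  let ?SE = "smult_span (ideal_power A \<mm> i) E (carrier E)"
  let ?S = "smult_span (ideal_power A \<mm> i) M (carrier M)"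
  have Ii: "ideal (ideal_power A \<mm> i) A" by (rule ideal_power_ideal[OF ring \<mm>])
  have S: "group_ring_submodule G A M actM ?S" by (rule smult_span_group_ring_submodule[OF M Ii])
  then have S': "submodule ?S A M" by (simp add: group_ring_submodule_def)
  obtain Q actQ w where Q: "(Q, actQ) \<in> \<C>" and w0: "w (\<lambda>_. \<zero>\<^bsub>E\<^esub>) = \<zero>\<^bsub>Q\<^esub>"
    and wc: "\<And>u. u \<in> {..<k} \<rightarrow> carrier E \<Longrightarrow> w u \<in> carrier Q"
    and wadd: "\<And>u v. u \<in> {..<k} \<rightarrow> carrier E \<Longrightarrow> v \<in> {..<k} \<rightarrow> carrier E \<Longrightarrow>
       w (\<lambda>l. u l \<oplus>\<^bsub>E\<^esub> v l) = w u \<oplus>\<^bsub>Q\<^esub> w v"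
    and wsmult: "\<And>r u. r \<in> carrier (padic_ints p) \<Longrightarrow> u \<in> {..<k} \<rightarrow> carrier E \<Longrightarrow>
       w (\<lambda>l. \<zeta> r \<odot>\<^bsub>E\<^esub> u l) = r \<odot>\<^bsub>Q\<^esub> w u"
    and wact: "\<And>g u. g \<in> carrier G \<Longrightarrow> u \<in> {..<k} \<rightarrow> carrier E \<Longrightarrow> w (\<lambda>l. actE g (u l)) = actQ g (w u)"
    and wker: "\<And>u v l. u \<in> {..<k} \<rightarrow> carrier E \<Longrightarrow> v \<in> {..<k} \<rightarrow> carrier E \<Longrightarrow> w u = w v \<Longrightarrow> l < k \<Longrightarrow>
       u l \<ominus>\<^bsub>E\<^esub> v l \<in> ?SE"
  proof (rule module_satisfies_power_map[OF G T stable E ring \<mm> \<zeta> sat i, of k], goal_cases)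
    case (1 Q actQ w)
    show thesis by (rule 1(1)[of Q actQ w, OF 1(2,3)]) (rule 1(4-8); assumption)+
  qed
  define L where "L u = (\<Oplus>\<^bsub>M\<^esub>l\<in>{..<k}. f l (u l))" for u
  have uD: "u l \<in> carrier E" if "u \<in> {..<k} \<rightarrow> carrier E" "l < k" for u l using that by blast
  have fu: "(\<lambda>l. f l (u l)) \<in> {..<k} \<rightarrow> carrier M" if "u \<in> {..<k} \<rightarrow> carrier E" for u
    using fD(1) uD[OF that] by simp
  have Lc: "L u \<in> carrier M" if "u \<in> {..<k} \<rightarrow> carrier E" for u
    unfolding L_def by (rule M.M.finsum_closed[OF fu[OF that]])
  have Ladd: "L (\<lambda>l. u l \<oplus>\<^bsub>E\<^esub> v l) = L u \<oplus>\<^bsub>M\<^esub> L v"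
    if "u \<in> {..<k} \<rightarrow> carrier E" "v \<in> {..<k} \<rightarrow> carrier E" for u v
  proof -
    have "L (\<lambda>l. u l \<oplus>\<^bsub>E\<^esub> v l) = (\<Oplus>\<^bsub>M\<^esub>l\<in>{..<k}. f l (u l) \<oplus>\<^bsub>M\<^esub> f l (v l))"
      unfolding L_def
    proof (rule M.M.finsum_cong'[OF refl])
      show "(\<lambda>l. f l (u l) \<oplus>\<^bsub>M\<^esub> f l (v l)) \<in> {..<k} \<rightarrow> carrier M"
        using fu[OF that(1)] fu[OF that(2)] by auto
    qed (use uD[OF that(1)] uD[OF that(2)] fD(2) in simp)
    then show ?thesis
      using M.M.finsum_addf[OF fu[OF that(1)] fu[OF that(2)]] by (simp add: L_def)
  qed
  \<comment> \<open>\<open>b\<close> and \<open>c\<close> are an operation on \<open>E\<close> and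
    its counterpart on \<open>M\<close>: below, scaling by \<open>\<zeta> r\<close> and the action
    of a group element.\<close>
  have Llin: "L (\<lambda>l. b (u l)) = c (L u)"
    if u: "u \<in> {..<k} \<rightarrow> carrier E" and c: "linear_map A M M c"
      and bc: "\<And>l e. l < k \<Longrightarrow> e \<in> carrier E \<Longrightarrow> f l (b e) = c (f l e)" for u b c
  proof -
    have "L (\<lambda>l. b (u l)) = (\<Oplus>\<^bsub>M\<^esub>l\<in>{..<k}. c (f l (u l)))"
      unfolding L_def
    proof (rule M.M.finsum_cong'[OF refl])
      show "(\<lambda>l. c (f l (u l))) \<in> {..<k} \<rightarrow> carrier M"
        using linear_mapD(1)[OF c] fu[OF u] by blast
    qed (use bc uD[OF u] in simp)
    then show ?thesis
      using linear_map_finsum[OF M' M' c fu[OF u]] by (simp add: L_def)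
  qed
  have Lsub: "L u \<ominus>\<^bsub>M\<^esub> L v \<in> ?S"
    if u: "u \<in> {..<k} \<rightarrow> carrier E" and v: "v \<in> {..<k} \<rightarrow> carrier E" and "w u = w v" for u v
  proof -
    let ?d = "\<lambda>l. u l \<ominus>\<^bsub>E\<^esub> v l"
    have d: "?d \<in> {..<k} \<rightarrow> carrier E" using uD[OF u] uD[OF v] by simp
    have "f l (?d l) \<in> ?S" if l: "l < k" for l
    proof (rule linear_map_smult_span[OF E' M' fl[OF l] Ii _ subset_refl subset_refl])
      show "f l ` carrier E \<subseteq> carrier M" using fD(1)[OF l] by blast
      show "?d l \<in> ?SE" by (rule wker[OF u v \<open>w u = w v\<close> l])
    qed
    then have Ld: "L ?d \<in> ?S" unfolding L_def by (intro M.finsum_in_submodule[OF S']) simp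
    have "L u = L (\<lambda>l. ?d l \<oplus>\<^bsub>E\<^esub> v l)"
      unfolding L_def
    proof (rule M.M.finsum_cong'[OF refl])
      fix l assume "l \<in> {..<k}"
      then have "u l \<in> carrier E" "v l \<in> carrier E" using uD[OF u] uD[OF v] by auto
      then have "?d l \<oplus>\<^bsub>E\<^esub> v l = u l" by (simp add: a_minus_def E.M.a_assoc E.M.l_neg)
      then show "f l (u l) = f l (?d l \<oplus>\<^bsub>E\<^esub> v l)" by simp
    qed (use uD[OF u] uD[OF v] fD(1) in simp)
    also have "\<dots> = L ?d \<oplus>\<^bsub>M\<^esub> L v" by (rule Ladd[OF d v])
    finally have "L u \<ominus>\<^bsub>M\<^esub> L v = L ?d"
      using Lc[OF d] Lc[OF v] by (simp add: a_minus_def M.M.a_assoc M.M.r_neg)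
    then show ?thesis using Ld by simp
  qed
  let ?U = "{..<k} \<rightarrow> carrier E"
  \<comment> \<open>The same \<open>q\<close> may come from many families \<open>u\<close>; by
    \<open>Lsub\<close> their sums \<open>L u\<close> agree modulo \<open>?S\<close>. Totality on
    \<open>M\<close> is joint surjectivity.\<close>
  have "subquotient_relation p G \<zeta> Q actQ M actM ?S (\<lambda>q x. \<exists>u\<in>?U. q = w u \<and> x = L u)"
    unfolding subquotient_relation_def
  proof (intro conjI allI ballI impI; (elim conjE bexE)?)
    fix q x u assume "u \<in> ?U" "q = w u" "x = L u"
    then show "q \<in> carrier Q" "x \<in> carrier M" using wc Lc by auto
  next
    have "L (\<lambda>_. \<zero>\<^bsub>E\<^esub>) = (\<Oplus>\<^bsub>M\<^esub>l\<in>{..<k}. \<zero>\<^bsub>M\<^esub>)"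
      unfolding L_def by (rule M.M.finsum_cong'[OF refl]) (simp_all add: linear_map_zero[OF E' M' fl])
    then show "\<exists>u\<in>?U. \<zero>\<^bsub>Q\<^esub> = w u \<and> \<zero>\<^bsub>M\<^esub> = L u"
      using w0 by (intro bexI[of _ "\<lambda>_. \<zero>\<^bsub>E\<^esub>"]) (simp_all add: M.M.finsum_zero)
  next
    fix q x q' x' u u' assume u: "u \<in> ?U" "q = w u" "x = L u" and u': "u' \<in> ?U" "q' = w u'" "x' = L u'"
    then show "\<exists>u\<in>?U. q \<oplus>\<^bsub>Q\<^esub> q' = w u \<and> x \<oplus>\<^bsub>M\<^esub> x' = L u"
      using uD[OF u(1)] uD[OF u'(1)]
      by (intro bexI[of _ "\<lambda>l. u l \<oplus>\<^bsub>E\<^esub> u' l"]) (simp_all add: wadd Ladd)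
  next
    fix r q x u assume r: "r \<in> carrier (padic_ints p)" and u: "u \<in> ?U" "q = w u" "x = L u"
    have \<zeta>r: "\<zeta> r \<in> carrier A" by (rule funcset_mem[OF \<zeta> r])
    have "L (\<lambda>l. \<zeta> r \<odot>\<^bsub>E\<^esub> u l) = \<zeta> r \<odot>\<^bsub>M\<^esub> L u"
      by (rule Llin[OF u(1) M.linear_map_smult[OF \<zeta>r]]) (rule fD(3)[OF _ \<zeta>r])
    then show "\<exists>u\<in>?U. r \<odot>\<^bsub>Q\<^esub> q = w u \<and> \<zeta> r \<odot>\<^bsub>M\<^esub> x = L u"
      using uD[OF u(1)] u wsmult[OF r u(1)] \<zeta>r by (intro bexI[of _ "\<lambda>l. \<zeta> r \<odot>\<^bsub>E\<^esub> u l"]) simp_all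
  next
    fix g q x u assume g: "g \<in> carrier G" and u: "u \<in> ?U" "q = w u" "x = L u"
    have "L (\<lambda>l. actE g (u l)) = actM g (L u)"
      by (rule Llin[OF u(1) group_ring_moduleD(2)[OF M g]]) (rule fa[OF _ g])
    moreover have "(\<lambda>l. actE g (u l)) \<in> ?U"
      using linear_mapD(1)[OF group_ring_moduleD(2)[OF E g]] u(1) by blast
    ultimately show "\<exists>u\<in>?U. actQ g q = w u \<and> actM g x = L u"
      using u wact[OF g u(1)] by (intro bexI[of _ "\<lambda>l. actE g (u l)"]) simp_all
  next
    fix q x x' u u' assume "u \<in> ?U" "q = w u" "x = L u" "u' \<in> ?U" "q = w u'" "x' = L u'"
    then show "x \<ominus>\<^bsub>M\<^esub> x' \<in> ?S" using Lsub by simp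
  next
    fix x assume "x \<in> carrier M"
    then show "\<exists>q. \<exists>u\<in>?U. q = w u \<and> x = L u" using surj unfolding L_def by blast
  qed
  then show "\<exists>(Q, act') \<in> \<C>. group_ring_isomorphic G (padic_ints p)
      (restrict_scalars \<zeta> (quotient_module M ?S)) (quotient_action M ?S actM) Q act'"
    by (rule stable_subquotient_relation[OF G T stable Q M S \<zeta>])
qed

section \<open>Generators, faithfulness and orbit maps\<close>

lemma (in plain_module) smult_span_finsum:
  fixes k :: nat
  assumes n: "n \<in> {..<k} \<rightarrow> carrier M" and x: "x \<in> smult_span (carrier R) M (n ` {..<k})"
  shows "\<exists>a\<in>{..<k} \<rightarrow> carrier R. x = (\<Oplus>\<^bsub>M\<^esub>l\<in>{..<k}. a l \<odot>\<^bsub>M\<^esub> n l)"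
proof -
  let ?U = "{..<k} \<rightarrow> carrier R"
  define L where "L a = (\<Oplus>\<^bsub>M\<^esub>l\<in>{..<k}. a l \<odot>\<^bsub>M\<^esub> n l)" for a
  have aD: "a l \<in> carrier R" if "a \<in> ?U" "l < k" for a l using that by blast
  have nD: "n l \<in> carrier M" if "l < k" for l using n that by blast
  have an: "(\<lambda>l. a l \<odot>\<^bsub>M\<^esub> n l) \<in> {..<k} \<rightarrow> carrier M" if "a \<in> ?U" for a
    using aD[OF that] nD by simp
  have "submodule (L ` ?U) R M"
  proof (rule submoduleI_smult)
    show "L ` ?U \<subseteq> carrier M" unfolding L_def using M.finsum_closed[OF an] by blast
    have "L (\<lambda>_. \<zero>) = (\<Oplus>\<^bsub>M\<^esub>l\<in>{..<k}. \<zero>\<^bsub>M\<^esub>)"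
      unfolding L_def by (rule M.finsum_cong'[OF refl]) (simp_all add: nD)
    then have "\<zero>\<^bsub>M\<^esub> = L (\<lambda>_. \<zero>)" by (simp add: M.finsum_zero)
    then show "\<zero>\<^bsub>M\<^esub> \<in> L ` ?U" by (rule image_eqI[where f = L]) simp
  next
    fix x y assume "x \<in> L ` ?U" "y \<in> L ` ?U"
    then obtain a b where ab: "a \<in> ?U" "x = L a" "b \<in> ?U" "y = L b" by blast
    have "L (\<lambda>l. a l \<oplus> b l) = (\<Oplus>\<^bsub>M\<^esub>l\<in>{..<k}. a l \<odot>\<^bsub>M\<^esub> n l \<oplus>\<^bsub>M\<^esub> b l \<odot>\<^bsub>M\<^esub> n l)"
      unfolding L_def
      by (rule M.finsum_cong'[OF refl]) (simp_all add: aD[OF ab(1)] aD[OF ab(3)] nD smult_l_distr)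
    then have "x \<oplus>\<^bsub>M\<^esub> y = L (\<lambda>l. a l \<oplus> b l)"
      using M.finsum_addf[OF an[OF ab(1)] an[OF ab(3)]] ab by (simp add: L_def)
    then show "x \<oplus>\<^bsub>M\<^esub> y \<in> L ` ?U"
      by (rule image_eqI[where f = L]) (simp add: aD[OF ab(1)] aD[OF ab(3)])
  next
    fix r x assume r: "r \<in> carrier R" and "x \<in> L ` ?U"
    then obtain a where a: "a \<in> ?U" "x = L a" by blast
    have "r \<odot>\<^bsub>M\<^esub> x = (\<Oplus>\<^bsub>M\<^esub>l\<in>{..<k}. r \<odot>\<^bsub>M\<^esub> (a l \<odot>\<^bsub>M\<^esub> n l))"
      unfolding a(2) L_def by (rule finsum_smult_ldistr[OF finite_lessThan r an[OF a(1)]])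
    also have "\<dots> = L (\<lambda>l. r \<otimes> a l)"
      unfolding L_def
      by (rule M.finsum_cong'[OF refl]) (simp_all add: r aD[OF a(1)] nD smult_assoc1)
    finally show "r \<odot>\<^bsub>M\<^esub> x \<in> L ` ?U" by (rule image_eqI[where f = L]) (simp add: r aD[OF a(1)])
  qed
  then have "smult_span (carrier R) M (n ` {..<k}) \<subseteq> L ` ?U"
  proof (rule smult_span_minimal)
    fix c y assume c: "c \<in> carrier R" and "y \<in> n ` {..<k}"
    then obtain j where j: "j < k" "y = n j" by blast
    \<comment> \<open>The family \<open>n\<close> may repeat values, so the coefficient is placed at
      the one chosen index \<open>j\<close> and not at every index with value
      \<open>y\<close>.\<close>
    let ?a = "\<lambda>l. if j = l then c else \<zero>"
    have "L ?a = (\<Oplus>\<^bsub>M\<^esub>l\<in>{..<k}. if j = l then c \<odot>\<^bsub>M\<^esub> n l else \<zero>\<^bsub>M\<^esub>)"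
      unfolding L_def by (rule M.finsum_cong'[OF refl]) (simp_all add: nD c)
    also have "\<dots> = c \<odot>\<^bsub>M\<^esub> n j"
      by (rule M.finsum_singleton) (simp_all add: j nD c)
    finally have "c \<odot>\<^bsub>M\<^esub> y = L ?a" by (simp add: j(2))
    then show "c \<odot>\<^bsub>M\<^esub> y \<in> L ` ?U" by (rule image_eqI[where f = L]) (simp add: c)
  qed
  then show ?thesis using x unfolding L_def by blast
qed

text \<open>The difference \<open>d\<close> of the two elements kills \<open>S\<close>. As
  \<open>\<eta>\<close> has central image, the elements of \<open>N\<close> killed by
  \<open>d\<close> form an \<open>A\<close>-submodule, which therefore is all of \<open>N\<close>;
  faithfulness gives \<open>d = 0\<close>.\<close>

lemma faithful_eqI:
  assumes alg: "is_algebra A E \<eta>" and N: "left_module E N" and faithful: "faithful E N"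
    and gen: "S \<subseteq> carrier N" "carrier N = smult_span (carrier A) (restrict_scalars \<eta> N) S"
    and e: "e \<in> carrier E" "e' \<in> carrier E" and eq: "\<And>x. x \<in> S \<Longrightarrow> e \<odot>\<^bsub>N\<^esub> x = e' \<odot>\<^bsub>N\<^esub> x"
  shows "e = e'"
proof -
  interpret N: left_module E N by fact
  interpret NA: plain_module A "restrict_scalars \<eta> N" by (rule plain_module_restrict_scalars[OF alg N])
  have \<eta>: "\<And>r. r \<in> carrier A \<Longrightarrow> \<eta> r \<in> carrier E"
    and central: "\<And>r x. r \<in> carrier A \<Longrightarrow> x \<in> carrier E \<Longrightarrow> \<eta> r \<otimes>\<^bsub>E\<^esub> x = x \<otimes>\<^bsub>E\<^esub> \<eta> r"
    using alg by (auto simp: is_algebra_def dest: ring_hom_closed)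
  define d where "d = e \<ominus>\<^bsub>E\<^esub> e'"
  have d: "d \<in> carrier E" "d \<oplus>\<^bsub>E\<^esub> e' = e"
    using e by (simp_all add: d_def a_minus_def N.R.a_assoc N.R.l_neg)
  let ?K = "{x \<in> carrier N. d \<odot>\<^bsub>N\<^esub> x = \<zero>\<^bsub>N\<^esub>}"
  have d0: "d \<odot>\<^bsub>N\<^esub> \<zero>\<^bsub>N\<^esub> = \<zero>\<^bsub>N\<^esub>"
    using N.smult_r_distr[OF d(1), of "\<zero>\<^bsub>N\<^esub>" "\<zero>\<^bsub>N\<^esub>"] N.smult_closed[OF d(1), of "\<zero>\<^bsub>N\<^esub>"]
      N.M.add.l_cancel_one[of "d \<odot>\<^bsub>N\<^esub> \<zero>\<^bsub>N\<^esub>" "d \<odot>\<^bsub>N\<^esub> \<zero>\<^bsub>N\<^esub>"] by simp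
  have comm: "d \<odot>\<^bsub>N\<^esub> (\<eta> r \<odot>\<^bsub>N\<^esub> x) = \<eta> r \<odot>\<^bsub>N\<^esub> (d \<odot>\<^bsub>N\<^esub> x)" if "r \<in> carrier A" "x \<in> carrier N" for r x
    using that \<eta> d(1) central[OF that(1) d(1)] by (simp add: N.smult_assoc[symmetric])
  have K: "submodule ?K A (restrict_scalars \<eta> N)"
  proof (rule NA.submoduleI_smult)
    fix r x assume r: "r \<in> carrier A" and x: "x \<in> ?K"
    have "\<eta> r \<odot>\<^bsub>N\<^esub> \<zero>\<^bsub>N\<^esub> = \<zero>\<^bsub>N\<^esub>" using NA.smult_r_null[OF r] by simp
    then show "r \<odot>\<^bsub>restrict_scalars \<eta> N\<^esub> x \<in> ?K"
      using r x comm[OF r] \<eta>[OF r] by (simp add: N.smult_closed)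
  qed (auto simp: d0 d(1) N.smult_r_distr)
  have SK: "x \<in> ?K" if "x \<in> S" for x
  proof -
    have x: "x \<in> carrier N" using gen(1) that by blast
    have "d \<odot>\<^bsub>N\<^esub> x \<oplus>\<^bsub>N\<^esub> e' \<odot>\<^bsub>N\<^esub> x = e' \<odot>\<^bsub>N\<^esub> x"
      using N.smult_l_distr[OF d(1) e(2) x] d(2) eq[OF that] by simp
    then show ?thesis
      using x N.smult_closed[OF d(1) x] N.smult_closed[OF e(2) x] N.M.add.r_cancel_one by simp
  qed
  have "smult_span (carrier A) (restrict_scalars \<eta> N) S \<subseteq> ?K"
    by (rule NA.smult_span_minimal[OF K]) (rule NA.submoduleE(4)[OF K _ SK])
  then have "d = \<zero>\<^bsub>E\<^esub>" using faithful d(1) gen(2) unfolding faithful_def by blast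
  then show ?thesis using d(2) e(2) by simp
qed

text \<open>\<open>A\<close> and \<open>G\<close> both act through left multiplication by elements
  of \<open>E\<close>, so \<open>A\<close>-linearity and equivariance are two cases of associativity
  of the \<open>E\<close>-action.\<close>

lemma orbit_map_rep_hom:
  assumes alg: "is_algebra A E \<eta>" and N: "left_module E N"
    and \<rho>: "\<rho> \<in> hom G (units_of E)" and x: "x \<in> carrier N"
  shows "rep_hom G A (restrict_scalars \<eta> (regular_module E)) (\<lambda>g e. \<rho> g \<otimes>\<^bsub>E\<^esub> e)
           (restrict_scalars \<eta> N) (\<lambda>g y. \<rho> g \<odot>\<^bsub>N\<^esub> y) (\<lambda>e. e \<odot>\<^bsub>N\<^esub> x)"
proof -
  interpret N: left_module E N by fact
  have \<eta>: "\<And>r. r \<in> carrier A \<Longrightarrow> \<eta> r \<in> carrier E"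
    using alg by (auto simp: is_algebra_def dest: ring_hom_closed)
  have "\<rho> g \<in> carrier E" if "g \<in> carrier G" for g
    using hom_in_carrier[OF \<rho> that] by (simp add: units_of_carrier N.R.Units_closed)
  then show ?thesis
    using x \<eta> by (simp add: rep_hom_def linear_map_def N.smult_closed N.smult_l_distr N.smult_assoc)
qed

theorem theorem2p6p4:
  fixes p :: nat
    and G :: "'g monoid" and T :: "'g topology"
    and F :: "'f ring"
    and \<C> :: "'g padic_rep set"
    and A :: "'a ring" and \<mm> :: "'a set"
    and \<iota> :: "(nat \<Rightarrow> int) \<Rightarrow> (nat \<Rightarrow> 'f)" and \<psi> :: "(nat \<Rightarrow> 'f) \<Rightarrow> 'a"
    and E :: "'e ring" and \<eta> :: "'a \<Rightarrow> 'e" and \<rho> :: "'g \<Rightarrow> 'e"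
    and d :: nat and D :: "('a, 'e, 'u) poly_law"
    and N :: "('e, 'n) module"
  assumes "Factorial_Ring.prime p"
    and "profinite_group G T" and "mazur_Phi p G T"
    and "field F" and "finite (carrier F)" and "[p] \<cdot>\<^bsub>F\<^esub> \<one>\<^bsub>F\<^esub> = \<zero>\<^bsub>F\<^esub>"
    and "stable_condition p G T \<C>"
    and "\<iota> \<in> ring_hom (padic_ints p) (witt_ring p F)"
    and "CNL_witt_algebra p F A \<mm> \<psi>"
    and "cayley_hamilton_rep G T A \<mm> E \<eta> \<rho> d D"
    and "left_module E N" and "faithful E N"
    and "fin_gen_module A (restrict_scalars \<eta> N)"
  shows "module_satisfies p G \<C> A \<mm> (\<psi> \<circ> \<iota>) (restrict_scalars \<eta> N) (\<lambda>g x. \<rho> g \<odot>\<^bsub>N\<^esub> x)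
     \<longleftrightarrow> cayley_hamilton_rep_satisfies p G \<C> A \<mm> (\<psi> \<circ> \<iota>) E \<eta> \<rho>"
proof -
  let ?\<zeta> = "\<psi> \<circ> \<iota>" and ?N = "restrict_scalars \<eta> N" and ?E = "restrict_scalars \<eta> (regular_module E)"
  have G: "group G" and T: "topspace T = carrier G"
    using \<open>profinite_group G T\<close> by (auto simp: profinite_group_def topological_group_def)
  then have monoid: "monoid G" by (simp add: group.is_monoid)
  note stable = \<open>stable_condition p G T \<C>\<close>
  have A: "noetherian_ring A" and "maximalideal \<mm> A" and \<psi>: "\<psi> \<in> ring_hom (witt_ring p F) A"
    using \<open>CNL_witt_algebra p F A \<mm> \<psi>\<close> by (auto simp: CNL_witt_algebra_def complete_noetherian_local_def)
  then have ring: "ring A" and \<mm>: "ideal \<mm> A"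
    by (auto intro: noetherian_ring.axioms(1) maximalideal.axioms(1))
  have \<zeta>: "?\<zeta> \<in> carrier (padic_ints p) \<rightarrow> carrier A"
    using ring_hom_closed[OF \<open>\<iota> \<in> ring_hom _ _\<close>] ring_hom_closed[OF \<psi>] by simp
  have alg: "is_algebra A E \<eta>" and \<rho>: "\<rho> \<in> hom G (units_of E)"
    using \<open>cayley_hamilton_rep G T A \<mm> E \<eta> \<rho> d D\<close>
    by (simp_all add: cayley_hamilton_rep_def cayley_hamilton_algebra_def pseudorepresentation_def)
  then have "ring E" by (simp add: is_algebra_def)
  note N = \<open>left_module E N\<close>
  have gN: "group_ring_module G A ?N (\<lambda>g x. \<rho> g \<odot>\<^bsub>N\<^esub> x)"
    by (rule algebra_group_ring_module[OF alg N G \<rho>])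
  have gE: "group_ring_module G A ?E (\<lambda>g e. \<rho> g \<otimes>\<^bsub>E\<^esub> e)"
    using algebra_group_ring_module[OF alg left_module_regular[OF \<open>ring E\<close>] G \<rho>] by simp
  interpret N: plain_module A ?N by (rule group_ring_moduleD(1)[OF gN])
  obtain S where S: "finite S" "S \<subseteq> carrier N" "carrier N = smult_span (carrier A) ?N S"
    using \<open>fin_gen_module A ?N\<close> by (auto simp: fin_gen_module_def)
  have noeth: "noetherian_on A ?N (carrier ?N)"
    using N.noetherian_on_span[OF A S(1)] S(2,3) by simp
  obtain k :: nat and n where n: "S = n ` {..<k}"
    using finite_imp_nat_seg_image_inj_on[OF S(1)] by (auto simp: lessThan_def)
  have nN: "n l \<in> carrier N" if "l < k" for l using n S(2) that by blast
  have f: "rep_hom G A ?E (\<lambda>g e. \<rho> g \<otimes>\<^bsub>E\<^esub> e) ?N (\<lambda>g x. \<rho> g \<odot>\<^bsub>N\<^esub> x) (\<lambda>e. e \<odot>\<^bsub>N\<^esub> n l)"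
    if "l < k" for l
    by (rule orbit_map_rep_hom[OF alg N \<rho> nN[OF that]])
  have inj: "e = e'"
    if "e \<in> carrier ?E" "e' \<in> carrier ?E" "\<And>l. l < k \<Longrightarrow> e \<odot>\<^bsub>N\<^esub> n l = e' \<odot>\<^bsub>N\<^esub> n l" for e e'
    by (rule faithful_eqI[OF alg N \<open>faithful E N\<close> S(2,3)]) (use that n in auto)
  have surj: "\<exists>u \<in> {..<k} \<rightarrow> carrier ?E. x = (\<Oplus>\<^bsub>?N\<^esub>l\<in>{..<k}. u l \<odot>\<^bsub>N\<^esub> n l)"
    if "x \<in> carrier ?N" for x
  proof -
    have "n \<in> {..<k} \<rightarrow> carrier ?N" "x \<in> smult_span (carrier A) ?N (n ` {..<k})"
      using nN that S(3) n by auto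
    from N.smult_span_finsum[OF this] obtain a where a: "a \<in> {..<k} \<rightarrow> carrier A"
      "x = (\<Oplus>\<^bsub>?N\<^esub>l\<in>{..<k}. a l \<odot>\<^bsub>?N\<^esub> n l)" by blast
    \<comment> \<open>Coefficients in \<open>A\<close> suffice to generate \<open>N\<close>; their
      images under \<open>\<eta>\<close> supply the elements of \<open>E\<close> whose orbit maps
      sum to \<open>x\<close>.\<close>
    have "(\<lambda>l. \<eta> (a l)) \<in> {..<k} \<rightarrow> carrier ?E"
      using a(1) alg by (auto simp: is_algebra_def dest: ring_hom_closed)
    then show ?thesis using a(2) by (intro bexI[of _ "\<lambda>l. \<eta> (a l)"]) simp_all
  qed
  show ?thesis
    unfolding cayley_hamilton_rep_satisfies_def
  proof
    assume sat: "module_satisfies p G \<C> A \<mm> ?\<zeta> ?N (\<lambda>g x. \<rho> g \<odot>\<^bsub>N\<^esub> x)"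
    show "module_satisfies p G \<C> A \<mm> ?\<zeta> ?E (\<lambda>g e. \<rho> g \<otimes>\<^bsub>E\<^esub> e)"
      by (rule module_satisfies_of_jointly_injective[where f = "\<lambda>l e. e \<odot>\<^bsub>N\<^esub> n l" and k = k,
            OF monoid T stable gE gN A \<mm> \<zeta> noeth _ _ sat])
         (fact f, fact inj)
  next
    assume sat: "module_satisfies p G \<C> A \<mm> ?\<zeta> ?E (\<lambda>g e. \<rho> g \<otimes>\<^bsub>E\<^esub> e)"
    show "module_satisfies p G \<C> A \<mm> ?\<zeta> ?N (\<lambda>g x. \<rho> g \<odot>\<^bsub>N\<^esub> x)"
      by (rule module_satisfies_of_jointly_surjective[where f = "\<lambda>l e. e \<odot>\<^bsub>N\<^esub> n l" and k = k,
            OF monoid T stable gE gN ring \<mm> \<zeta> _ _ sat])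
         (fact f, fact surj)
  qed
qed

end
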